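(* Let $\mathbb{F}$ be a field, $\mathsf{R}=\mathbb{F}[x]$, and $0\neq h\in\mathsf{R}$. Let $\mathfrak{m} = \mathsf{R}f$ be the maximal ideal of $\mathsf{R}$ generated by the prime polynomial $f$, and let $\mathsf{U}(\mathfrak{m}) := \mathsf{A}_h\otimes_{\mathsf{R}}\mathsf{R}/\mathfrak{m}$ be the $\mathsf{A}_h$-module induced from the irreducible $\mathsf{R}$-module $\mathsf{R}/\mathfrak{m}$. Then the following hold: (i) $\mathsf{U}(\mathfrak{m}) = \mathsf{U}(\mathfrak{m})^{\mathfrak{m}}$ is a generalized weight module for $\mathsf{A}_h$. If $\mathfrak{m}$ is $\delta$-invariant, then $\mathsf{U}(\mathfrak{m}) = \mathsf{U}(\mathfrak{m})_{\mathfrak{m}}$ is a weight module for $\mathsf{A}_h$. (ii) If $f$ is a factor of $h$, then $\mathsf{U}(\mathfrak{m}) = \mathsf{U}(\mathfrak{m})_{\mathfrak{m}}$. For any monic prime polynomial $\bar g\in \mathsf{Q}_{\mathfrak{m}} = (\mathsf{R}/\mathfrak{m})[y]$, the quotient $\mathsf{L}(\mathfrak{m},\bar g) = \mathsf{U}(\mathfrak{m})/\bar g\,\mathsf{U}(\mathfrak{m})$ is an irreducible weight $\mathsf{A}_h$-module of dimension $\deg(f)\deg(\bar g)$ over $\mathbb{F}$, and any irreducible generalized weight module $\mathsf{V} = \mathsf{V}^{\mathfrak{m}}$ for $\mathsf{A}_h$ is isomorphic to $\mathsf{L}(\mathfrak{m},\bar g)$ for some monic prime polynomial $\bar g\in\mathsf{Q}_{\mathfrak{m}}$.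 (iii) If $\mathrm{char}(\mathbb{F})=0$ and $f$ is not a factor of $h$, then $\mathsf{U}(\mathfrak{m}) = \mathsf{U}(\mathfrak{m})^{\mathfrak{m}}$ is an irreducible generalized weight module for $\mathsf{A}_h$.
   Context: $\mathsf{A}_h$ is the unital associative $\mathbb{F}$-algebra with generators $x,y$ and defining relation $yx=xy+h$; throughout $h\neq 0$. It is a free left and right module over $\mathsf{R}=\mathbb{F}[x]$ with basis $\{y^n\mid n\geq 0\}$. Let $\delta(r)=r'h$ for $r\in\mathsf{R}$; an ideal $\mathfrak{n}$ of $\mathsf{R}$ is $\delta$-invariant if $\delta(\mathfrak{n})\subseteq\mathfrak{n}$. Modules are left modules; "prime polynomial" means irreducible polynomial. For an $\mathsf{A}_h$-module $\mathsf{M}$ and an ideal $\mathfrak{n}$ of $\mathsf{R}$, let $\mathsf{M}_{\mathfrak{n}}=\{v\in\mathsf{M}\mid \mathfrak{n}v=0\}$ and $\mathsf{M}^{\mathfrak{n}}=\{v\in\mathsf{M}\mid \mathfrak{n}^kv=0\text{ for some }k=k(v)\}$. $\mathsf{M}$ is a weight module (resp. generalized weight module) if $\mathsf{M}=\bigoplus_{\mathfrak{n}}\mathsf{M}_{\mathfrak{n}}$ (resp. $\mathsf{M}=\bigoplus_{\mathfrak{n}}\mathsf{M}^{\mathfrak{n}}$), the sums being over all maximal ideals $\mathfrak{n}$ of $\mathsf{R}$. $\mathsf{Q}_{\mathfrak{m}}=(\mathsf{R}/\mathfrak{m})[y]$ is the commutative polynomial ring in $y$ over the field $\mathsf{R}/\mathfrak{m}$.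 For $\bar g=\sum_i y^i\bar g_i\in\mathsf{Q}_{\mathfrak{m}}$ with $g_i\in\mathsf{R}$ lifting $\bar g_i$, put $g=\sum_i y^ig_i\in\mathsf{A}_h$ and $\bar g\,\mathsf{U}(\mathfrak{m}):=\{gw\mid w\in\mathsf{U}(\mathfrak{m})\}$; when $f$ divides $h$, this is an $\mathsf{A}_h$-submodule of $\mathsf{U}(\mathfrak{m})$ that depends only on $\bar g$ and not on the chosen lift. *)

theory Defs
  imports
    "HOL-Library.Poly_Mapping"
    "HOL-Computational_Algebra.Polynomial"
    "HOL-Algebra.Algebra"
    "HOL-Algebra.Algebraic_Closure_Type"
    "HOL-Algebra.Free_Abelian_Groups"
    "HOL-Algebra.Ideal_Product"
    "HOL-Algebra.Polynomial_Divisibility"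
    "Jordan_Normal_Form.Missing_VectorSpace"
begin

section \<open>Left modules over a not necessarily commutative ring\<close>

text \<open>The library locale \<^locale>\<open>Module.module\<close> requires a commutative ring of scalars; the axioms
  below are the same ones over an arbitrary ring. The fields \<^const>\<open>monoid.mult\<close> and
  \<^const>\<open>monoid.one\<close>, which a module record inherits from the ring record, are never looked at.\<close>

locale left_module = R?: ring R + M?: abelian_group M
  for R :: "('r, 'i) ring_scheme" (structure) and M :: "('r, 'm, 'k) module_scheme" (structure) +
  assumes smult_closed: "\<lbrakk>a \<in> carrier R; v \<in> carrier M\<rbrakk> \<Longrightarrow> a \<odot>\<^bsub>M\<^esub> v \<in> carrier M"
    and smult_l_distr: "\<lbrakk>a \<in> carrier R; b \<in> carrier R; v \<in> carrier M\<rbrakk>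
      \<Longrightarrow> (a \<oplus>\<^bsub>R\<^esub> b) \<odot>\<^bsub>M\<^esub> v = a \<odot>\<^bsub>M\<^esub> v \<oplus>\<^bsub>M\<^esub> b \<odot>\<^bsub>M\<^esub> v"
    and smult_r_distr: "\<lbrakk>a \<in> carrier R; v \<in> carrier M; w \<in> carrier M\<rbrakk>
      \<Longrightarrow> a \<odot>\<^bsub>M\<^esub> (v \<oplus>\<^bsub>M\<^esub> w) = a \<odot>\<^bsub>M\<^esub> v \<oplus>\<^bsub>M\<^esub> a \<odot>\<^bsub>M\<^esub> w"
    and smult_assoc: "\<lbrakk>a \<in> carrier R; b \<in> carrier R; v \<in> carrier M\<rbrakk>
      \<Longrightarrow> (a \<otimes>\<^bsub>R\<^esub> b) \<odot>\<^bsub>M\<^esub> v = a \<odot>\<^bsub>M\<^esub> (b \<odot>\<^bsub>M\<^esub> v)"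
    and smult_one: "v \<in> carrier M \<Longrightarrow> \<one>\<^bsub>R\<^esub> \<odot>\<^bsub>M\<^esub> v = v"

text \<open>\<^const>\<open>Module.submodule\<close> needs no commutativity: it is an additive subgroup closed under scalars.\<close>

definition irreducible_module :: "('r, 'i) ring_scheme \<Rightarrow> ('r, 'm, 'k) module_scheme \<Rightarrow> bool" where
  "irreducible_module R M \<longleftrightarrow> left_module R M \<and> carrier M \<noteq> {\<zero>\<^bsub>M\<^esub>} \<and>
     (\<forall>N. Module.submodule N R M \<longrightarrow> N = {\<zero>\<^bsub>M\<^esub>} \<or> N = carrier M)"

definition isomorphic_modules ::
  "('r, 'i) ring_scheme \<Rightarrow> ('r, 'm, 'k) module_scheme \<Rightarrow> ('r, 'n, 'l) module_scheme \<Rightarrow> bool" where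
  "isomorphic_modules R M N \<longleftrightarrow> (\<exists>\<phi> \<in> module_hom R M N. bij_betw \<phi> (carrier M) (carrier N))"

definition quotient_module :: "('r, 'm, 'k) module_scheme \<Rightarrow> 'm set \<Rightarrow> ('r, 'm set) module" where
  "quotient_module M N =
     \<lparr>carrier = a_rcosets\<^bsub>M\<^esub> N, monoid.mult = undefined, monoid.one = undefined,
      ring.zero = N, ring.add = set_add M, module.smult = (\<lambda>a C. \<Union>v\<in>C. N +>\<^bsub>M\<^esub> (a \<odot>\<^bsub>M\<^esub> v))\<rparr>"

definition regular_module :: "('r, 'i) ring_scheme \<Rightarrow> ('r, 'r) module" where
  "regular_module R =
     \<lparr>carrier = carrier R, monoid.mult = monoid.mult R, monoid.one = \<one>\<^bsub>R\<^esub>,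
      ring.zero = \<zero>\<^bsub>R\<^esub>, ring.add = ring.add R, module.smult = monoid.mult R\<rparr>"

definition is_direct_sum :: "('r, 'm, 'k) module_scheme \<Rightarrow> 'i set \<Rightarrow> ('i \<Rightarrow> 'm set) \<Rightarrow> bool" where
  "is_direct_sum M I N \<longleftrightarrow> (\<forall>i\<in>I. subgroup (N i) (add_monoid M)) \<and>
     (\<forall>v\<in>carrier M. \<exists>!u. u \<in> (\<Pi>\<^sub>E i\<in>I. N i) \<and> finite {i\<in>I. u i \<noteq> \<zero>\<^bsub>M\<^esub>} \<and>
        v = (\<Oplus>\<^bsub>M\<^esub> i\<in>{i\<in>I. u i \<noteq> \<zero>\<^bsub>M\<^esub>}. u i))"


section \<open>Induced modules\<close>

text \<open>For a ring homomorphism \<open>\<iota> : R \<rightarrow> S\<close> and a left \<open>R\<close>-module \<open>N\<close>, the left \<open>S\<close>-module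
  \<open>S \<otimes>\<^sub>R N\<close> is the free abelian group on \<open>S \<times> N\<close> modulo the subgroup generated by the
  relations of an \<open>R\<close>-balanced biadditive map; \<open>S\<close> acts on the first tensor factor.\<close>

definition tensor_relations ::
  "('r, 'i) ring_scheme \<Rightarrow> ('s, 'j) ring_scheme \<Rightarrow> ('r \<Rightarrow> 's) \<Rightarrow> ('r, 'n, 'k) module_scheme
     \<Rightarrow> (('s \<times> 'n) \<Rightarrow>\<^sub>0 int) set" where
  "tensor_relations R S \<iota> N =
     {frag_of (a \<oplus>\<^bsub>S\<^esub> b, v) - frag_of (a, v) - frag_of (b, v) | a b v.
        a \<in> carrier S \<and> b \<in> carrier S \<and> v \<in> carrier N} \<union>
     {frag_of (a, v \<oplus>\<^bsub>N\<^esub> w) - frag_of (a, v) - frag_of (a, w) | a v w.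
        a \<in> carrier S \<and> v \<in> carrier N \<and> w \<in> carrier N} \<union>
     {frag_of (a \<otimes>\<^bsub>S\<^esub> \<iota> r, v) - frag_of (a, r \<odot>\<^bsub>N\<^esub> v) | a r v.
        a \<in> carrier S \<and> r \<in> carrier R \<and> v \<in> carrier N}"

definition tensor_kernel ::
  "('r, 'i) ring_scheme \<Rightarrow> ('s, 'j) ring_scheme \<Rightarrow> ('r \<Rightarrow> 's) \<Rightarrow> ('r, 'n, 'k) module_scheme
     \<Rightarrow> (('s \<times> 'n) \<Rightarrow>\<^sub>0 int) set" where
  "tensor_kernel R S \<iota> N =
     generate (free_Abelian_group (carrier S \<times> carrier N)) (tensor_relations R S \<iota> N)"

definition induced_module ::
  "('r, 'i) ring_scheme \<Rightarrow> ('s, 'j) ring_scheme \<Rightarrow> ('r \<Rightarrow> 's) \<Rightarrow> ('r, 'n, 'k) module_scheme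
     \<Rightarrow> ('s, (('s \<times> 'n) \<Rightarrow>\<^sub>0 int) set) module" where
  "induced_module R S \<iota> N =
     (let G = free_Abelian_group (carrier S \<times> carrier N); K = tensor_kernel R S \<iota> N
      in \<lparr>carrier = carrier (G Mod K), monoid.mult = undefined, monoid.one = undefined,
          ring.zero = \<one>\<^bsub>G Mod K\<^esub>, ring.add = monoid.mult (G Mod K),
          module.smult = (\<lambda>a C. \<Union>c\<in>C. K #>\<^bsub>G\<^esub> frag_extend (\<lambda>(b, v). frag_of (a \<otimes>\<^bsub>S\<^esub> b, v)) c)\<rparr>)"


section \<open>The algebra \<open>A\<^sub>h\<close>\<close>

text \<open>The free algebra on two generators is the monoid algebra of the free monoid of words.
  The product of \<^typ>\<open>'m \<Rightarrow>\<^sub>0 'a\<close> is convolution with respect to addition on \<^typ>\<open>'m\<close>, so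
  concatenation of words is written additively; it is not commutative.\<close>

datatype generator = Gen_x | Gen_y

datatype xy_word = Word "generator list"

fun letters :: "xy_word \<Rightarrow> generator list" where
  "letters (Word w) = w"

instantiation xy_word :: monoid_add
begin

definition zero_xy_word :: xy_word where "0 = Word []"

definition plus_xy_word :: "xy_word \<Rightarrow> xy_word \<Rightarrow> xy_word" where
  "u + v = Word (letters u @ letters v)"

instance
proof
  fix a b c :: xy_word
  show "a + b + c = a + (b + c)" by (simp add: plus_xy_word_def)
  show "0 + a = a" by (cases a) (simp add: plus_xy_word_def zero_xy_word_def)
  show "a + 0 = a" by (cases a) (simp add: plus_xy_word_def zero_xy_word_def)
qed

end

type_synonym 'a free_xy = "xy_word \<Rightarrow>\<^sub>0 'a"

definition free_gen :: "generator \<Rightarrow> 'a::field free_xy" where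
  "free_gen g = Poly_Mapping.single (Word [g]) 1"

definition free_poly :: "'a::field poly \<Rightarrow> 'a free_xy" where
  "free_poly p = (\<Sum>i\<le>Polynomial.degree p.
     Poly_Mapping.single 0 (Polynomial.coeff p i) * free_gen Gen_x ^ i)"

text \<open>\<^const>\<open>genideal\<close> is the two-sided ideal generated by a set.\<close>

definition Ah_ideal :: "'a::field poly \<Rightarrow> 'a free_xy set" where
  "Ah_ideal h = genideal ring_of_type_algebra
     {free_gen Gen_y * free_gen Gen_x - (free_gen Gen_x * free_gen Gen_y + free_poly h)}"

definition Ah :: "'a::field poly \<Rightarrow> 'a free_xy set ring" where
  "Ah h = ring_of_type_algebra Quot Ah_ideal h"

definition Ah_y :: "'a::field poly \<Rightarrow> 'a free_xy set" where
  "Ah_y h = Ah_ideal h +>\<^bsub>ring_of_type_algebra\<^esub> free_gen Gen_y"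

text \<open>The embedding of \<open>R = F[x]\<close> into \<open>A\<^sub>h\<close>; on constant polynomials it is the
  \<open>F\<close>-algebra structure of \<open>A\<^sub>h\<close>.\<close>

definition Ah_poly :: "'a::field poly \<Rightarrow> 'a poly \<Rightarrow> 'a free_xy set" where
  "Ah_poly h r = Ah_ideal h +>\<^bsub>ring_of_type_algebra\<^esub> free_poly r"

type_synonym ('a, 'm) Ah_module = "('a free_xy set, 'm) module"


section \<open>Weight modules\<close>

abbreviation Fx :: "'a::field poly ring" where
  "Fx \<equiv> ring_of_type_algebra"

definition delta :: "'a::field poly \<Rightarrow> 'a poly \<Rightarrow> 'a poly" where
  "delta h r = pderiv r * h"

definition delta_invariant :: "'a::field poly \<Rightarrow> 'a poly set \<Rightarrow> bool" where
  "delta_invariant h n \<longleftrightarrow> delta h ` n \<subseteq> n"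

definition weight_space :: "'a::field poly \<Rightarrow> ('a, 'm) Ah_module \<Rightarrow> 'a poly set \<Rightarrow> 'm set" where
  "weight_space h M n = {v \<in> carrier M. \<forall>r\<in>n. Ah_poly h r \<odot>\<^bsub>M\<^esub> v = \<zero>\<^bsub>M\<^esub>}"

text \<open>The multiplication of \<^const>\<open>ideals_set\<close> is the product of ideals, so the power below is
  the power of an ideal.\<close>

definition gen_weight_space :: "'a::field poly \<Rightarrow> ('a, 'm) Ah_module \<Rightarrow> 'a poly set \<Rightarrow> 'm set" where
  "gen_weight_space h M n = {v \<in> carrier M.
     \<exists>k::nat. \<forall>r \<in> n [^]\<^bsub>ideals_set Fx\<^esub> k. Ah_poly h r \<odot>\<^bsub>M\<^esub> v = \<zero>\<^bsub>M\<^esub>}"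

definition weight_module :: "'a::field poly \<Rightarrow> ('a, 'm) Ah_module \<Rightarrow> bool" where
  "weight_module h M \<longleftrightarrow> left_module (Ah h) M \<and>
     is_direct_sum M {n. maximalideal n Fx} (weight_space h M)"

definition gen_weight_module :: "'a::field poly \<Rightarrow> ('a, 'm) Ah_module \<Rightarrow> bool" where
  "gen_weight_module h M \<longleftrightarrow> left_module (Ah h) M \<and>
     is_direct_sum M {n. maximalideal n Fx} (gen_weight_space h M)"

definition scalar_restriction :: "'a::field poly \<Rightarrow> ('a, 'm) Ah_module \<Rightarrow> ('a, 'm) module" where
  "scalar_restriction h M =
     \<lparr>carrier = carrier M, monoid.mult = undefined, monoid.one = undefined,
      ring.zero = \<zero>\<^bsub>M\<^esub>, ring.add = ring.add M, module.smult = (\<lambda>c v. Ah_poly h [:c:] \<odot>\<^bsub>M\<^esub> v)\<rparr>"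

text \<open>\<^const>\<open>vectorspace.dim\<close> is only meaningful for finite-dimensional spaces.\<close>

definition has_dimension :: "'a::field poly \<Rightarrow> ('a, 'm) Ah_module \<Rightarrow> nat \<Rightarrow> bool" where
  "has_dimension h M d \<longleftrightarrow>
     vectorspace ring_of_type_algebra (scalar_restriction h M) \<and>
     vectorspace.fin_dim ring_of_type_algebra (scalar_restriction h M) \<and>
     vectorspace.dim ring_of_type_algebra (scalar_restriction h M) = d"


section \<open>The modules \<open>U(m)\<close> and \<open>L(m, g)\<close>\<close>

type_synonym 'a U_elem = "(('a free_xy set \<times> 'a poly set) \<Rightarrow>\<^sub>0 int) set"

definition U :: "'a::field poly \<Rightarrow> 'a poly set \<Rightarrow> ('a, 'a U_elem) Ah_module" where
  "U h m = induced_module Fx (Ah h) (Ah_poly h) (quotient_module (regular_module Fx) m)"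

text \<open>Univariate polynomials of HOL-Algebra are lists of coefficients, leading coefficient first.\<close>

definition Q :: "'a::field poly set \<Rightarrow> 'a poly set list ring" where
  "Q m = poly_ring (Fx Quot m)"

definition monic_prime :: "'a::field poly set \<Rightarrow> 'a poly set list \<Rightarrow> bool" where
  "monic_prime m gbar \<longleftrightarrow> gbar \<in> carrier (Q m) \<and> ring_irreducible\<^bsub>Q m\<^esub> gbar \<and>
     Polynomials.lead_coeff gbar = \<one>\<^bsub>Fx Quot m\<^esub>"

text \<open>The elements \<open>g = \<Sum> y\<^sup>i g\<^sub>i\<close> of \<open>A\<^sub>h\<close> with \<open>g\<^sub>i \<in> R\<close> lifting the \<open>i\<close>-th
  coefficient of \<open>gbar\<close>; an element of \<open>R/m\<close> is a coset, i.e. the set of its lifts. Coefficients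
  beyond the degree of \<open>gbar\<close> are zero and may be lifted to nonzero elements of \<open>m\<close>.\<close>

definition lifts :: "'a::field poly \<Rightarrow> 'a poly set \<Rightarrow> 'a poly set list \<Rightarrow> 'a free_xy set set" where
  "lifts h m gbar =
     {\<Oplus>\<^bsub>Ah h\<^esub> i\<in>{..n}. (Ah_y h [^]\<^bsub>Ah h\<^esub> i) \<otimes>\<^bsub>Ah h\<^esub> Ah_poly h (g i) | n g.
        Polynomials.degree gbar \<le> n \<and> (\<forall>i\<le>n. g i \<in> ring.coeff (Fx Quot m) gbar i)}"

text \<open>The quotient of \<open>U(m)\<close> by \<open>gbar U(m) = g U(m)\<close>, where \<open>g\<close> is a lift of \<open>gbar\<close>.\<close>

definition L :: "'a::field poly \<Rightarrow> 'a poly set \<Rightarrow> 'a free_xy set \<Rightarrow> ('a, 'a U_elem set) Ah_module" where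
  "L h m g = quotient_module (U h m) {g \<odot>\<^bsub>U h m\<^esub> w | w. w \<in> carrier (U h m)}"

end

theory Submission
  imports Defs
begin

text \<open>The left regular module of \<open>A\<^sub>h\<close> is modelled on polynomials in \<open>y\<close> over \<open>F[x]\<close>. A cyclic module
  is a quotient of the model, its submodules are the subsets stable under \<open>y\<close> and under left
  multiplication by \<open>F[x]\<close>, and \<open>U(m)\<close> is the model modulo \<open>f\<close>. The relation \<open>f y = y f - \<delta>(f)\<close>
  decides everything. It makes \<open>f\<close> act locally nilpotently on \<open>U(m)\<close>, and by zero if \<open>m\<close> is
  \<open>\<delta>\<close>-invariant. If \<open>\<delta>(f) = f' h\<close> is invertible modulo \<open>f\<close> and the characteristic is zero, then
  \<open>f\<close> lowers the \<open>y\<close>-degree by exactly one, so every nonzero submodule of \<open>U(m)\<close> contains the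
  generator. If \<open>f\<close> divides \<open>h\<close>, left multiplication by \<open>r\<close> is multiplication of the coefficients by
  \<open>r\<close> modulo \<open>f\<close>, so the submodules of \<open>U(m)\<close> are the ideals of the principal ideal domain
  \<open>(R/m)[y]\<close>; an irreducible \<open>V = V\<^sup>m\<close> is generated by a vector killed by \<open>f\<close>, hence is a quotient of
  \<open>U(m)\<close> by a maximal one.\<close>

section \<open>Left modules, quotients and induced modules\<close>

text \<open>Both \<open>Ah h\<close> and \<open>U h m\<close> are given by generators and relations,
  so the obstacle is a lower bound: the definitions alone do not show that they fail to collapse.
  The bound comes from an explicit action on \<open>'a poly poly\<close>, where an element of A_h is
  written with the powers of y on the left and its coefficients in F[x] on the right. With this
  convention left multiplication by y is a shift and right multiplication by F[x] is
  coefficientwise; only left multiplication by F[x] is twisted by \<delta>. The left ideal A_h f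
  then appears as the multiples of the constant polynomial \<open>[:f:]\<close>. Modules with
  unrelated carrier types are never compared element by element. Each is described by a generator
  and the annihilator of that generator, a subset of the model (\<open>presented\<close>), and
  weights, irreducibility, isomorphism and dimension are read off from this subset. F[x] is not a
  field, so the dimension count needs a lift G of gbar to F[x][y] that is itself monic; division by
  G and reduction of coefficients modulo f give unique normal forms.\<close>

lemma (in left_module) smult_zero_right [simp]:
  assumes "a \<in> carrier R" shows "a \<odot>\<^bsub>M\<^esub> \<zero>\<^bsub>M\<^esub> = \<zero>\<^bsub>M\<^esub>"
proof -
  have "a \<odot>\<^bsub>M\<^esub> \<zero>\<^bsub>M\<^esub> \<oplus>\<^bsub>M\<^esub> a \<odot>\<^bsub>M\<^esub> \<zero>\<^bsub>M\<^esub> = a \<odot>\<^bsub>M\<^esub> \<zero>\<^bsub>M\<^esub>"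
    using smult_r_distr[of a "\<zero>\<^bsub>M\<^esub>" "\<zero>\<^bsub>M\<^esub>"] assms by simp
  then show ?thesis using smult_closed[OF assms] by (simp add: M.add.l_cancel_one)
qed

lemma (in left_module) smult_zero_left [simp]:
  assumes "v \<in> carrier M" shows "\<zero>\<^bsub>R\<^esub> \<odot>\<^bsub>M\<^esub> v = \<zero>\<^bsub>M\<^esub>"
proof -
  have "\<zero>\<^bsub>R\<^esub> \<odot>\<^bsub>M\<^esub> v \<oplus>\<^bsub>M\<^esub> \<zero>\<^bsub>R\<^esub> \<odot>\<^bsub>M\<^esub> v = \<zero>\<^bsub>R\<^esub> \<odot>\<^bsub>M\<^esub> v"
    using smult_l_distr[of "\<zero>\<^bsub>R\<^esub>" "\<zero>\<^bsub>R\<^esub>" v] assms by simp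
  then show ?thesis using smult_closed[OF R.zero_closed assms] by (simp add: M.add.l_cancel_one)
qed

lemma (in left_module) smult_a_inv_right:
  assumes "a \<in> carrier R" "v \<in> carrier M"
  shows "a \<odot>\<^bsub>M\<^esub> (\<ominus>\<^bsub>M\<^esub> v) = \<ominus>\<^bsub>M\<^esub> (a \<odot>\<^bsub>M\<^esub> v)"
proof -
  have "a \<odot>\<^bsub>M\<^esub> (\<ominus>\<^bsub>M\<^esub> v) \<oplus>\<^bsub>M\<^esub> a \<odot>\<^bsub>M\<^esub> v = \<zero>\<^bsub>M\<^esub>"
    using smult_r_distr[of a "\<ominus>\<^bsub>M\<^esub> v" v] assms by (simp add: M.l_neg)
  then show ?thesis using assms smult_closed M.minus_equality by simp
qed

lemma (in left_module) smult_a_inv_left: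
  assumes "a \<in> carrier R" "v \<in> carrier M"
  shows "(\<ominus>\<^bsub>R\<^esub> a) \<odot>\<^bsub>M\<^esub> v = \<ominus>\<^bsub>M\<^esub> (a \<odot>\<^bsub>M\<^esub> v)"
proof -
  have "(\<ominus>\<^bsub>R\<^esub> a) \<odot>\<^bsub>M\<^esub> v \<oplus>\<^bsub>M\<^esub> a \<odot>\<^bsub>M\<^esub> v = \<zero>\<^bsub>M\<^esub>"
    using smult_l_distr[of "\<ominus>\<^bsub>R\<^esub> a" a v] assms by (simp add: R.l_neg)
  then show ?thesis using assms smult_closed M.minus_equality by simp
qed

text \<open>The group laws see only carrier, product and unit. The additive group of a new module
  record thus inherits them from the group it was copied from, whose record has other extra
  fields.\<close>

lemma comm_group_change_extension:
  assumes "comm_group \<lparr>carrier = A, monoid.mult = m, monoid.one = e, \<dots> = r'\<rparr>"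
  shows "comm_group \<lparr>carrier = A, monoid.mult = m, monoid.one = e, \<dots> = r\<rparr>"
proof -
  interpret comm_group "\<lparr>carrier = A, monoid.mult = m, monoid.one = e, \<dots> = r'\<rparr>" by fact
  show ?thesis
  proof (rule comm_groupI, unfold monoid.simps partial_object.simps)
    show "m x y \<in> A" if "x \<in> A" "y \<in> A" for x y using m_closed that by simp
    show "e \<in> A" using one_closed by simp
    show "m (m x y) z = m x (m y z)" if "x \<in> A" "y \<in> A" "z \<in> A" for x y z
      using m_assoc that by simp
    show "m x y = m y x" if "x \<in> A" "y \<in> A" for x y using m_comm that by simp
    show "m e x = x" if "x \<in> A" for x using l_one that by simp
    show "\<exists>y\<in>A. m y x = e" if "x \<in> A" for x using l_inv_ex that by simp
  qed
qed

lemma abelian_group_iff_comm_group: "abelian_group M \<longleftrightarrow> comm_group (add_monoid M)"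
  by (auto simp: abelian_group_def abelian_monoid_def abelian_group_axioms_def comm_group_def)

lemma (in left_module) submodule_additive:
  "Module.submodule N R M \<Longrightarrow> abelian_subgroup N M"
  by (rule abelian_subgroupI3[OF additive_subgroup.intro M.abelian_group_axioms])
    (rule Module.submodule.axioms(1))

text \<open>Closure under inverses is automatic: \<open>- v = (- 1) v\<close>.\<close>

lemma (in left_module) submoduleI':
  assumes "N \<subseteq> carrier M" "\<zero>\<^bsub>M\<^esub> \<in> N"
    and "\<And>v w. \<lbrakk>v \<in> N; w \<in> N\<rbrakk> \<Longrightarrow> v \<oplus>\<^bsub>M\<^esub> w \<in> N"
    and "\<And>a v. \<lbrakk>a \<in> carrier R; v \<in> N\<rbrakk> \<Longrightarrow> a \<odot>\<^bsub>M\<^esub> v \<in> N"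
  shows "Module.submodule N R M"
proof -
  have inv: "\<ominus>\<^bsub>M\<^esub> v \<in> N" if "v \<in> N" for v
    using assms(4)[of "\<ominus>\<^bsub>R\<^esub> \<one>\<^bsub>R\<^esub>" v] that assms(1) by (auto simp: smult_a_inv_left smult_one)
  have "subgroup N (add_monoid M)"
  proof (intro subgroup.intro)
    show "inv\<^bsub>add_monoid M\<^esub> v \<in> N" if "v \<in> N" for v
      using inv[OF that] unfolding a_inv_def .
  qed (use assms in simp_all)
  then show ?thesis
    using assms(4) by (simp add: Module.submodule_def Module.submodule_axioms_def)
qed

lemma module_homD:
  assumes "T \<in> module_hom R M N"
  shows "\<And>v. v \<in> carrier M \<Longrightarrow> T v \<in> carrier N"
    and "\<And>v w. \<lbrakk>v \<in> carrier M; w \<in> carrier M\<rbrakk> \<Longrightarrow> T (v \<oplus>\<^bsub>M\<^esub> w) = T v \<oplus>\<^bsub>N\<^esub> T w"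
    and "\<And>a v. \<lbrakk>a \<in> carrier R; v \<in> carrier M\<rbrakk> \<Longrightarrow> T (a \<odot>\<^bsub>M\<^esub> v) = a \<odot>\<^bsub>N\<^esub> T v"
  using assms by (auto simp: module_hom_def)

lemma module_hom_zero:
  assumes "left_module R M" "left_module R N" "T \<in> module_hom R M N"
  shows "T \<zero>\<^bsub>M\<^esub> = \<zero>\<^bsub>N\<^esub>"
proof -
  interpret M: left_module R M by fact
  interpret N: left_module R N by fact
  show ?thesis
    using module_homD(3)[OF assms(3), of "\<zero>\<^bsub>R\<^esub>" "\<zero>\<^bsub>M\<^esub>"] module_homD(1)[OF assms(3)] by simp
qed

lemma quotient_module_simps [simp]:
  "carrier (quotient_module M N) = a_rcosets\<^bsub>M\<^esub> N"
  "\<zero>\<^bsub>quotient_module M N\<^esub> = N"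
  "ring.add (quotient_module M N) = set_add M"
  by (simp_all add: quotient_module_def)

lemma regular_module_simps [simp]:
  "carrier (regular_module R) = carrier R"
  "\<zero>\<^bsub>regular_module R\<^esub> = \<zero>\<^bsub>R\<^esub>"
  "ring.add (regular_module R) = ring.add R"
  "module.smult (regular_module R) = monoid.mult R"
  by (simp_all add: regular_module_def)

lemma left_module_regular:
  assumes "ring R" shows "left_module R (regular_module R)"
proof -
  interpret ring R by fact
  have "abelian_group (regular_module R)"
    using abelian_group_axioms unfolding abelian_group_iff_comm_group regular_module_simps
    by (rule comm_group_change_extension)
  moreover have "left_module_axioms R (regular_module R)"
    unfolding left_module_axioms_def regular_module_simps
    by (simp add: l_distr r_distr m_assoc)
  ultimately show ?thesis
    by (intro left_module.intro ring_axioms)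
qed

text \<open>The scalar action on cosets is a union over all representatives. Two representatives
  differ by an element n of N, and a n lies in N again, so all members of the union are the same
  coset.\<close>

lemma (in left_module) smult_coset:
  assumes N: "Module.submodule N R M" and a: "a \<in> carrier R" and v: "v \<in> carrier M"
  shows "a \<odot>\<^bsub>quotient_module M N\<^esub> (N +>\<^bsub>M\<^esub> v) = N +>\<^bsub>M\<^esub> (a \<odot>\<^bsub>M\<^esub> v)"
proof -
  interpret N: abelian_subgroup N M using N by (rule submodule_additive)
  have "N +>\<^bsub>M\<^esub> (a \<odot>\<^bsub>M\<^esub> w) = N +>\<^bsub>M\<^esub> (a \<odot>\<^bsub>M\<^esub> v)" if w: "w \<in> N +>\<^bsub>M\<^esub> v" for w
  proof -
    obtain n where n: "n \<in> N" "w = n \<oplus>\<^bsub>M\<^esub> v" using w unfolding a_r_coset_def' by blast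
    have "a \<odot>\<^bsub>M\<^esub> w = a \<odot>\<^bsub>M\<^esub> n \<oplus>\<^bsub>M\<^esub> a \<odot>\<^bsub>M\<^esub> v"
      using smult_r_distr[OF a _ v] N.a_Hcarr[OF n(1)] n(2) by simp
    moreover have "a \<odot>\<^bsub>M\<^esub> n \<in> N" using Module.submodule.smult_closed[OF N a n(1)] .
    ultimately have "a \<odot>\<^bsub>M\<^esub> w \<in> N +>\<^bsub>M\<^esub> (a \<odot>\<^bsub>M\<^esub> v)"
      unfolding a_r_coset_def' by blast
    from M.a_repr_independence[OF this smult_closed[OF a v] N.a_subgroup]
    show ?thesis ..
  qed
  moreover have "N +>\<^bsub>M\<^esub> v \<noteq> {}" using N.a_rcos_self[OF v] by blast
  ultimately show ?thesis
    unfolding quotient_module_def module.simps by (intro SUP_eq_const)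
qed

lemma (in left_module) left_module_quotient:
  assumes N: "Module.submodule N R M"
  shows "left_module R (quotient_module M N)"
proof -
  interpret N: abelian_subgroup N M using N by (rule submodule_additive)
  have "comm_group (add_monoid (quotient_module M N))"
    using N.a_factorgroup_is_comm_group unfolding A_FactGroup_def' quotient_module_simps
    by (rule comm_group_change_extension)
  then have "abelian_group (quotient_module M N)"
    unfolding abelian_group_iff_comm_group .
  moreover have "left_module_axioms R (quotient_module M N)"
  proof
    fix a b C D
    assume a: "a \<in> carrier R" and b: "b \<in> carrier R"
      and "C \<in> carrier (quotient_module M N)" "D \<in> carrier (quotient_module M N)"
    then obtain v w where v: "C = N +>\<^bsub>M\<^esub> v" "v \<in> carrier M" and w: "D = N +>\<^bsub>M\<^esub> w" "w \<in> carrier M"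
      unfolding quotient_module_simps A_RCOSETS_def' by blast
    note simps = smult_coset[OF N] N.a_rcos_sum smult_closed a b v w
    show "a \<odot>\<^bsub>quotient_module M N\<^esub> C \<in> carrier (quotient_module M N)"
      using M.a_rcosetsI[OF N.a_subset smult_closed[OF a v(2)]] by (simp add: simps)
    show "(a \<oplus>\<^bsub>R\<^esub> b) \<odot>\<^bsub>quotient_module M N\<^esub> C =
        a \<odot>\<^bsub>quotient_module M N\<^esub> C \<oplus>\<^bsub>quotient_module M N\<^esub> b \<odot>\<^bsub>quotient_module M N\<^esub> C"
      by (simp add: simps smult_l_distr)
    show "a \<odot>\<^bsub>quotient_module M N\<^esub> (C \<oplus>\<^bsub>quotient_module M N\<^esub> D) =
        a \<odot>\<^bsub>quotient_module M N\<^esub> C \<oplus>\<^bsub>quotient_module M N\<^esub> a \<odot>\<^bsub>quotient_module M N\<^esub> D"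
      by (simp add: simps smult_r_distr)
    show "(a \<otimes>\<^bsub>R\<^esub> b) \<odot>\<^bsub>quotient_module M N\<^esub> C =
        a \<odot>\<^bsub>quotient_module M N\<^esub> (b \<odot>\<^bsub>quotient_module M N\<^esub> C)"
      by (simp add: simps smult_assoc)
  next
    fix C
    assume "C \<in> carrier (quotient_module M N)"
    then obtain v where "C = N +>\<^bsub>M\<^esub> v" "v \<in> carrier M"
      unfolding quotient_module_simps A_RCOSETS_def' by blast
    then show "\<one>\<^bsub>R\<^esub> \<odot>\<^bsub>quotient_module M N\<^esub> C = C"
      by (simp add: smult_coset[OF N] smult_one)
  qed
  ultimately show ?thesis
    by (intro left_module.intro R.ring_axioms)
qed

lemma (in left_module) coset_eq_zero_iff:
  assumes "Module.submodule N R M" "v \<in> carrier M"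
  shows "N +>\<^bsub>M\<^esub> v = N \<longleftrightarrow> v \<in> N"
proof -
  interpret N: abelian_subgroup N M using assms(1) by (rule submodule_additive)
  show ?thesis using assms(2) N.a_rcos_self N.a_rcos_const by blast
qed

lemma (in left_module) coset_module_hom:
  assumes "Module.submodule N R M"
  shows "(\<lambda>v. N +>\<^bsub>M\<^esub> v) \<in> module_hom R M (quotient_module M N)"
proof -
  interpret N: abelian_subgroup N M using assms by (rule submodule_additive)
  show ?thesis
    by (auto simp: module_hom_def smult_coset[OF assms] N.a_rcos_sum M.a_rcosetsI N.a_subset)
qed


section \<open>Induced modules: well-definedness, induction over tensors, universal property\<close>

locale induction_data = R?: ring R + S?: ring S + N?: left_module R N
  for R :: "('r, 'i) ring_scheme" and S :: "('s, 'j) ring_scheme" and N :: "('r, 'n, 'k) module_scheme" +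
  fixes \<iota> :: "'r \<Rightarrow> 's"
  assumes \<iota>_closed: "r \<in> carrier R \<Longrightarrow> \<iota> r \<in> carrier S"
begin

definition "G = free_Abelian_group (carrier S \<times> carrier N)"
definition "K = tensor_kernel R S \<iota> N"
definition "lscale a = frag_extend (\<lambda>(b, v). frag_of (a \<otimes>\<^bsub>S\<^esub> b, v))"
definition "tens a v = K #>\<^bsub>G\<^esub> frag_of (a, v)"

lemma G_iff: "c \<in> carrier G \<longleftrightarrow> Poly_Mapping.keys c \<subseteq> carrier S \<times> carrier N"
  by (simp add: G_def)

lemma G_simps [simp]:
  "\<one>\<^bsub>G\<^esub> = 0" "c \<otimes>\<^bsub>G\<^esub> d = c + d" "c \<in> carrier G \<Longrightarrow> inv\<^bsub>G\<^esub> c = - c"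
  by (simp_all add: G_def)

lemma comm_group_G: "comm_group G"
  by (simp add: G_def abelian_free_Abelian_group)

lemma G_add: "\<lbrakk>c \<in> carrier G; d \<in> carrier G\<rbrakk> \<Longrightarrow> c + d \<in> carrier G"
  using comm_group_G[THEN comm_group.axioms(2), THEN group.is_monoid, THEN monoid.m_closed, of c d]
  by simp

lemma G_minus: "c \<in> carrier G \<Longrightarrow> - c \<in> carrier G"
  by (simp add: G_iff)

lemma G_diff: "\<lbrakk>c \<in> carrier G; d \<in> carrier G\<rbrakk> \<Longrightarrow> c - d \<in> carrier G"
  using G_add[of c "- d"] G_minus[of d] by simp

lemma G_frag_of: "frag_of (a, v) \<in> carrier G \<longleftrightarrow> a \<in> carrier S \<and> v \<in> carrier N"
  by (simp add: G_iff)

lemma relations_subset: "tensor_relations R S \<iota> N \<subseteq> carrier G"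
  unfolding tensor_relations_def
  by (auto intro!: G_diff simp: G_frag_of \<iota>_closed N.smult_closed)

lemma subgroup_K: "subgroup K G"
  unfolding K_def tensor_kernel_def
  using comm_group_G relations_subset
  by (metis G_def comm_group.axioms(2) group.generate_is_subgroup)

lemma K_closed:
  shows K_zero: "0 \<in> K" and K_add: "\<lbrakk>c \<in> K; d \<in> K\<rbrakk> \<Longrightarrow> c + d \<in> K"
    and K_minus: "c \<in> K \<Longrightarrow> - c \<in> K" and K_carrier: "c \<in> K \<Longrightarrow> c \<in> carrier G"
proof -
  show *: "c \<in> K \<Longrightarrow> c \<in> carrier G" for c using subgroup.mem_carrier[OF subgroup_K] .
  show "0 \<in> K" using subgroup.one_closed[OF subgroup_K] by simp
  show "\<lbrakk>c \<in> K; d \<in> K\<rbrakk> \<Longrightarrow> c + d \<in> K" using subgroup.m_closed[OF subgroup_K, of c d] by simp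
  show "c \<in> K \<Longrightarrow> - c \<in> K" using subgroup.m_inv_closed[OF subgroup_K, of c] *[of c] by simp
qed

lemma K_diff: "\<lbrakk>c \<in> K; d \<in> K\<rbrakk> \<Longrightarrow> c - d \<in> K"
  using K_add[of c "- d"] K_minus[of d] by simp

lemma relations_K: "c \<in> tensor_relations R S \<iota> N \<Longrightarrow> c \<in> K"
  unfolding K_def tensor_kernel_def by (rule generate.incl)

lemma K_coset_eq_iff:
  "K #>\<^bsub>G\<^esub> c = K #>\<^bsub>G\<^esub> d \<longleftrightarrow> c - d \<in> K"
proof
  assume "K #>\<^bsub>G\<^esub> c = K #>\<^bsub>G\<^esub> d"
  moreover have "c \<in> K #>\<^bsub>G\<^esub> c" using K_zero by (force simp: r_coset_def)
  ultimately have "c \<in> K #>\<^bsub>G\<^esub> d" by simp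
  then show "c - d \<in> K" by (auto simp: r_coset_def)
next
  assume cd: "c - d \<in> K"
  have "k + c \<in> K #>\<^bsub>G\<^esub> d" if "k \<in> K" for k
    using K_add[OF that cd] by (force simp: r_coset_def algebra_simps)
  moreover have "k + d \<in> K #>\<^bsub>G\<^esub> c" if "k \<in> K" for k
    using K_diff[OF that cd] by (force simp: r_coset_def algebra_simps)
  ultimately show "K #>\<^bsub>G\<^esub> c = K #>\<^bsub>G\<^esub> d" by (auto simp: r_coset_def)
qed

lemma lscale_closed:
  assumes "a \<in> carrier S" "c \<in> carrier G" shows "lscale a c \<in> carrier G"
  using keys_frag_extend[of "\<lambda>(b, v). frag_of (a \<otimes>\<^bsub>S\<^esub> b, v)" c] assms
  by (fastforce simp: G_iff lscale_def split: prod.splits)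

lemma lscale_arith [simp]:
  "lscale a (c + d) = lscale a c + lscale a d" "lscale a (c - d) = lscale a c - lscale a d"
  "lscale a (- c) = - lscale a c" "lscale a 0 = 0"
  "lscale a (frag_of (b, v)) = frag_of (a \<otimes>\<^bsub>S\<^esub> b, v)"
  by (simp_all add: lscale_def frag_extend_add frag_extend_diff frag_extend_minus)

lemma lscale_relations:
  assumes "a \<in> carrier S" "c \<in> tensor_relations R S \<iota> N"
  shows "lscale a c \<in> tensor_relations R S \<iota> N"
proof -
  consider (1) b b' v where "c = frag_of (b \<oplus>\<^bsub>S\<^esub> b', v) - frag_of (b, v) - frag_of (b', v)"
      "b \<in> carrier S" "b' \<in> carrier S" "v \<in> carrier N"
    | (2) b v w where "c = frag_of (b, v \<oplus>\<^bsub>N\<^esub> w) - frag_of (b, v) - frag_of (b, w)"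
      "b \<in> carrier S" "v \<in> carrier N" "w \<in> carrier N"
    | (3) b r v where "c = frag_of (b \<otimes>\<^bsub>S\<^esub> \<iota> r, v) - frag_of (b, r \<odot>\<^bsub>N\<^esub> v)"
      "b \<in> carrier S" "r \<in> carrier R" "v \<in> carrier N"
    using assms(2) unfolding tensor_relations_def by blast
  then show ?thesis
  proof cases
    case 1
    then have "lscale a c = frag_of (a \<otimes>\<^bsub>S\<^esub> b \<oplus>\<^bsub>S\<^esub> a \<otimes>\<^bsub>S\<^esub> b', v) - frag_of (a \<otimes>\<^bsub>S\<^esub> b, v) - frag_of (a \<otimes>\<^bsub>S\<^esub> b', v)"
      using assms(1) by (simp add: S.r_distr)
    then show ?thesis unfolding tensor_relations_def using 1 assms(1) by blast
  next
    case 2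
    then have "lscale a c = frag_of (a \<otimes>\<^bsub>S\<^esub> b, v \<oplus>\<^bsub>N\<^esub> w) - frag_of (a \<otimes>\<^bsub>S\<^esub> b, v) - frag_of (a \<otimes>\<^bsub>S\<^esub> b, w)"
      by simp
    then show ?thesis unfolding tensor_relations_def using 2 assms(1) by blast
  next
    case 3
    then have "lscale a c = frag_of (a \<otimes>\<^bsub>S\<^esub> b \<otimes>\<^bsub>S\<^esub> \<iota> r, v) - frag_of (a \<otimes>\<^bsub>S\<^esub> b, r \<odot>\<^bsub>N\<^esub> v)"
      using assms(1) by (simp add: S.m_assoc \<iota>_closed)
    then show ?thesis unfolding tensor_relations_def using 3 assms(1) by blast
  qed
qed

text \<open>The cases for sums and negatives also supply membership in \<open>K\<close>, hence in
  \<open>G\<close>: the maps to which the rule is applied need only be additive on the carrier of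
  \<open>G\<close>.\<close>

lemma K_induct [consumes 1, case_names zero relation add minus]:
  assumes "c \<in> K" and "P 0" and "\<And>c. c \<in> tensor_relations R S \<iota> N \<Longrightarrow> P c"
    and "\<And>c d. \<lbrakk>P c; P d; c \<in> K; d \<in> K\<rbrakk> \<Longrightarrow> P (c + d)" and "\<And>c. \<lbrakk>c \<in> K; P c\<rbrakk> \<Longrightarrow> P (- c)"
  shows "P c"
  using assms(1)[unfolded K_def tensor_kernel_def]
proof (induction rule: generate.induct)
  case one
  then show ?case using assms(2) by simp
next
  case (incl c)
  then show ?case by (rule assms(3))
next
  case (inv c)
  then have "inv\<^bsub>G\<^esub> c = - c" using relations_subset inv by (intro G_simps(3)) blast
  then show ?case using assms(5)[of c] assms(3)[OF inv] relations_K[OF inv] by (simp add: G_def)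
next
  case (eng c d)
  then show ?case using assms(4)[of c d] by (simp add: K_def tensor_kernel_def)
qed

lemma lscale_K: "\<lbrakk>a \<in> carrier S; c \<in> K\<rbrakk> \<Longrightarrow> lscale a c \<in> K"
  by (rotate_tac, induction c rule: K_induct)
    (simp_all add: K_zero K_add K_minus lscale_relations relations_K)

lemma induced_simps:
  "carrier (induced_module R S \<iota> N) = (\<lambda>c. K #>\<^bsub>G\<^esub> c) ` carrier G"
  "\<zero>\<^bsub>induced_module R S \<iota> N\<^esub> = K"
  "ring.add (induced_module R S \<iota> N) = set_mult G"
  "a \<odot>\<^bsub>induced_module R S \<iota> N\<^esub> C = (\<Union>c\<in>C. K #>\<^bsub>G\<^esub> lscale a c)"
  by (auto simp: induced_module_def Let_def FactGroup_def RCOSETS_def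
      G_def[symmetric] K_def[symmetric] lscale_def[symmetric])

lemma normal_K: "K \<lhd> G"
  using comm_group.subgroup_imp_normal[OF comm_group_G subgroup_K] .

lemma induced_add:
  "\<lbrakk>c \<in> carrier G; d \<in> carrier G\<rbrakk> \<Longrightarrow>
    (K #>\<^bsub>G\<^esub> c) \<oplus>\<^bsub>induced_module R S \<iota> N\<^esub> (K #>\<^bsub>G\<^esub> d) = K #>\<^bsub>G\<^esub> (c + d)"
  using normal.rcos_sum[OF normal_K, of c d] by (simp add: induced_simps)

lemma induced_smult:
  assumes "a \<in> carrier S"
  shows "a \<odot>\<^bsub>induced_module R S \<iota> N\<^esub> (K #>\<^bsub>G\<^esub> c) = K #>\<^bsub>G\<^esub> lscale a c"
proof -
  have "K #>\<^bsub>G\<^esub> lscale a d = K #>\<^bsub>G\<^esub> lscale a c" if "d \<in> K #>\<^bsub>G\<^esub> c" for d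
  proof -
    obtain k where "k \<in> K" "d = k + c" using \<open>d \<in> K #>\<^bsub>G\<^esub> c\<close> by (auto simp: r_coset_def)
    then show ?thesis using lscale_K[OF assms, of k] by (simp add: K_coset_eq_iff)
  qed
  moreover have "c \<in> K #>\<^bsub>G\<^esub> c" using K_zero by (force simp: r_coset_def)
  ultimately show ?thesis unfolding induced_simps by blast
qed

text \<open>Additivity in the scalar holds only modulo \<open>K\<close>: the two sides are different
  combinations of basis elements of the free group, linked by a biadditivity relation. Associativity
  and the unit law, in contrast, are equalities in the free group itself.\<close>

lemma lscale_distr_K:
  assumes "a \<in> carrier S" "b \<in> carrier S" "c \<in> carrier G"
  shows "lscale (a \<oplus>\<^bsub>S\<^esub> b) c - (lscale a c + lscale b c) \<in> K"
  using assms(3)[unfolded G_iff]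
proof (induction c rule: frag_induction)
  case zero
  then show ?case by (simp add: K_zero)
next
  case (one x)
  obtain e v where x: "x = (e, v)" "e \<in> carrier S" "v \<in> carrier N" using one by auto
  have "frag_of ((a \<otimes>\<^bsub>S\<^esub> e) \<oplus>\<^bsub>S\<^esub> (b \<otimes>\<^bsub>S\<^esub> e), v) - frag_of (a \<otimes>\<^bsub>S\<^esub> e, v) - frag_of (b \<otimes>\<^bsub>S\<^esub> e, v)
      \<in> tensor_relations R S \<iota> N"
    unfolding tensor_relations_def using x assms S.m_closed by blast
  from relations_K[OF this] show ?case
    using x assms by (simp add: S.l_distr algebra_simps)
next
  case (diff c d)
  from K_diff[OF this] show ?case by (simp add: algebra_simps)
qed

lemma lscale_assoc:
  assumes "a \<in> carrier S" "b \<in> carrier S" "c \<in> carrier G"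
  shows "lscale (a \<otimes>\<^bsub>S\<^esub> b) c = lscale a (lscale b c)"
  using assms(3)[unfolded G_iff]
proof (induction c rule: frag_induction)
  case (one x)
  then obtain e v where "x = (e, v)" "e \<in> carrier S" "v \<in> carrier N" by auto
  then show ?case using assms by (simp add: S.m_assoc)
qed auto

lemma lscale_one:
  assumes "c \<in> carrier G"
  shows "lscale \<one>\<^bsub>S\<^esub> c = c"
  using assms[unfolded G_iff]
  by (induction c rule: frag_induction) auto

lemma left_module_induced: "left_module S (induced_module R S \<iota> N)"
proof -
  let ?I = "induced_module R S \<iota> N"
  have car: "carrier ?I = rcosets\<^bsub>G\<^esub> K"
    unfolding induced_simps(1) RCOSETS_def by blast
  have "comm_group (add_monoid ?I)"
    using comm_group.abelian_FactGroup[OF comm_group_G subgroup_K]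
    unfolding FactGroup_def car induced_simps(2,3) by (rule comm_group_change_extension)
  then have "abelian_group ?I"
    unfolding abelian_group_iff_comm_group .
  moreover have "left_module_axioms S ?I"
  proof
    fix a b v w
    assume a: "a \<in> carrier S" and b: "b \<in> carrier S" and "v \<in> carrier ?I" "w \<in> carrier ?I"
    then obtain c d where c: "v = K #>\<^bsub>G\<^esub> c" "c \<in> carrier G" and d: "w = K #>\<^bsub>G\<^esub> d" "d \<in> carrier G"
      unfolding induced_simps(1) by blast
    note closed = lscale_closed[OF a c(2)] lscale_closed[OF a d(2)] lscale_closed[OF b c(2)]
    show "a \<odot>\<^bsub>?I\<^esub> v \<in> carrier ?I"
      unfolding c(1) induced_smult[OF a] induced_simps(1) using closed by blast
    show "(a \<oplus>\<^bsub>S\<^esub> b) \<odot>\<^bsub>?I\<^esub> v = a \<odot>\<^bsub>?I\<^esub> v \<oplus>\<^bsub>?I\<^esub> b \<odot>\<^bsub>?I\<^esub> v"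
      unfolding c(1) induced_smult[OF a] induced_smult[OF b] induced_smult[OF S.a_closed[OF a b]]
        induced_add[OF closed(1,3)] K_coset_eq_iff by (rule lscale_distr_K[OF a b c(2)])
    show "a \<odot>\<^bsub>?I\<^esub> (v \<oplus>\<^bsub>?I\<^esub> w) = a \<odot>\<^bsub>?I\<^esub> v \<oplus>\<^bsub>?I\<^esub> a \<odot>\<^bsub>?I\<^esub> w"
      unfolding c(1) d(1) induced_smult[OF a] induced_add[OF c(2) d(2)] induced_add[OF closed(1,2)]
        lscale_arith ..
    show "(a \<otimes>\<^bsub>S\<^esub> b) \<odot>\<^bsub>?I\<^esub> v = a \<odot>\<^bsub>?I\<^esub> (b \<odot>\<^bsub>?I\<^esub> v)"
      unfolding c(1) induced_smult[OF a] induced_smult[OF b] induced_smult[OF S.m_closed[OF a b]]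
        lscale_assoc[OF a b c(2)] ..
  next
    fix v
    assume "v \<in> carrier ?I"
    then obtain c where c: "v = K #>\<^bsub>G\<^esub> c" "c \<in> carrier G"
      unfolding induced_simps(1) by blast
    show "\<one>\<^bsub>S\<^esub> \<odot>\<^bsub>?I\<^esub> v = v"
      unfolding c(1) induced_smult[OF S.one_closed] lscale_one[OF c(2)] ..
  qed
  ultimately show ?thesis
    by (intro left_module.intro S.ring_axioms)
qed

lemma tens_closed: "\<lbrakk>a \<in> carrier S; v \<in> carrier N\<rbrakk> \<Longrightarrow> tens a v \<in> carrier (induced_module R S \<iota> N)"
  unfolding tens_def induced_simps(1) by (intro imageI) (simp add: G_frag_of)

lemma smult_tens:
  "\<lbrakk>a \<in> carrier S\<rbrakk> \<Longrightarrow> a \<odot>\<^bsub>induced_module R S \<iota> N\<^esub> tens b v = tens (a \<otimes>\<^bsub>S\<^esub> b) v"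
  unfolding tens_def induced_smult lscale_arith ..

lemma tens_balanced:
  assumes "a \<in> carrier S" "r \<in> carrier R" "v \<in> carrier N"
  shows "tens (a \<otimes>\<^bsub>S\<^esub> \<iota> r) v = tens a (r \<odot>\<^bsub>N\<^esub> v)"
  unfolding tens_def K_coset_eq_iff
  by (rule relations_K) (use assms in \<open>auto simp: tensor_relations_def\<close>)

text \<open>Differences suffice because the free abelian group is generated by its basis under
  subtraction. The rule needs no case for zero, which is a tensor minus itself.\<close>

lemma induced_induct [consumes 1, case_names tens diff]:
  assumes "C \<in> carrier (induced_module R S \<iota> N)"
    and "\<And>a v. \<lbrakk>a \<in> carrier S; v \<in> carrier N\<rbrakk> \<Longrightarrow> P (tens a v)"
    and "\<And>C D. \<lbrakk>C \<in> carrier (induced_module R S \<iota> N); D \<in> carrier (induced_module R S \<iota> N); P C; P D\<rbrakk>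
      \<Longrightarrow> P (C \<ominus>\<^bsub>induced_module R S \<iota> N\<^esub> D)"
  shows "P C"
proof -
  let ?I = "induced_module R S \<iota> N"
  interpret I: left_module S ?I by (rule left_module_induced)
  have minus: "(K #>\<^bsub>G\<^esub> c) \<ominus>\<^bsub>?I\<^esub> (K #>\<^bsub>G\<^esub> d) = K #>\<^bsub>G\<^esub> (c - d)"
    if "c \<in> carrier G" "d \<in> carrier G" for c d
  proof -
    have "(K #>\<^bsub>G\<^esub> (- d)) \<oplus>\<^bsub>?I\<^esub> (K #>\<^bsub>G\<^esub> d) = \<zero>\<^bsub>?I\<^esub>"
      unfolding induced_add[OF G_minus[OF that(2)] that(2)] by (simp add: induced_simps(2) r_coset_def)
    moreover have "K #>\<^bsub>G\<^esub> d \<in> carrier ?I" "K #>\<^bsub>G\<^esub> (- d) \<in> carrier ?I"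
      unfolding induced_simps(1) using that G_minus[of d] by blast+
    ultimately have "\<ominus>\<^bsub>?I\<^esub> (K #>\<^bsub>G\<^esub> d) = K #>\<^bsub>G\<^esub> (- d)"
      by (rule I.M.minus_equality)
    then show ?thesis
      unfolding a_minus_def using induced_add[OF that(1) G_minus[OF that(2)]] by simp
  qed
  obtain c where c: "C = K #>\<^bsub>G\<^esub> c" "Poly_Mapping.keys c \<subseteq> carrier S \<times> carrier N"
    using assms(1) unfolding induced_simps(1) by (auto simp: G_iff)
  \<comment> \<open>The support condition is carried through the induction: the difference case
    otherwise provides only the property of the two parts, while subtracting their cosets requires
    both to lie in \<open>G\<close>.\<close>
  have "Poly_Mapping.keys c \<subseteq> carrier S \<times> carrier N \<and> P (K #>\<^bsub>G\<^esub> c)"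
    using c(2)
  proof (induction c rule: frag_induction)
    case zero
    have t: "tens \<zero>\<^bsub>S\<^esub> \<zero>\<^bsub>N\<^esub> \<in> carrier ?I"
      by (rule tens_closed[OF S.zero_closed N.M.zero_closed])
    have "P (tens \<zero>\<^bsub>S\<^esub> \<zero>\<^bsub>N\<^esub> \<ominus>\<^bsub>?I\<^esub> tens \<zero>\<^bsub>S\<^esub> \<zero>\<^bsub>N\<^esub>)"
      using assms(3)[OF t t] assms(2)[OF S.zero_closed N.M.zero_closed] by blast
    moreover have "frag_of (\<zero>\<^bsub>S\<^esub>, \<zero>\<^bsub>N\<^esub>) \<in> carrier G" by (simp add: G_frag_of)
    ultimately have "P (K #>\<^bsub>G\<^esub> 0)"
      using minus[of "frag_of (\<zero>\<^bsub>S\<^esub>, \<zero>\<^bsub>N\<^esub>)" "frag_of (\<zero>\<^bsub>S\<^esub>, \<zero>\<^bsub>N\<^esub>)"] unfolding tens_def by (simp only: diff_self)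
    then show ?case by simp
  next
    case (one x)
    then obtain a v where x: "x = (a, v)" "a \<in> carrier S" "v \<in> carrier N" by blast
    then show ?case using assms(2)[OF x(2,3)] by (simp add: tens_def)
  next
    case (diff a b)
    then have ab: "a \<in> carrier G" "b \<in> carrier G" "P (K #>\<^bsub>G\<^esub> a)" "P (K #>\<^bsub>G\<^esub> b)"
      by (simp_all add: G_iff)
    then have "K #>\<^bsub>G\<^esub> a \<in> carrier ?I" "K #>\<^bsub>G\<^esub> b \<in> carrier ?I"
      unfolding induced_simps(1) by blast+
    then show ?case
      using assms(3)[of "K #>\<^bsub>G\<^esub> a" "K #>\<^bsub>G\<^esub> b"] ab G_diff[OF ab(1,2)]
      unfolding minus[OF ab(1,2)] G_iff[symmetric] by blast
  qed
  then show ?thesis using c by simp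
qed

text \<open>The map (a, v) \<mapsto> a \<phi>(v) extends to the free abelian group. Additivity and
  linearity of \<phi> make it kill the three kinds of relations, so it factors through the quotient
  by \<open>K\<close>.\<close>

lemma induced_lift:
  assumes M: "left_module S M"
    and \<phi>: "\<And>v. v \<in> carrier N \<Longrightarrow> \<phi> v \<in> carrier M"
    and add: "\<And>v w. \<lbrakk>v \<in> carrier N; w \<in> carrier N\<rbrakk> \<Longrightarrow> \<phi> (v \<oplus>\<^bsub>N\<^esub> w) = \<phi> v \<oplus>\<^bsub>M\<^esub> \<phi> w"
    and smult: "\<And>r v. \<lbrakk>r \<in> carrier R; v \<in> carrier N\<rbrakk> \<Longrightarrow> \<phi> (r \<odot>\<^bsub>N\<^esub> v) = \<iota> r \<odot>\<^bsub>M\<^esub> \<phi> v"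
  obtains T where "T \<in> module_hom S (induced_module R S \<iota> N) M"
    and "\<And>a v. \<lbrakk>a \<in> carrier S; v \<in> carrier N\<rbrakk> \<Longrightarrow> T (tens a v) = a \<odot>\<^bsub>M\<^esub> \<phi> v"
proof -
  let ?I = "induced_module R S \<iota> N"
  interpret M: left_module S M by fact
  have "(\<lambda>(a, v). a \<odot>\<^bsub>M\<^esub> \<phi> v) ` (carrier S \<times> carrier N) \<subseteq> carrier (add_monoid M)"
    using M.smult_closed \<phi> by auto
  from comm_group.free_Abelian_group_universal[OF M.a_comm_group this]
  obtain \<theta> where \<theta>: "\<theta> \<in> hom G (add_monoid M)"
    and \<theta>_of: "\<And>x. x \<in> carrier S \<times> carrier N \<Longrightarrow> \<theta> (frag_of x) = (case x of (a, v) \<Rightarrow> a \<odot>\<^bsub>M\<^esub> \<phi> v)"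
    unfolding G_def by blast
  interpret \<theta>: group_hom G "add_monoid M" \<theta>
    using \<theta> comm_group_G M.add.group_axioms
    by (simp add: group_hom_def group_hom_axioms_def comm_group_def)
  have \<theta>_add: "\<theta> (c + d) = \<theta> c \<oplus>\<^bsub>M\<^esub> \<theta> d" if "c \<in> carrier G" "d \<in> carrier G" for c d
    using \<theta>.hom_mult[OF that] by simp
  have \<theta>_minus: "\<theta> (- d) = \<ominus>\<^bsub>M\<^esub> \<theta> d" if "d \<in> carrier G" for d
    using \<theta>.hom_inv[OF that] that by (simp add: a_inv_def)
  have \<theta>_diff: "\<theta> (c - d) = \<theta> c \<ominus>\<^bsub>M\<^esub> \<theta> d" if "c \<in> carrier G" "d \<in> carrier G" for c d
    using \<theta>_add[of c "- d"] \<theta>_minus that G_minus[of d] by (simp add: a_minus_def)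
  have \<theta>_closed: "\<theta> c \<in> carrier M" if "c \<in> carrier G" for c
    using \<theta>.hom_closed[OF that] by simp
  have \<theta>_frag: "\<theta> (frag_of (a, v)) = a \<odot>\<^bsub>M\<^esub> \<phi> v" if "a \<in> carrier S" "v \<in> carrier N" for a v
    using \<theta>_of[of "(a, v)"] that by simp
  have cancel: "(x \<oplus>\<^bsub>M\<^esub> y) \<ominus>\<^bsub>M\<^esub> x \<ominus>\<^bsub>M\<^esub> y = \<zero>\<^bsub>M\<^esub>" if "x \<in> carrier M" "y \<in> carrier M" for x y
  proof -
    have "(x \<oplus>\<^bsub>M\<^esub> y) \<ominus>\<^bsub>M\<^esub> x \<ominus>\<^bsub>M\<^esub> y = (x \<ominus>\<^bsub>M\<^esub> x) \<oplus>\<^bsub>M\<^esub> (y \<ominus>\<^bsub>M\<^esub> y)"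
      using that by (simp add: a_minus_def M.a_ac)
    then show ?thesis using that by (simp add: M.r_neg a_minus_def)
  qed
  have rel: "\<theta> c = \<zero>\<^bsub>M\<^esub>" if c: "c \<in> tensor_relations R S \<iota> N" for c
  proof -
    consider (1) b b' v where "c = frag_of (b \<oplus>\<^bsub>S\<^esub> b', v) - frag_of (b, v) - frag_of (b', v)"
        "b \<in> carrier S" "b' \<in> carrier S" "v \<in> carrier N"
      | (2) b v w where "c = frag_of (b, v \<oplus>\<^bsub>N\<^esub> w) - frag_of (b, v) - frag_of (b, w)"
        "b \<in> carrier S" "v \<in> carrier N" "w \<in> carrier N"
      | (3) b r v where "c = frag_of (b \<otimes>\<^bsub>S\<^esub> \<iota> r, v) - frag_of (b, r \<odot>\<^bsub>N\<^esub> v)"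
        "b \<in> carrier S" "r \<in> carrier R" "v \<in> carrier N"
      using c unfolding tensor_relations_def by blast
    then show ?thesis
    proof cases
      case 1
      then show ?thesis
        by (simp add: \<theta>_diff G_diff G_frag_of \<theta>_frag M.smult_l_distr \<phi> cancel M.smult_closed)
    next
      case 2
      then show ?thesis
        by (simp add: \<theta>_diff G_diff G_frag_of \<theta>_frag M.smult_r_distr \<phi> add cancel M.smult_closed)
    next
      case 3
      then show ?thesis
        by (simp add: \<theta>_diff G_diff G_frag_of \<theta>_frag M.smult_assoc \<phi> smult \<iota>_closed
            N.smult_closed M.smult_closed M.r_neg a_minus_def)
    qed
  qed
  have \<theta>_K: "\<theta> c = \<zero>\<^bsub>M\<^esub>" if "c \<in> K" for c
    using that
    by (induction c rule: K_induct)
      (auto simp: rel \<theta>_add \<theta>_minus K_carrier \<theta>.hom_one[simplified])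
  \<comment> \<open>An arbitrary representative of the coset will do, since \<theta> vanishes on
    \<open>K\<close>.\<close>
  define T where "T C = \<theta> (SOME c. c \<in> C)" for C
  have T: "T (K #>\<^bsub>G\<^esub> c) = \<theta> c" if c: "c \<in> carrier G" for c
  proof -
    have "c \<in> K #>\<^bsub>G\<^esub> c" using K_zero by (force simp: r_coset_def)
    then have "(SOME d. d \<in> K #>\<^bsub>G\<^esub> c) \<in> K #>\<^bsub>G\<^esub> c" by (rule someI)
    then obtain k where "(SOME d. d \<in> K #>\<^bsub>G\<^esub> c) = k + c" "k \<in> K" by (auto simp: r_coset_def)
    then show ?thesis using c by (simp add: T_def \<theta>_add \<theta>_K K_carrier \<theta>_closed)
  qed
  have \<theta>_lscale: "\<theta> (lscale a c) = a \<odot>\<^bsub>M\<^esub> \<theta> c" if "a \<in> carrier S" "c \<in> carrier G" for a c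
  proof -
    have "Poly_Mapping.keys c \<subseteq> carrier S \<times> carrier N \<and> \<theta> (lscale a c) = a \<odot>\<^bsub>M\<^esub> \<theta> c"
      using that(2)[unfolded G_iff]
    proof (induction c rule: frag_induction)
      case zero
      then show ?case using \<theta>.hom_one that(1) by simp
    next
      case (one x)
      then show ?case using that(1) by (auto simp: \<theta>_frag M.smult_assoc \<phi>)
    next
      case (diff c d)
      then show ?case
        using G_diff[of c d] lscale_closed[OF that(1), of c] lscale_closed[OF that(1), of d] that(1)
          \<theta>_closed[of c] \<theta>_closed[of d]
        by (simp add: G_iff[symmetric] \<theta>_diff a_minus_def M.smult_r_distr M.smult_a_inv_right)
    qed
    then show ?thesis by simp
  qed
  show ?thesis
  proof
    show "T \<in> module_hom S ?I M"
      unfolding module_hom_def induced_simps(1)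
      by (auto simp: induced_add induced_smult T \<theta>_closed \<theta>_add G_add \<theta>_lscale lscale_closed)
    show "T (tens a v) = a \<odot>\<^bsub>M\<^esub> \<phi> v" if "a \<in> carrier S" "v \<in> carrier N" for a v
      using that by (simp add: tens_def T G_frag_of \<theta>_frag)
  qed
qed

end


section \<open>The polynomial model of the free cyclic module\<close>

lemma delta_simps [simp]:
  "delta h 0 = 0" "delta h 1 = 0" "delta h [:c:] = 0"
  "delta h (r + s) = delta h r + delta h s" "delta h (r - s) = delta h r - delta h s"
  by (simp_all add: delta_def pderiv_add pderiv_diff algebra_simps pderiv_pCons)

lemma delta_mult: "delta h (r * s) = delta h r * s + r * delta h s"
  by (simp add: delta_def pderiv_mult algebra_simps)

text \<open>A polynomial \<open>p\<close> over \<open>F[x]\<close> stands for the element \<open>\<Sum> y\<^sup>i p\<^sub>i\<close> of \<open>A\<^sub>h\<close>, and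
  \<open>lmul h r p\<close> for its product with \<open>r\<close> on the left; the recursion is the relation
  \<open>r y = y r - \<delta>(r)\<close>.\<close>

definition lmul :: "'a::field poly \<Rightarrow> 'a poly \<Rightarrow> 'a poly poly \<Rightarrow> 'a poly poly" where
  "lmul h r p = fold_coeffs (\<lambda>a F r. pCons (r * a) (F r) - F (delta h r)) p (\<lambda>_. 0) r"

lemma lmul_0_right [simp]: "lmul h r 0 = 0"
  by (simp add: lmul_def)

lemma lmul_pCons: "lmul h r (pCons a p) = pCons (r * a) (lmul h r p) - lmul h (delta h r) p"
  by (cases "a = 0 \<and> p = 0") (auto simp: lmul_def)

lemma lmul_add_left: "lmul h (r + s) p = lmul h r p + lmul h s p"
  by (induction p arbitrary: r s) (simp_all add: lmul_pCons algebra_simps flip: add_pCons)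

lemma lmul_0_left [simp]: "lmul h 0 p = 0"
  using lmul_add_left[of h 0 0 p] by (metis add_0 add_cancel_right_left)

lemma lmul_1_left [simp]: "lmul h 1 p = p"
  by (induction p) (simp_all add: lmul_pCons)

lemma lmul_const_left [simp]: "lmul h [:c:] p = smult [:c:] p"
  by (induction p) (simp_all add: lmul_pCons)

lemma lmul_add_right: "lmul h r (p + q) = lmul h r p + lmul h r q"
  by (induction p q arbitrary: r rule: poly_induct2) (simp_all add: lmul_pCons algebra_simps)

lemma lmul_diff_right: "lmul h r (p - q) = lmul h r p - lmul h r q"
  using lmul_add_right[of h r "p - q" q] by simp

text \<open>The Leibniz rule for \<delta> matches the correction terms of the two sides. Both
  factors stay arbitrary in the induction because \<delta> replaces them.\<close>

lemma lmul_mult_left: "lmul h (r * s) p = lmul h r (lmul h s p)"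
proof (induction p arbitrary: r s)
  case (pCons a p)
  then show ?case
    by (simp add: lmul_pCons lmul_diff_right delta_mult lmul_add_left mult.assoc diff_diff_eq)
qed simp

text \<open>\<open>smult s\<close> is multiplication by s on the right, as the coefficients stand to
  the right of the powers of y; left and right multiplication commute. Hence the multiples of
  \<open>[:f:]\<close> are stable under left multiplication by F[x].\<close>

lemma lmul_smult: "lmul h r (smult s p) = smult s (lmul h r p)"
  by (induction p arbitrary: r) (simp_all add: lmul_pCons smult_diff_right algebra_simps)

lemma lmul_const_right [simp]: "lmul h r [:a:] = [:r * a:]"
  by (simp add: lmul_pCons)

text \<open>The commutation rule y r = r y + \<delta>(r), acting on the model.\<close>

lemma lmul_y: "pCons 0 (lmul h r p) = lmul h r (pCons 0 p) + lmul h (delta h r) p"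
  by (simp add: lmul_pCons)


section \<open>The free algebra and \<open>A\<^sub>h\<close>\<close>

lemma free_xy_induct [case_names zero single add]:
  fixes w :: "'b \<Rightarrow>\<^sub>0 'c::monoid_add"
  assumes "P 0" and "\<And>u c. P (Poly_Mapping.single u c)"
    and "\<And>v w. \<lbrakk>P v; P w\<rbrakk> \<Longrightarrow> P (v + w)"
  shows "P w"
proof (induction w rule: Poly_Mapping.update_induct)
  case const
  then show ?case using assms(1) .
next
  case (update f a b)
  have "Poly_Mapping.update a b f = Poly_Mapping.single a b + f"
    using update(1)
    by (intro poly_mapping_eqI) (auto simp: lookup_update lookup_add lookup_single when_def in_keys_iff)
  then show ?case using assms(2,3) update(3) by metis
qed

lemma word_induct [case_names Nil Cons]:
  assumes "P 0" and "\<And>g u. P u \<Longrightarrow> P (Word [g] + u)"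
  shows "P u"
proof -
  have "P (Word l)" for l
  proof (induction l)
    case Nil
    then show ?case using assms(1) by (simp add: zero_xy_word_def)
  next
    case (Cons g l)
    then show ?case using assms(2)[of "Word l" g] by (simp add: plus_xy_word_def)
  qed
  then show ?thesis by (cases u) simp
qed

lemma free_poly_0 [simp]: "free_poly 0 = 0"
  by (simp add: free_poly_def)

lemma free_poly_pCons:
  "free_poly (pCons a p) = Poly_Mapping.single 0 a + free_gen Gen_x * free_poly p"
proof (cases "p = 0")
  case True
  then show ?thesis by (simp add: free_poly_def)
next
  case False
  have x_commutes: "Poly_Mapping.single 0 c * free_gen Gen_x = free_gen Gen_x * Poly_Mapping.single 0 c" for c :: 'a
    by (simp add: free_gen_def mult_single)
  have "free_poly (pCons a p) = (\<Sum>i\<le>Suc (degree p).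
      Poly_Mapping.single 0 (coeff (pCons a p) i) * free_gen Gen_x ^ i)"
    using False by (simp add: free_poly_def)
  also have "\<dots> = Poly_Mapping.single 0 a +
      (\<Sum>i\<le>degree p. Poly_Mapping.single 0 (coeff p i) * free_gen Gen_x ^ Suc i)"
    by (subst sum.atMost_Suc_shift) simp
  also have "(\<Sum>i\<le>degree p. Poly_Mapping.single 0 (coeff p i) * free_gen Gen_x ^ Suc i) =
      free_gen Gen_x * free_poly p"
    by (simp add: free_poly_def sum_distrib_left mult.assoc[symmetric] x_commutes)
  finally show ?thesis .
qed

lemma free_poly_const: "free_poly [:c:] = Poly_Mapping.single 0 c"
  by (simp add: free_poly_pCons)

lemma free_poly_add: "free_poly (p + q) = free_poly p + free_poly q"
  by (induction p q rule: poly_induct2) (simp_all add: free_poly_pCons single_add algebra_simps)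

lemma free_poly_smult: "free_poly (smult c p) = Poly_Mapping.single 0 c * free_poly p"
proof (induction p)
  case (pCons a p)
  have "Poly_Mapping.single 0 c * free_gen Gen_x = free_gen Gen_x * Poly_Mapping.single 0 c"
    by (simp add: free_gen_def mult_single)
  then have "Poly_Mapping.single 0 c * (free_gen Gen_x * free_poly p) = free_gen Gen_x * free_poly (smult c p)"
    by (simp add: pCons mult.assoc[symmetric])
  then show ?case by (simp add: free_poly_pCons distrib_left mult_single)
qed simp

lemma free_poly_mult: "free_poly (p * q) = free_poly p * free_poly q"
  by (induction p)
    (simp_all add: free_poly_pCons free_poly_add free_poly_smult distrib_right mult.assoc)

lemma free_poly_1 [simp]: "free_poly 1 = 1"
  using free_poly_const[of 1] by (simp flip: one_pCons)


section \<open>The action of the free algebra on the model\<close>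

fun gen_act :: "'a::field poly \<Rightarrow> generator \<Rightarrow> 'a poly poly \<Rightarrow> 'a poly poly" where
  "gen_act h Gen_x = lmul h [:0, 1:]"
| "gen_act h Gen_y = pCons 0"

definition word_act :: "'a::field poly \<Rightarrow> xy_word \<Rightarrow> 'a poly poly \<Rightarrow> 'a poly poly" where
  "word_act h u = foldr (gen_act h) (letters u)"

definition free_act :: "'a::field poly \<Rightarrow> 'a free_xy \<Rightarrow> 'a poly poly \<Rightarrow> 'a poly poly" where
  "free_act h w p =
     (\<Sum>u\<in>Poly_Mapping.keys w. smult [:Poly_Mapping.lookup w u:] (word_act h u p))"

lemma word_act_0 [simp]: "word_act h 0 p = p"
  by (simp add: word_act_def zero_xy_word_def)

lemma word_act_plus: "word_act h (u + v) p = word_act h u (word_act h v p)"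
  by (simp add: word_act_def plus_xy_word_def)

lemma word_act_gen [simp]: "word_act h (Word [g]) p = gen_act h g p"
  by (simp add: word_act_def)

lemma gen_act_add: "gen_act h g (p + q) = gen_act h g p + gen_act h g q"
  by (cases g) (simp_all add: lmul_add_right)

lemma gen_act_smult: "gen_act h g (smult s p) = smult s (gen_act h g p)"
  by (cases g) (simp_all add: lmul_smult)

lemma word_act_add: "word_act h u (p + q) = word_act h u p + word_act h u q"
  by (induction u rule: word_induct) (simp_all add: word_act_plus gen_act_add)

lemma word_act_smult: "word_act h u (smult s p) = smult s (word_act h u p)"
  by (induction u rule: word_induct) (simp_all add: word_act_plus gen_act_smult)

lemma free_act_0 [simp]: "free_act h 0 p = 0"
  by (simp add: free_act_def)

lemma free_act_single [simp]: "free_act h (Poly_Mapping.single u c) p = smult [:c:] (word_act h u p)"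
  by (simp add: free_act_def)

lemma free_act_superset:
  assumes "finite A" "Poly_Mapping.keys w \<subseteq> A"
  shows "free_act h w p = (\<Sum>u\<in>A. smult [:Poly_Mapping.lookup w u:] (word_act h u p))"
  unfolding free_act_def using assms
  by (intro sum.mono_neutral_left) (auto simp: in_keys_iff)

lemma free_act_add_left: "free_act h (v + w) p = free_act h v p + free_act h w p"
proof -
  let ?A = "Poly_Mapping.keys v \<union> Poly_Mapping.keys w"
  have fin: "finite ?A" by simp
  have "Poly_Mapping.keys (v + w) \<subseteq> ?A" by (rule Poly_Mapping.keys_add)
  then show ?thesis
    unfolding free_act_superset[OF fin Un_upper1] free_act_superset[OF fin Un_upper2]
      sum.distrib[symmetric]
    by (simp only: free_act_superset[OF fin])
      (intro sum.cong refl, simp add: lookup_add smult_add_left[symmetric])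
qed

lemma free_act_add_right: "free_act h w (p + q) = free_act h w p + free_act h w q"
  by (simp add: free_act_def word_act_add smult_add_right sum.distrib)

lemma free_act_0_right [simp]: "free_act h w 0 = 0"
  using free_act_add_right[of h w 0 0] by (metis add_0 add_cancel_right_left)

lemma free_act_minus_left: "free_act h (- w) p = - free_act h w p"
  using free_act_add_left[of h w "- w" p] by (simp add: eq_neg_iff_add_eq_0 add.commute)

lemma free_act_diff_left: "free_act h (v - w) p = free_act h v p - free_act h w p"
  using free_act_add_left[of h v "- w" p] by (simp add: free_act_minus_left)

lemma free_act_mult: "free_act h (v * w) p = free_act h v (free_act h w p)"
proof (induction v rule: free_xy_induct)
  case (single u c)
  show ?case
  proof (induction w rule: free_xy_induct)
    case (single u' c')
    show ?case by (simp add: mult_single word_act_plus word_act_smult mult.commute)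
  next
    case (add w w')
    then show ?case by (simp add: distrib_left free_act_add_left word_act_add smult_add_right)
  qed (simp add: word_act_smult)
qed (simp_all add: distrib_right free_act_add_left)

lemma free_act_1 [simp]: "free_act h 1 p = p"
  using free_act_single[of h 0 1 p] by (simp add: one_pCons[symmetric])

text \<open>x acts as \<open>lmul\<close> by \<open>[:0, 1:]\<close>, and \<open>lmul\<close>
  respects sums and products in its polynomial argument, so the Horner form of r gives the
  claim.\<close>

lemma free_act_poly: "free_act h (free_poly r) p = lmul h r p"
proof (induction r arbitrary: p)
  case (pCons a r)
  have "free_act h (free_poly (pCons a r)) p = lmul h [:a:] p + lmul h [:0, 1:] (lmul h r p)"
    by (simp add: free_poly_pCons free_act_add_left free_act_mult pCons.IH free_gen_def one_pCons[symmetric])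
  also have "\<dots> = lmul h ([:a:] + [:0, 1:] * r) p"
    by (simp only: lmul_add_left lmul_mult_left)
  also have "[:a:] + [:0, 1:] * r = pCons a r" by simp
  finally show ?case .
qed simp

lemma free_act_y [simp]: "free_act h (free_gen Gen_y) p = pCons 0 p"
  by (simp add: free_gen_def one_pCons[symmetric])

text \<open>Every word acts by composing left multiplications by x with the shift
  \<open>pCons 0\<close>, and every scalar acts as left multiplication by a constant; stability
  under F[x] and y thus gives stability under the whole algebra.\<close>

lemma free_act_closed:
  assumes "0 \<in> J" "\<And>p q. \<lbrakk>p \<in> J; q \<in> J\<rbrakk> \<Longrightarrow> p + q \<in> J"
    and "\<And>r p. p \<in> J \<Longrightarrow> lmul h r p \<in> J" "\<And>p. p \<in> J \<Longrightarrow> pCons 0 p \<in> J" "p \<in> J"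
  shows "free_act h w p \<in> J"
proof (induction w rule: free_xy_induct)
  case zero
  then show ?case using assms(1) by simp
next
  case (single u c)
  have "gen_act h g q \<in> J" if "q \<in> J" for g q
    using that assms(3,4) by (cases g) auto
  then have "word_act h u p \<in> J"
    using assms(5) by (induction u rule: word_induct) (simp_all add: word_act_plus)
  from assms(3)[OF this, of "[:c:]"] show ?case by simp
next
  case (add v w)
  then show ?case using assms(2) by (simp add: free_act_add_left)
qed

lemma ring_ring_of_type_algebra: "ring (ring_of_type_algebra :: 'b::ring_1 ring)"
proof (rule ringI)
  show "abelian_group (ring_of_type_algebra :: 'b ring)"
  proof (rule abelian_groupI)
    show "\<exists>y\<in>carrier ring_of_type_algebra. y \<oplus>\<^bsub>ring_of_type_algebra\<^esub> x = \<zero>\<^bsub>ring_of_type_algebra\<^esub>" for x :: 'b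
      by (rule bexI[of _ "- x"]) (simp_all add: ring_of_type_algebra_def)
  qed (simp_all add: ring_of_type_algebra_def algebra_simps)
  show "Group.monoid (ring_of_type_algebra :: 'b ring)"
    by (rule monoidI) (simp_all add: ring_of_type_algebra_def algebra_simps)
qed (simp_all add: ring_of_type_algebra_def algebra_simps)

lemma ring_of_type_algebra_simps [simp]:
  "carrier ring_of_type_algebra = (UNIV :: 'b::ring_1 set)"
  "\<zero>\<^bsub>ring_of_type_algebra\<^esub> = (0 :: 'b)" "\<one>\<^bsub>ring_of_type_algebra\<^esub> = (1 :: 'b)"
  "x \<oplus>\<^bsub>ring_of_type_algebra\<^esub> y = (x + y :: 'b)" "x \<otimes>\<^bsub>ring_of_type_algebra\<^esub> y = (x * y :: 'b)"
  by (simp_all add: ring_of_type_algebra_def)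

lemma a_inv_ring_of_type_algebra [simp]: "\<ominus>\<^bsub>ring_of_type_algebra\<^esub> x = (- x :: 'b::ring_1)"
proof -
  interpret ring "ring_of_type_algebra :: 'b ring" by (rule ring_ring_of_type_algebra)
  show ?thesis by (rule minus_equality) simp_all
qed

section \<open>The quotient algebra: its classes, its action on the model, its commutation
  rule\<close>

definition Ah_class :: "'a::field poly \<Rightarrow> 'a free_xy \<Rightarrow> 'a free_xy set" where
  "Ah_class h w = Ah_ideal h +>\<^bsub>ring_of_type_algebra\<^esub> w"

lemma ideal_Ah_ideal: "ideal (Ah_ideal h) ring_of_type_algebra"
proof -
  interpret ring "ring_of_type_algebra :: 'a free_xy ring" by (rule ring_ring_of_type_algebra)
  show ?thesis unfolding Ah_ideal_def by (rule genideal_ideal) simp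
qed

lemma ring_Ah: "ring (Ah h)"
  unfolding Ah_def by (rule ideal.quotient_is_ring[OF ideal_Ah_ideal])

lemma Ah_ideal_closed:
  "0 \<in> Ah_ideal h"
  "\<lbrakk>v \<in> Ah_ideal h; w \<in> Ah_ideal h\<rbrakk> \<Longrightarrow> v + w \<in> Ah_ideal h"
  "v \<in> Ah_ideal h \<Longrightarrow> v * u \<in> Ah_ideal h" "v \<in> Ah_ideal h \<Longrightarrow> u * v \<in> Ah_ideal h"
  "v \<in> Ah_ideal h \<Longrightarrow> - v \<in> Ah_ideal h"
proof -
  note I = ideal_Ah_ideal[of h] and A = ideal.axioms(1)[OF ideal_Ah_ideal[of h]]
  show "0 \<in> Ah_ideal h" using additive_subgroup.zero_closed[OF A] by simp
  show "\<lbrakk>v \<in> Ah_ideal h; w \<in> Ah_ideal h\<rbrakk> \<Longrightarrow> v + w \<in> Ah_ideal h"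
    using additive_subgroup.a_closed[OF A, of v w] by simp
  show "v \<in> Ah_ideal h \<Longrightarrow> v * u \<in> Ah_ideal h" using ideal.I_r_closed[OF I, of v u] by simp
  show "v \<in> Ah_ideal h \<Longrightarrow> u * v \<in> Ah_ideal h" using ideal.I_l_closed[OF I, of v u] by simp
  show "v \<in> Ah_ideal h \<Longrightarrow> - v \<in> Ah_ideal h" using ideal.I_l_closed[OF I, of v "- 1"] by simp
qed

lemma Ah_class_hom:
  shows Ah_class_add: "Ah_class h (v + w) = Ah_class h v \<oplus>\<^bsub>Ah h\<^esub> Ah_class h w"
    and Ah_class_mult: "Ah_class h (v * w) = Ah_class h v \<otimes>\<^bsub>Ah h\<^esub> Ah_class h w"
    and Ah_class_1: "Ah_class h 1 = \<one>\<^bsub>Ah h\<^esub>"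
    and Ah_class_closed [simp]: "Ah_class h w \<in> carrier (Ah h)"
proof -
  have hom: "Ah_class h \<in> ring_hom ring_of_type_algebra (Ah h)"
    using ideal.rcos_ring_hom[OF ideal_Ah_ideal, of h] unfolding Ah_def Ah_class_def .
  show "Ah_class h (v + w) = Ah_class h v \<oplus>\<^bsub>Ah h\<^esub> Ah_class h w"
    using ring_hom_add[OF hom, of v w] by simp
  show "Ah_class h (v * w) = Ah_class h v \<otimes>\<^bsub>Ah h\<^esub> Ah_class h w"
    using ring_hom_mult[OF hom, of v w] by simp
  show "Ah_class h 1 = \<one>\<^bsub>Ah h\<^esub>"
    using ring_hom_one[OF hom] by simp
  show "Ah_class h w \<in> carrier (Ah h)"
    using ring_hom_closed[OF hom, of w] by simp
qed

lemma Ah_cases: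
  assumes "a \<in> carrier (Ah h)"
  obtains w where "a = Ah_class h w"
  using assms unfolding Ah_def FactRing_def A_RCOSETS_def' Ah_class_def by auto

lemma mem_Ah_class_iff: "v \<in> Ah_class h w \<longleftrightarrow> v - w \<in> Ah_ideal h"
proof
  show "v - w \<in> Ah_ideal h" if "v \<in> Ah_class h w"
    using that by (auto simp: Ah_class_def a_r_coset_def')
  show "v \<in> Ah_class h w" if "v - w \<in> Ah_ideal h"
    using that unfolding Ah_class_def a_r_coset_def' by (auto intro!: bexI[OF _ that])
qed

lemma Ah_class_eqI:
  assumes "v - w \<in> Ah_ideal h" shows "Ah_class h v = Ah_class h w"
proof -
  have "u - w \<in> Ah_ideal h \<longleftrightarrow> u - v \<in> Ah_ideal h" for u
    using Ah_ideal_closed(2)[OF _ assms, of "u - v"] Ah_ideal_closed(2)[OF _ Ah_ideal_closed(5)[OF assms], of "u - w"]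
    by (auto simp: algebra_simps)
  then show ?thesis by (auto simp: mem_Ah_class_iff)
qed

text \<open>The elements acting by zero on the model form a two-sided ideal containing the defining
  relation, hence the ideal generated by it. The action therefore descends to
  \<open>Ah h\<close>.\<close>

lemma free_act_Ah_ideal:
  assumes "w \<in> Ah_ideal h" shows "free_act h w p = 0"
proof -
  interpret ring "ring_of_type_algebra :: 'a free_xy ring" by (rule ring_ring_of_type_algebra)
  let ?I = "{w. \<forall>p. free_act h w p = 0}"
  have "ideal ?I ring_of_type_algebra"
  proof (rule idealI)
    show "ring (ring_of_type_algebra :: 'a free_xy ring)" by (rule ring_axioms)
    show "subgroup ?I (add_monoid ring_of_type_algebra)"
    proof (rule add.subgroupI)
      show "?I \<noteq> {}" using free_act_0 by blast
    qed (simp_all add: free_act_add_left free_act_minus_left)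
  qed (auto simp: free_act_mult)
  moreover have "free_act h (free_gen Gen_y * free_gen Gen_x -
      (free_gen Gen_x * free_gen Gen_y + free_poly h)) p = 0" for p
  proof -
    \<comment> \<open>Since h = \<delta>(x), the defining relation is the rule \<open>lmul_y\<close>
      for r = x.\<close>
    have "delta h [:0, 1:] = h" by (simp add: delta_def pderiv_pCons)
    moreover have "free_gen Gen_x = free_poly [:0, 1 :: 'a:]"
      by (simp add: free_poly_pCons)
    ultimately show ?thesis
      using lmul_y[of h "[:0, 1:]" p]
      by (simp add: free_act_diff_left free_act_add_left free_act_mult free_act_poly)
  qed
  ultimately have "Ah_ideal h \<subseteq> ?I"
    unfolding Ah_ideal_def by (intro genideal_minimal) auto
  then show ?thesis using assms by blast
qed

lemma Ah_poly_class: "Ah_poly h r = Ah_class h (free_poly r)"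
  by (simp add: Ah_poly_def Ah_class_def)

lemma Ah_y_class: "Ah_y h = Ah_class h (free_gen Gen_y)"
  by (simp add: Ah_y_def Ah_class_def)

lemma Ah_poly_hom:
  shows Ah_poly_add: "Ah_poly h (r + s) = Ah_poly h r \<oplus>\<^bsub>Ah h\<^esub> Ah_poly h s"
    and Ah_poly_mult: "Ah_poly h (r * s) = Ah_poly h r \<otimes>\<^bsub>Ah h\<^esub> Ah_poly h s"
    and Ah_poly_1: "Ah_poly h 1 = \<one>\<^bsub>Ah h\<^esub>"
    and Ah_poly_closed [simp]: "Ah_poly h r \<in> carrier (Ah h)"
    and Ah_y_closed [simp]: "Ah_y h \<in> carrier (Ah h)"
  by (simp_all add: Ah_poly_class Ah_y_class free_poly_add free_poly_mult Ah_class_hom)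

lemma Ah_poly_0: "Ah_poly h 0 = \<zero>\<^bsub>Ah h\<^esub>"
proof -
  interpret ring "Ah h" by (rule ring_Ah)
  show ?thesis using Ah_poly_add[of h 0 0] add.l_cancel_one[of "Ah_poly h 0" "Ah_poly h 0"] by simp
qed

text \<open>The defining relation is the case r = x. For a + x r, multiply it by r on the right and
  add x times the induction hypothesis: the remainder h r + x \<delta>(r) is \<delta>(a + x
  r).\<close>

lemma Ah_commutation:
  "Ah_y h \<otimes>\<^bsub>Ah h\<^esub> Ah_poly h r = Ah_poly h r \<otimes>\<^bsub>Ah h\<^esub> Ah_y h \<oplus>\<^bsub>Ah h\<^esub> Ah_poly h (delta h r)"
proof -
  interpret ring "ring_of_type_algebra :: 'a free_xy ring" by (rule ring_ring_of_type_algebra)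
  let ?x = "free_gen Gen_x :: 'a free_xy" and ?y = "free_gen Gen_y :: 'a free_xy"
  have rel: "?y * ?x - (?x * ?y + free_poly h) \<in> Ah_ideal h"
    unfolding Ah_ideal_def by (rule subsetD[OF genideal_self]) auto
  have "?y * free_poly r - (free_poly r * ?y + free_poly (delta h r)) \<in> Ah_ideal h"
  proof (induction r)
    case 0
    then show ?case by (simp add: Ah_ideal_closed)
  next
    case (pCons a r)
    have c: "?y * Poly_Mapping.single 0 a = Poly_Mapping.single 0 a * ?y"
      by (simp add: free_gen_def mult_single)
    have d: "delta h (pCons a r) = r * h + pCons 0 (delta h r)"
      by (simp add: delta_def pderiv_pCons algebra_simps)
    have "(?y * ?x - (?x * ?y + free_poly h)) * free_poly r
        + ?x * (?y * free_poly r - (free_poly r * ?y + free_poly (delta h r))) \<in> Ah_ideal h"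
      using Ah_ideal_closed(2)[OF Ah_ideal_closed(3)[OF rel] Ah_ideal_closed(4)[OF pCons.IH]] .
    moreover have "free_poly h * free_poly r = free_poly (r * h)"
      by (simp add: free_poly_mult[symmetric] mult.commute)
    ultimately show ?case
      by (simp add: d c free_poly_pCons free_poly_add algebra_simps)
  qed
  from Ah_class_eqI[OF this] show ?thesis
    by (simp add: Ah_poly_class Ah_y_class Ah_class_hom)
qed

section \<open>Cyclic modules over \<open>A\<^sub>h\<close>\<close>

text \<open>This is the sum of the y^i (p_i v) in Horner form. Each coefficient acts before its
  power of y, in accordance with the coefficients standing on the right in the model.\<close>

definition cyclic_map :: "'a::field poly \<Rightarrow> ('a, 'm) Ah_module \<Rightarrow> 'm \<Rightarrow> 'a poly poly \<Rightarrow> 'm" where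
  "cyclic_map h M v p =
     fold_coeffs (\<lambda>a w. Ah_poly h a \<odot>\<^bsub>M\<^esub> v \<oplus>\<^bsub>M\<^esub> Ah_y h \<odot>\<^bsub>M\<^esub> w) p \<zero>\<^bsub>M\<^esub>"

text \<open>The subsets of the model that correspond to submodules.\<close>

definition left_closed :: "'a::field poly \<Rightarrow> 'a poly poly set \<Rightarrow> bool" where
  "left_closed h J \<longleftrightarrow> 0 \<in> J \<and> (\<forall>p\<in>J. \<forall>q\<in>J. p + q \<in> J) \<and>
     (\<forall>r. \<forall>p\<in>J. lmul h r p \<in> J) \<and> (\<forall>p\<in>J. pCons 0 p \<in> J)"

lemma left_closedD:
  assumes "left_closed h J"
  shows "0 \<in> J" "\<lbrakk>p \<in> J; q \<in> J\<rbrakk> \<Longrightarrow> p + q \<in> J" "p \<in> J \<Longrightarrow> lmul h r p \<in> J"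
    "p \<in> J \<Longrightarrow> pCons 0 p \<in> J" "p \<in> J \<Longrightarrow> smult [:c:] p \<in> J" "\<lbrakk>p \<in> J; q \<in> J\<rbrakk> \<Longrightarrow> p - q \<in> J"
    "p \<in> J \<Longrightarrow> free_act h w p \<in> J"
proof -
  have minus_one: "[:- 1 :: 'a:] = - 1" by (simp add: one_pCons)
  show "0 \<in> J" and add: "\<And>p q. \<lbrakk>p \<in> J; q \<in> J\<rbrakk> \<Longrightarrow> p + q \<in> J"
    and l: "\<And>p r. p \<in> J \<Longrightarrow> lmul h r p \<in> J" and "\<And>p. p \<in> J \<Longrightarrow> pCons 0 p \<in> J"
    using assms by (auto simp: left_closed_def)
  then show "p \<in> J \<Longrightarrow> free_act h w p \<in> J" by (intro free_act_closed[of J h p w]) auto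
  show c: "p \<in> J \<Longrightarrow> smult [:c:] p \<in> J" for p c using l[of p "[:c:]"] by simp
  show "\<lbrakk>p \<in> J; q \<in> J\<rbrakk> \<Longrightarrow> p - q \<in> J"
    using add[of p "- q"] c[of q "- 1"] minus_one by simp
qed

lemma free_gen_x: "free_gen Gen_x = free_poly [:0, 1:]"
  by (simp add: free_poly_pCons)

locale Ah_left_module = left_module "Ah h" M
  for h :: "'a::field poly" and M :: "('a, 'm) Ah_module"
begin

abbreviation "\<Phi> \<equiv> cyclic_map h M"

lemma poly_smult:
  assumes "v \<in> carrier M"
  shows poly_smult_closed: "Ah_poly h r \<odot>\<^bsub>M\<^esub> v \<in> carrier M"
    and y_smult_closed: "Ah_y h \<odot>\<^bsub>M\<^esub> v \<in> carrier M"
    and poly_smult_add: "Ah_poly h (r + s) \<odot>\<^bsub>M\<^esub> v = Ah_poly h r \<odot>\<^bsub>M\<^esub> v \<oplus>\<^bsub>M\<^esub> Ah_poly h s \<odot>\<^bsub>M\<^esub> v"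
    and poly_smult_mult: "Ah_poly h (r * s) \<odot>\<^bsub>M\<^esub> v = Ah_poly h r \<odot>\<^bsub>M\<^esub> (Ah_poly h s \<odot>\<^bsub>M\<^esub> v)"
    and poly_smult_0: "Ah_poly h 0 \<odot>\<^bsub>M\<^esub> v = \<zero>\<^bsub>M\<^esub>"
    and poly_smult_1: "Ah_poly h 1 \<odot>\<^bsub>M\<^esub> v = v"
  using assms
  by (simp_all add: smult_closed Ah_poly_add smult_l_distr Ah_poly_mult smult_assoc Ah_poly_0 Ah_poly_1 smult_one)

lemma y_poly_smult:
  assumes "v \<in> carrier M"
  shows "Ah_y h \<odot>\<^bsub>M\<^esub> (Ah_poly h r \<odot>\<^bsub>M\<^esub> v) =
    Ah_poly h r \<odot>\<^bsub>M\<^esub> (Ah_y h \<odot>\<^bsub>M\<^esub> v) \<oplus>\<^bsub>M\<^esub> Ah_poly h (delta h r) \<odot>\<^bsub>M\<^esub> v"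
proof -
  have "Ah_y h \<odot>\<^bsub>M\<^esub> (Ah_poly h r \<odot>\<^bsub>M\<^esub> v) = (Ah_y h \<otimes>\<^bsub>Ah h\<^esub> Ah_poly h r) \<odot>\<^bsub>M\<^esub> v"
    using assms by (simp add: smult_assoc)
  then show ?thesis
    using assms by (simp add: Ah_commutation smult_l_distr smult_assoc)
qed

lemma cyclic_0 [simp]: "\<Phi> v 0 = \<zero>\<^bsub>M\<^esub>"
  by (simp add: cyclic_map_def)

lemma cyclic_pCons:
  assumes "v \<in> carrier M"
  shows "\<Phi> v (pCons a p) = Ah_poly h a \<odot>\<^bsub>M\<^esub> v \<oplus>\<^bsub>M\<^esub> Ah_y h \<odot>\<^bsub>M\<^esub> \<Phi> v p"
proof (cases "a = 0 \<and> p = 0")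
  case True
  then show ?thesis using assms by (simp add: poly_smult_0)
next
  case False
  then show ?thesis by (auto simp: cyclic_map_def)
qed

lemma cyclic_closed [simp]:
  assumes "v \<in> carrier M" shows "\<Phi> v p \<in> carrier M"
  by (induction p) (simp_all add: cyclic_pCons assms poly_smult_closed y_smult_closed)

lemma cyclic_const: "v \<in> carrier M \<Longrightarrow> \<Phi> v [:a:] = Ah_poly h a \<odot>\<^bsub>M\<^esub> v"
  by (simp add: cyclic_pCons poly_smult_closed)

lemma cyclic_1: "v \<in> carrier M \<Longrightarrow> \<Phi> v 1 = v"
  by (simp add: one_pCons cyclic_const) (simp add: one_pCons[symmetric] poly_smult_1)

lemma cyclic_y: "v \<in> carrier M \<Longrightarrow> \<Phi> v (pCons 0 p) = Ah_y h \<odot>\<^bsub>M\<^esub> \<Phi> v p"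
  by (simp add: cyclic_pCons poly_smult_0 y_smult_closed)

lemma cyclic_add:
  assumes "v \<in> carrier M"
  shows "\<Phi> v (p + q) = \<Phi> v p \<oplus>\<^bsub>M\<^esub> \<Phi> v q"
proof (induction p q rule: poly_induct2)
  case (pCons a p b q)
  show ?case
    using assms
    by (simp add: cyclic_pCons pCons poly_smult_add smult_r_distr poly_smult_closed y_smult_closed M.a_ac)
qed simp

lemma cyclic_eq_iff:
  assumes "v \<in> carrier M"
  shows "\<Phi> v p = \<Phi> v q \<longleftrightarrow> \<Phi> v (p - q) = \<zero>\<^bsub>M\<^esub>"
proof -
  have "\<Phi> v p = \<Phi> v (p - q) \<oplus>\<^bsub>M\<^esub> \<Phi> v q"
    using cyclic_add[OF assms, of "p - q" q] by simp
  moreover have "\<Phi> v (p - q) \<in> carrier M" "\<Phi> v q \<in> carrier M" using assms by simp_all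
  ultimately show ?thesis
    by (metis M.l_zero M.add.r_cancel M.zero_closed)
qed

lemma cyclic_diff:
  assumes "v \<in> carrier M"
  shows "\<Phi> v (p - q) = \<Phi> v p \<ominus>\<^bsub>M\<^esub> \<Phi> v q"
proof -
  have "\<Phi> v p = \<Phi> v (p - q) \<oplus>\<^bsub>M\<^esub> \<Phi> v q"
    using cyclic_add[OF assms, of "p - q" q] by simp
  moreover have "\<Phi> v (p - q) \<in> carrier M" "\<Phi> v q \<in> carrier M" using assms by simp_all
  ultimately show ?thesis
    unfolding a_minus_def by (simp add: M.a_assoc M.r_neg)
qed

text \<open>Right multiplication by s can be moved onto the generator: (a s) v = a (s v). In
  particular, if f kills v then every multiple of \<open>[:f:]\<close> is sent to zero.\<close>

lemma cyclic_smult: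
  assumes "v \<in> carrier M"
  shows "\<Phi> v (smult s p) = \<Phi> (Ah_poly h s \<odot>\<^bsub>M\<^esub> v) p"
proof (induction p)
  case (pCons a p)
  have "Ah_poly h (s * a) \<odot>\<^bsub>M\<^esub> v = Ah_poly h a \<odot>\<^bsub>M\<^esub> (Ah_poly h s \<odot>\<^bsub>M\<^esub> v)"
    using poly_smult_mult[OF assms, of a s] by (simp add: mult.commute)
  then show ?case using assms by (simp add: cyclic_pCons poly_smult_closed pCons)
qed simp

lemma cyclic_of_zero: "\<Phi> \<zero>\<^bsub>M\<^esub> p = \<zero>\<^bsub>M\<^esub>"
  by (induction p) (simp_all add: cyclic_pCons)

lemma cyclic_lmul:
  assumes "v \<in> carrier M"
  shows "\<Phi> v (lmul h r p) = Ah_poly h r \<odot>\<^bsub>M\<^esub> \<Phi> v p"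
proof (induction p arbitrary: r)
  case 0
  then show ?case by simp
next
  case (pCons a p)
  let ?d = "Ah_poly h (delta h r) \<odot>\<^bsub>M\<^esub> \<Phi> v p"
  have closed: "\<Phi> v (lmul h r (pCons a p)) \<in> carrier M" "Ah_poly h r \<odot>\<^bsub>M\<^esub> \<Phi> v (pCons a p) \<in> carrier M"
    "?d \<in> carrier M"
    using assms by (simp_all add: poly_smult_closed)
  \<comment> \<open>The correction term \<open>?d\<close> is added to both sides, which turns the
    subtraction in \<open>lmul_pCons\<close> into a sum; it is cancelled at the end.\<close>
  have "\<Phi> v (lmul h r (pCons a p)) \<oplus>\<^bsub>M\<^esub> ?d = \<Phi> v (lmul h r (pCons a p) + lmul h (delta h r) p)"
    using assms by (simp add: cyclic_add pCons.IH)
  also have "\<dots> = \<Phi> v (pCons (r * a) (lmul h r p))"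
    by (simp add: lmul_pCons)
  also have "\<dots> = Ah_poly h r \<odot>\<^bsub>M\<^esub> (Ah_poly h a \<odot>\<^bsub>M\<^esub> v) \<oplus>\<^bsub>M\<^esub> Ah_y h \<odot>\<^bsub>M\<^esub> (Ah_poly h r \<odot>\<^bsub>M\<^esub> \<Phi> v p)"
    using assms by (simp add: cyclic_pCons pCons.IH poly_smult_mult)
  also have "\<dots> = Ah_poly h r \<odot>\<^bsub>M\<^esub> \<Phi> v (pCons a p) \<oplus>\<^bsub>M\<^esub> ?d"
    using assms
    by (simp add: y_poly_smult cyclic_pCons smult_r_distr poly_smult_closed y_smult_closed M.a_assoc)
  finally show ?case
    using closed M.add.r_cancel by blast
qed

text \<open>The map from the model to M is equivariant for the whole algebra and not only for F[x]
  and y. Linearity reduces this to words, and words reduce to the two generators.\<close>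

lemma cyclic_act:
  assumes "v \<in> carrier M"
  shows "Ah_class h w \<odot>\<^bsub>M\<^esub> \<Phi> v p = \<Phi> v (free_act h w p)"
proof (induction w rule: free_xy_induct)
  case zero
  have "Ah_class h 0 = Ah_poly h 0" by (simp add: Ah_poly_class)
  then show ?case using assms by (simp add: poly_smult_0)
next
  case (single u c)
  have word: "Ah_class h (Poly_Mapping.single u 1) \<odot>\<^bsub>M\<^esub> \<Phi> v p = \<Phi> v (word_act h u p)"
  proof (induction u rule: word_induct)
    case Nil
    then show ?case using assms by (simp add: Ah_class_1 smult_one)
  next
    case (Cons g u)
    have "Poly_Mapping.single (Word [g] + u) (1 :: 'a) = free_gen g * Poly_Mapping.single u 1"
      by (simp add: free_gen_def mult_single)
    then have "Ah_class h (Poly_Mapping.single (Word [g] + u) 1) \<odot>\<^bsub>M\<^esub> \<Phi> v p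
        = Ah_class h (free_gen g) \<odot>\<^bsub>M\<^esub> \<Phi> v (word_act h u p)"
      using assms Cons by (simp add: Ah_class_mult smult_assoc)
    also have "\<dots> = \<Phi> v (gen_act h g (word_act h u p))"
      using assms
      by (cases g) (simp_all add: free_gen_x cyclic_lmul cyclic_y flip: Ah_poly_class Ah_y_class)
    finally show ?case by (simp add: word_act_plus)
  qed
  have "Poly_Mapping.single u c = free_poly [:c:] * Poly_Mapping.single u 1"
    by (simp add: free_poly_const mult_single)
  then have "Ah_class h (Poly_Mapping.single u c) \<odot>\<^bsub>M\<^esub> \<Phi> v p
      = Ah_poly h [:c:] \<odot>\<^bsub>M\<^esub> \<Phi> v (word_act h u p)"
    using assms word by (simp add: Ah_class_mult smult_assoc Ah_poly_class)
  then show ?case using assms cyclic_lmul[of v "[:c:]"] by simp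
next
  case (add w w')
  then show ?case using assms by (simp add: Ah_class_add smult_l_distr free_act_add_left cyclic_add)
qed

lemma cyclic_image_submodule:
  assumes "v \<in> carrier M" "left_closed h J"
  shows "Module.submodule (\<Phi> v ` J) (Ah h) M"
proof (rule submoduleI')
  show "\<Phi> v ` J \<subseteq> carrier M" using assms(1) by auto
  show "\<zero>\<^bsub>M\<^esub> \<in> \<Phi> v ` J"
    using left_closedD(1)[OF assms(2)] by (intro image_eqI[of _ _ 0]) simp_all
  show "x \<oplus>\<^bsub>M\<^esub> y \<in> \<Phi> v ` J" if "x \<in> \<Phi> v ` J" "y \<in> \<Phi> v ` J" for x y
  proof -
    obtain p q where "x = \<Phi> v p" "y = \<Phi> v q" "p \<in> J" "q \<in> J" using \<open>x \<in> \<Phi> v ` J\<close> \<open>y \<in> \<Phi> v ` J\<close> by blast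
    then show ?thesis
      using left_closedD(2)[OF assms(2), of p q] by (auto simp flip: cyclic_add[OF assms(1)])
  qed
  show "a \<odot>\<^bsub>M\<^esub> x \<in> \<Phi> v ` J" if "a \<in> carrier (Ah h)" "x \<in> \<Phi> v ` J" for a x
  proof -
    obtain p where p: "x = \<Phi> v p" "p \<in> J" using \<open>x \<in> \<Phi> v ` J\<close> by blast
    obtain w where w: "a = Ah_class h w" using \<open>a \<in> carrier (Ah h)\<close> by (rule Ah_cases)
    show ?thesis
      unfolding p(1) w cyclic_act[OF assms(1)] using left_closedD(7)[OF assms(2) p(2)] by blast
  qed
qed

lemma cyclic_vimage_left_closed:
  assumes v: "v \<in> carrier M" and N: "Module.submodule N (Ah h) M"
  shows "left_closed h {p. \<Phi> v p \<in> N}"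
proof -
  interpret N: abelian_subgroup N M using N by (rule submodule_additive)
  show ?thesis
    unfolding left_closed_def mem_Collect_eq
    using Module.submodule.smult_closed[OF N Ah_poly_closed] Module.submodule.smult_closed[OF N Ah_y_closed]
    by (simp add: cyclic_add[OF v] cyclic_lmul[OF v] cyclic_y[OF v])
qed

text \<open>A nonzero submodule pulls back to a stable subset of the model strictly above the
  kernel. Once this subset contains 1, the submodule contains the generator. Irreducibility thus
  becomes a condition on subsets of the model.\<close>

lemma irreducible_cyclicI:
  assumes v: "v \<in> carrier M" "v \<noteq> \<zero>\<^bsub>M\<^esub>" and surj: "carrier M = range (\<Phi> v)"
    and J: "\<And>J. \<lbrakk>left_closed h J; {p. \<Phi> v p = \<zero>\<^bsub>M\<^esub>} \<subset> J\<rbrakk> \<Longrightarrow> 1 \<in> J"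
  shows "irreducible_module (Ah h) M"
  unfolding irreducible_module_def
proof (intro conjI allI impI)
  show "left_module (Ah h) M" by (rule left_module_axioms)
  show "carrier M \<noteq> {\<zero>\<^bsub>M\<^esub>}" using v by blast
  fix N assume N: "Module.submodule N (Ah h) M"
  interpret N: abelian_subgroup N M using N by (rule submodule_additive)
  show "N = {\<zero>\<^bsub>M\<^esub>} \<or> N = carrier M"
  proof (cases "N \<subseteq> {\<zero>\<^bsub>M\<^esub>}")
    case True
    then show ?thesis using N.zero_closed by blast
  next
    case False
    then obtain x where x: "x \<in> N" "x \<noteq> \<zero>\<^bsub>M\<^esub>" by blast
    then obtain p where p: "x = \<Phi> v p" using N.a_Hcarr[OF x(1)] unfolding surj by blast
    have "{p. \<Phi> v p = \<zero>\<^bsub>M\<^esub>} \<subset> {p. \<Phi> v p \<in> N}"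
      using x[unfolded p] N.zero_closed by auto
    from J[OF cyclic_vimage_left_closed[OF v(1) N] this]
    have one: "v \<in> N" unfolding mem_Collect_eq cyclic_1[OF v(1)] .
    have "\<Phi> v q \<in> N" for q
    proof (induction q)
      case (pCons a q)
      show ?case
        unfolding cyclic_pCons[OF v(1)]
        by (intro N.a_closed Module.submodule.smult_closed[OF N] Ah_poly_closed Ah_y_closed one pCons(2))
    qed simp
    then have "carrier M \<subseteq> N" unfolding surj by blast
    then show ?thesis using N.a_subset by blast
  qed
qed

end

lemma cyclic_map_hom:
  assumes M: "Ah_left_module h M" and N: "Ah_left_module h N"
    and T: "T \<in> module_hom (Ah h) M N" and v: "v \<in> carrier M"
  shows "T (cyclic_map h M v p) = cyclic_map h N (T v) p"
proof -
  interpret M: Ah_left_module h M by fact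
  interpret N: Ah_left_module h N by fact
  have Tv: "T v \<in> carrier N" using module_homD(1)[OF T v] .
  show ?thesis
  proof (induction p)
    case 0
    show ?case using module_hom_zero[OF M.left_module_axioms N.left_module_axioms T] by simp
  next
    case (pCons a p)
    show ?case
      unfolding M.cyclic_pCons[OF v] N.cyclic_pCons[OF Tv]
      using v pCons(2)
      by (simp add: module_homD[OF T] M.poly_smult_closed M.y_smult_closed)
  qed
qed

lemma isomorphic_cyclic:
  assumes M: "Ah_left_module h M" and N: "Ah_left_module h N"
    and v: "v \<in> carrier M" "carrier M = range (cyclic_map h M v)"
    and w: "w \<in> carrier N" "carrier N = range (cyclic_map h N w)"
    and ker: "\<And>p. cyclic_map h M v p = \<zero>\<^bsub>M\<^esub> \<longleftrightarrow> cyclic_map h N w p = \<zero>\<^bsub>N\<^esub>"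
  shows "isomorphic_modules (Ah h) M N"
proof -
  interpret M: Ah_left_module h M by fact
  interpret N: Ah_left_module h N by fact
  \<comment> \<open>Any preimage in the first module's model may be chosen: the kernels agree, so
    two choices have the same image. The same equality of kernels makes \<open>T\<close>
    injective.\<close>
  define T where "T x = cyclic_map h N w (SOME p. cyclic_map h M v p = x)" for x
  have T: "T (cyclic_map h M v p) = cyclic_map h N w p" for p
  proof -
    have "cyclic_map h M v (SOME q. cyclic_map h M v q = cyclic_map h M v p) = cyclic_map h M v p"
      by (rule someI) (rule refl)
    then show ?thesis
      unfolding T_def N.cyclic_eq_iff[OF w(1)] ker[symmetric] M.cyclic_eq_iff[OF v(1), symmetric] .
  qed
  have "T \<in> module_hom (Ah h) M N"
    unfolding module_hom_def
  proof (intro CollectI conjI allI impI funcsetI)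
    show "T x \<in> carrier N" for x
      unfolding T_def using w(1) by (rule N.cyclic_closed)
    show "T (x \<oplus>\<^bsub>M\<^esub> y) = T x \<oplus>\<^bsub>N\<^esub> T y" if xy: "x \<in> carrier M \<and> y \<in> carrier M" for x y
    proof -
      obtain p q where "x = cyclic_map h M v p" "y = cyclic_map h M v q" using xy v(2) by blast
      then show ?thesis
        by (simp add: T M.cyclic_add[OF v(1), symmetric] N.cyclic_add[OF w(1)])
    qed
    show "T (a \<odot>\<^bsub>M\<^esub> x) = a \<odot>\<^bsub>N\<^esub> T x" if ax: "a \<in> carrier (Ah h) \<and> x \<in> carrier M" for a x
    proof -
      obtain p where p: "x = cyclic_map h M v p" using ax v(2) by blast
      obtain u where u: "a = Ah_class h u" using ax Ah_cases by blast
      show ?thesis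
        unfolding p u M.cyclic_act[OF v(1)] T N.cyclic_act[OF w(1)] ..
    qed
  qed
  moreover have "bij_betw T (carrier M) (carrier N)"
    unfolding bij_betw_def
  proof
    show "inj_on T (carrier M)"
    proof (rule inj_onI)
      fix x y assume "x \<in> carrier M" "y \<in> carrier M" and eq: "T x = T y"
      then obtain p q where p: "x = cyclic_map h M v p" and q: "y = cyclic_map h M v q" using v(2) by blast
      show "x = y"
        using eq unfolding p q T N.cyclic_eq_iff[OF w(1)] M.cyclic_eq_iff[OF v(1)] ker .
    qed
    show "T ` carrier M = carrier N"
      unfolding v(2) w(2) image_image T ..
  qed
  ultimately show ?thesis
    unfolding isomorphic_modules_def by blast
qed


section \<open>The model itself as a cyclic module\<close>

definition poly_module :: "'a::field poly \<Rightarrow> ('a, 'a poly poly) Ah_module" where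
  "poly_module h = \<lparr>carrier = UNIV, monoid.mult = undefined, monoid.one = undefined,
     ring.zero = 0, ring.add = (+), module.smult = (\<lambda>a. free_act h (SOME w. w \<in> a))\<rparr>"

lemma poly_module_simps [simp]:
  "carrier (poly_module h) = UNIV" "\<zero>\<^bsub>poly_module h\<^esub> = 0" "p \<oplus>\<^bsub>poly_module h\<^esub> q = p + q"
  by (simp_all add: poly_module_def)

text \<open>The scalar action was defined through an arbitrary representative of a class; two
  representatives differ by an element of \<open>Ah_ideal h\<close>, which acts by zero.\<close>

lemma poly_module_smult: "Ah_class h w \<odot>\<^bsub>poly_module h\<^esub> p = free_act h w p"
proof -
  have "w \<in> Ah_class h w" by (simp add: mem_Ah_class_iff Ah_ideal_closed)
  then have "(SOME v. v \<in> Ah_class h w) \<in> Ah_class h w" by (rule someI)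
  then have "free_act h (SOME v. v \<in> Ah_class h w) p - free_act h w p = 0"
    unfolding free_act_diff_left[symmetric] mem_Ah_class_iff by (rule free_act_Ah_ideal)
  then show ?thesis by (simp add: poly_module_def)
qed

lemma poly_module_left_module: "Ah_left_module h (poly_module h)"
proof (intro Ah_left_module.intro left_module.intro ring_Ah)
  show "abelian_group (poly_module h)"
  proof (rule abelian_groupI)
    show "\<exists>y\<in>carrier (poly_module h). y \<oplus>\<^bsub>poly_module h\<^esub> x = \<zero>\<^bsub>poly_module h\<^esub>" for x
      by (rule bexI[of _ "- x"]) simp_all
  qed (simp_all add: algebra_simps)
  show "left_module_axioms (Ah h) (poly_module h)"
  proof
    fix a b v w
    assume "a \<in> carrier (Ah h)" "b \<in> carrier (Ah h)"
    then obtain u u' where u: "a = Ah_class h u" and u': "b = Ah_class h u'"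
      by (metis Ah_cases)
    show "(a \<oplus>\<^bsub>Ah h\<^esub> b) \<odot>\<^bsub>poly_module h\<^esub> v = a \<odot>\<^bsub>poly_module h\<^esub> v \<oplus>\<^bsub>poly_module h\<^esub> b \<odot>\<^bsub>poly_module h\<^esub> v"
      unfolding u u' Ah_class_add[symmetric] poly_module_smult by (simp add: free_act_add_left)
    show "a \<odot>\<^bsub>poly_module h\<^esub> (v \<oplus>\<^bsub>poly_module h\<^esub> w) = a \<odot>\<^bsub>poly_module h\<^esub> v \<oplus>\<^bsub>poly_module h\<^esub> a \<odot>\<^bsub>poly_module h\<^esub> w"
      unfolding u poly_module_smult by (simp add: free_act_add_right)
    show "(a \<otimes>\<^bsub>Ah h\<^esub> b) \<odot>\<^bsub>poly_module h\<^esub> v = a \<odot>\<^bsub>poly_module h\<^esub> (b \<odot>\<^bsub>poly_module h\<^esub> v)"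
      unfolding u u' Ah_class_mult[symmetric] poly_module_smult by (simp add: free_act_mult)
  next
    show "\<one>\<^bsub>Ah h\<^esub> \<odot>\<^bsub>poly_module h\<^esub> v = v" for v
      unfolding Ah_class_1[symmetric] poly_module_smult by simp
  qed simp
qed

text \<open>For the generator 1 the evaluation map is the identity, so stable subsets of the model
  are themselves submodules and can be factored out.\<close>

lemma poly_module_cyclic: "cyclic_map h (poly_module h) 1 p = p"
proof -
  interpret Ah_left_module h "poly_module h" by (rule poly_module_left_module)
  show ?thesis
  proof (induction p)
    case (pCons a p)
    show ?case
      unfolding cyclic_pCons[of 1, simplified] pCons(2)
      by (simp add: Ah_poly_class Ah_y_class poly_module_smult free_act_poly)
        (simp add: one_pCons)
  qed simp
qed

lemma quotient_cyclic:
  assumes M: "Ah_left_module h M" and N: "Module.submodule N (Ah h) M" and v: "v \<in> carrier M"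
  shows "Ah_left_module h (quotient_module M N)"
    and "N +>\<^bsub>M\<^esub> v \<in> carrier (quotient_module M N)"
    and "cyclic_map h (quotient_module M N) (N +>\<^bsub>M\<^esub> v) p = N +>\<^bsub>M\<^esub> cyclic_map h M v p"
    and "cyclic_map h (quotient_module M N) (N +>\<^bsub>M\<^esub> v) p = \<zero>\<^bsub>quotient_module M N\<^esub> \<longleftrightarrow> cyclic_map h M v p \<in> N"
    and "carrier M = range (cyclic_map h M v) \<Longrightarrow>
      carrier (quotient_module M N) = range (cyclic_map h (quotient_module M N) (N +>\<^bsub>M\<^esub> v))"
proof -
  interpret M: Ah_left_module h M by fact
  show Q: "Ah_left_module h (quotient_module M N)"
    using M.left_module_quotient[OF N] by (rule Ah_left_module.intro)
  note T = M.coset_module_hom[OF N]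
  show "N +>\<^bsub>M\<^esub> v \<in> carrier (quotient_module M N)"
    using module_homD(1)[OF T v] .
  show c: "cyclic_map h (quotient_module M N) (N +>\<^bsub>M\<^esub> v) p = N +>\<^bsub>M\<^esub> cyclic_map h M v p" for p
    using cyclic_map_hom[OF M Q T v] by simp
  show "cyclic_map h (quotient_module M N) (N +>\<^bsub>M\<^esub> v) p = \<zero>\<^bsub>quotient_module M N\<^esub> \<longleftrightarrow> cyclic_map h M v p \<in> N"
    unfolding c quotient_module_simps using M.coset_eq_zero_iff[OF N M.cyclic_closed[OF v]] .
  show "carrier (quotient_module M N) = range (cyclic_map h (quotient_module M N) (N +>\<^bsub>M\<^esub> v))"
    if surj: "carrier M = range (cyclic_map h M v)"
    unfolding c quotient_module_simps A_RCOSETS_def' surj by auto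
qed


section \<open>Ideals of \<open>F[x]\<close> and weight spaces\<close>

lemma PIdl_Fx: "PIdl\<^bsub>Fx\<^esub> f = {q. f dvd q}"
  by (auto simp: cgenideal_def dvd_def mult.commute)

lemma cring_Fx: "cring (Fx :: 'a::field poly ring)"
  by (rule cring_from_type_algebra)

lemma principal_domain_Fx: "principal_domain (Fx :: 'a::field poly ring)"
proof -
  interpret cring "Fx :: 'a poly ring" by (rule cring_Fx)
  have "domain (Fx :: 'a poly ring)"
    by (intro domain.intro cring_Fx domain_axioms.intro) simp_all
  then interpret domain "Fx :: 'a poly ring" .
  have "euclidean_domain (Fx :: 'a poly ring) degree"
  proof (rule euclidean_domainI)
    fix a b :: "'a poly"
    assume "b \<in> carrier Fx - {\<zero>\<^bsub>Fx\<^esub>}"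
    then have "b \<noteq> 0" by simp
    then show "\<exists>q r. q \<in> carrier Fx \<and> r \<in> carrier Fx \<and> a = b \<otimes>\<^bsub>Fx\<^esub> q \<oplus>\<^bsub>Fx\<^esub> r \<and>
        (r = \<zero>\<^bsub>Fx\<^esub> \<or> degree r < degree b)"
      using degree_mod_less[of b a] by (intro exI[of _ "a div b"] exI[of _ "a mod b"]) simp
  qed
  then interpret euclidean_domain "Fx :: 'a poly ring" degree .
  show ?thesis by unfold_locales
qed

lemma ideal_FxE:
  fixes n :: "'a::field poly set"
  assumes "ideal n Fx"
  obtains p where "n = {q. p dvd q}"
  using principal_domain.exists_gen[OF principal_domain_Fx assms] PIdl_Fx by blast

lemma ideal_PIdl_Fx: "ideal (PIdl\<^bsub>Fx\<^esub> f) (Fx :: 'a::field poly ring)"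
  using cring.cgenideal_ideal[OF cring_Fx] by simp

text \<open>The ideal generated by a and f is principal. Its generator d divides f; if d were not a
  unit, the cofactor would be one, so f would divide d and hence a.\<close>

lemma bezout_irreducible:
  fixes f a :: "'a::field poly"
  assumes "Factorial_Ring.irreducible f" "\<not> f dvd a"
  shows "\<exists>s t. s * a + t * f = 1"
proof -
  interpret cring "Fx :: 'a poly ring" by (rule cring_Fx)
  have "ideal (PIdl\<^bsub>Fx\<^esub> a <+>\<^bsub>Fx\<^esub> PIdl\<^bsub>Fx\<^esub> f) Fx"
    by (rule add_ideals) (rule ideal_PIdl_Fx)+
  then obtain d where d: "PIdl\<^bsub>Fx\<^esub> a <+>\<^bsub>Fx\<^esub> PIdl\<^bsub>Fx\<^esub> f = {q. d dvd q}" by (rule ideal_FxE)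
  have mem: "d dvd q \<longleftrightarrow> (\<exists>s t. q = s * a + t * f)" for q
  proof -
    have "d dvd q \<longleftrightarrow> q \<in> PIdl\<^bsub>Fx\<^esub> a <+>\<^bsub>Fx\<^esub> PIdl\<^bsub>Fx\<^esub> f" using d by simp
    then show ?thesis by (auto simp: set_add_def' cgenideal_def)
  qed
  have "d dvd a" unfolding mem by (rule exI[of _ 1], rule exI[of _ 0]) simp
  have "d dvd f" unfolding mem by (rule exI[of _ 0], rule exI[of _ 1]) simp
  then obtain e where e: "f = d * e" by blast
  have "d dvd 1"
  proof (rule ccontr)
    assume "\<not> d dvd 1"
    with e assms(1) have "e dvd 1" using Factorial_Ring.irreducibleD by blast
    then have "f dvd d" using e by (metis dvd_mult_unit_iff dvd_refl)
    then show False using \<open>d dvd a\<close> assms(2) dvd_trans by blast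
  qed
  then show ?thesis unfolding mem by metis
qed

lemma maximalideal_irreducible:
  fixes f :: "'a::field poly"
  assumes f: "Factorial_Ring.irreducible f"
  shows "maximalideal (PIdl\<^bsub>Fx\<^esub> f) Fx"
proof (rule maximalidealI)
  show "ideal (PIdl\<^bsub>Fx\<^esub> f) Fx" by (rule ideal_PIdl_Fx)
  have "1 \<notin> PIdl\<^bsub>Fx\<^esub> f" using f by (auto simp: PIdl_Fx irreducible_not_unit)
  then show "carrier Fx \<noteq> PIdl\<^bsub>Fx\<^esub> f" by auto
  fix J assume J: "ideal J Fx" "PIdl\<^bsub>Fx\<^esub> f \<subseteq> J"
  obtain d where d: "J = {q. d dvd q}" using J(1) by (rule ideal_FxE)
  show "J = PIdl\<^bsub>Fx\<^esub> f \<or> J = carrier Fx"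
  proof (cases "f dvd d")
    case True
    from dvd_trans[OF this] have "J \<subseteq> PIdl\<^bsub>Fx\<^esub> f" unfolding d PIdl_Fx by (intro Collect_mono impI)
    then show ?thesis using J(2) by simp
  next
    case False
    then obtain s t where "s * d + t * f = 1" using bezout_irreducible[OF f] by blast
    moreover have "d dvd f" using subsetD[OF J(2)[unfolded d PIdl_Fx], of f] by simp
    ultimately have "d dvd 1" using dvd_add[of d "s * d" "t * f"] by simp
    then have "J = UNIV" unfolding d using dvd_trans[of d 1] by auto
    then show ?thesis by simp
  qed
qed

lemma ideal_prod_PIdl:
  "ideal_prod Fx (PIdl\<^bsub>Fx\<^esub> a) (PIdl\<^bsub>Fx\<^esub> b) = PIdl\<^bsub>Fx\<^esub> (a * b :: 'a::field poly)"
proof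
  show "ideal_prod Fx (PIdl\<^bsub>Fx\<^esub> a) (PIdl\<^bsub>Fx\<^esub> b) \<subseteq> PIdl\<^bsub>Fx\<^esub> (a * b)"
  proof
    show "q \<in> PIdl\<^bsub>Fx\<^esub> (a * b)" if "q \<in> ideal_prod Fx (PIdl\<^bsub>Fx\<^esub> a) (PIdl\<^bsub>Fx\<^esub> b)" for q
      using that by (induction rule: ideal_prod.induct) (simp_all add: PIdl_Fx mult_dvd_mono)
  qed
  show "PIdl\<^bsub>Fx\<^esub> (a * b) \<subseteq> ideal_prod Fx (PIdl\<^bsub>Fx\<^esub> a) (PIdl\<^bsub>Fx\<^esub> b)"
  proof
    fix q assume "q \<in> PIdl\<^bsub>Fx\<^esub> (a * b)"
    then obtain c where "q = a * (b * c)" by (auto simp: PIdl_Fx dvd_def mult.assoc)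
    then show "q \<in> ideal_prod Fx (PIdl\<^bsub>Fx\<^esub> a) (PIdl\<^bsub>Fx\<^esub> b)"
      using ideal_prod.prod[of a "PIdl\<^bsub>Fx\<^esub> a" "b * c" "PIdl\<^bsub>Fx\<^esub> b" Fx] by (simp add: PIdl_Fx)
  qed
qed

text \<open>This replaces annihilation by a power of the ideal by annihilation by the single element
  f^k. The zeroth power is the whole ring, generated by f^0 = 1.\<close>

lemma ideals_power_PIdl:
  "PIdl\<^bsub>Fx\<^esub> f [^]\<^bsub>ideals_set Fx\<^esub> k = PIdl\<^bsub>Fx\<^esub> (f ^ k :: 'a::field poly)"
proof (induction k)
  case 0
  show ?case by (simp add: nat_pow_def ideals_set_def PIdl_Fx)
next
  case (Suc k)
  have "PIdl\<^bsub>Fx\<^esub> f [^]\<^bsub>ideals_set Fx\<^esub> Suc k = ideal_prod Fx (PIdl\<^bsub>Fx\<^esub> f [^]\<^bsub>ideals_set Fx\<^esub> k) (PIdl\<^bsub>Fx\<^esub> f)"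
    by (simp add: nat_pow_def ideals_set_def)
  then show ?case
    unfolding Suc ideal_prod_PIdl power_Suc2 .
qed

text \<open>Multiplying a relation for b^l by one for b gives a relation for b^(l+1). Doing this for
  one argument, and again with the roles exchanged, raises both to powers.\<close>

lemma comaximal_power:
  fixes a b :: "'a::comm_ring_1"
  assumes "s * a + t * b = 1"
  shows "\<exists>s t. s * a ^ k + t * b ^ l = 1"
proof -
  have step: "\<exists>s t. s * a + t * b ^ l = 1" if ab: "\<exists>s t. s * a + t * b = 1" for a b :: 'a and l
  proof (induction l)
    case 0
    show ?case by (rule exI[of _ 0], rule exI[of _ 1]) simp
  next
    case (Suc l)
    then obtain s t where 1: "s * a + t * b ^ l = 1" by blast
    obtain s' t' where 2: "s' * a + t' * b = 1" using ab by blast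
    have "(s * a + t * b ^ l) * (s' * a + t' * b) = 1" using 1 2 by simp
    then have "(s * (s' * a + t' * b) + t * b ^ l * s') * a + (t * t') * b ^ Suc l = 1"
      by (simp add: algebra_simps)
    then show ?case by blast
  qed
  obtain s' t' where "s' * a + t' * b ^ l = 1" using step[of a b l] assms by blast
  then have "t' * b ^ l + s' * a = 1" by (simp add: add.commute)
  then obtain s'' t'' where "s'' * b ^ l + t'' * a ^ k = 1" using step[of "b ^ l" a k] by blast
  then show ?thesis by (metis add.commute)
qed

lemma is_direct_sum_single:
  assumes "abelian_group M" and "i0 \<in> I"
    and sub: "\<And>i. i \<in> I \<Longrightarrow> subgroup (N i) (add_monoid M)"
    and all: "N i0 = carrier M" and triv: "\<And>i. \<lbrakk>i \<in> I; i \<noteq> i0\<rbrakk> \<Longrightarrow> N i = {\<zero>\<^bsub>M\<^esub>}"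
  shows "is_direct_sum M I N"
  unfolding is_direct_sum_def
proof (intro conjI ballI)
  interpret abelian_group M by fact
  show "subgroup (N i) (add_monoid M)" if "i \<in> I" for i using sub[OF that] .
  fix v assume v: "v \<in> carrier M"
  let ?P = "\<lambda>u. u \<in> (\<Pi>\<^sub>E i\<in>I. N i) \<and> finite {i\<in>I. u i \<noteq> \<zero>\<^bsub>M\<^esub>} \<and>
    v = (\<Oplus>\<^bsub>M\<^esub> i\<in>{i\<in>I. u i \<noteq> \<zero>\<^bsub>M\<^esub>}. u i)"
  have sum: "(\<Oplus>\<^bsub>M\<^esub> i\<in>{i\<in>I. u i \<noteq> \<zero>\<^bsub>M\<^esub>}. u i) = u i0"
    if "\<And>i. \<lbrakk>i \<in> I; i \<noteq> i0\<rbrakk> \<Longrightarrow> u i = \<zero>\<^bsub>M\<^esub>" "u i0 \<in> carrier M" for u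
  proof (cases "u i0 = \<zero>\<^bsub>M\<^esub>")
    case True
    then have "{i\<in>I. u i \<noteq> \<zero>\<^bsub>M\<^esub>} = {}" using that(1) by blast
    then show ?thesis unfolding True by (simp only: finsum_empty)
  next
    case False
    then have "{i\<in>I. u i \<noteq> \<zero>\<^bsub>M\<^esub>} = {i0}" using that(1) assms(2) by blast
    then show ?thesis using finsum_singleton[of i0 "{i0}" u] that(2) by (simp only: finite.emptyI) simp
  qed
  show "\<exists>!u. ?P u"
  proof (rule ex1I)
    \<comment> \<open>The family must be restricted to I: direct sums are stated with extensional
      functions, and this is what makes the decomposition unique outside I.\<close>
    let ?u = "\<lambda>i\<in>I. if i = i0 then v else \<zero>\<^bsub>M\<^esub>"
    have "{i\<in>I. ?u i \<noteq> \<zero>\<^bsub>M\<^esub>} \<subseteq> {i0}" by auto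
    then have "finite {i\<in>I. ?u i \<noteq> \<zero>\<^bsub>M\<^esub>}" by (rule finite_subset) simp
    moreover have "?u \<in> (\<Pi>\<^sub>E i\<in>I. N i)" using v all triv by (auto simp: PiE_iff)
    moreover have "v = (\<Oplus>\<^bsub>M\<^esub> i\<in>{i\<in>I. ?u i \<noteq> \<zero>\<^bsub>M\<^esub>}. ?u i)"
    proof -
      have e: "?u i0 = v" using assms(2) by simp
      have "?u i0 \<in> carrier M" unfolding e by (rule v)
      then have "(\<Oplus>\<^bsub>M\<^esub> i\<in>{i\<in>I. ?u i \<noteq> \<zero>\<^bsub>M\<^esub>}. ?u i) = ?u i0"
        by (intro sum) simp_all
      then show ?thesis unfolding e by (rule sym)
    qed
    ultimately show "?P ?u" by blast
    fix u assume u: "?P u"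
    then have un: "u i \<in> N i" if "i \<in> I" for i using that by (auto simp: PiE_iff)
    have z: "u i = \<zero>\<^bsub>M\<^esub>" if "i \<in> I" "i \<noteq> i0" for i using un[OF that(1)] triv[OF that] by simp
    have "u i0 \<in> carrier M" using un[OF assms(2)] all by simp
    from sum[of u, OF z this] have "v = u i0" using u by simp
    show "u = ?u"
    proof
      fix i
      show "u i = ?u i"
      proof (cases "i \<in> I")
        case True
        then show ?thesis using z[of i] \<open>v = u i0\<close> by simp
      next
        case False
        have "u \<in> extensional I" using u by (simp add: PiE_def)
        then show ?thesis using False by (simp add: extensional_def)
      qed
    qed
  qed
qed

section \<open>Weight spaces at principal ideals\<close>

context Ah_left_module begin

lemma poly_smult_dvd:
  assumes "v \<in> carrier M" "Ah_poly h r \<odot>\<^bsub>M\<^esub> v = \<zero>\<^bsub>M\<^esub>" "r dvd s"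
  shows "Ah_poly h s \<odot>\<^bsub>M\<^esub> v = \<zero>\<^bsub>M\<^esub>"
proof -
  obtain t where "s = r * t" using assms(3) by (rule dvdE)
  then have s: "s = t * r" by (simp add: mult.commute)
  show ?thesis unfolding s poly_smult_mult[OF assms(1)] assms(2) by simp
qed

lemma poly_smult_PIdl:
  assumes "v \<in> carrier M"
  shows "(\<forall>r\<in>PIdl\<^bsub>Fx\<^esub> f. Ah_poly h r \<odot>\<^bsub>M\<^esub> v = \<zero>\<^bsub>M\<^esub>) \<longleftrightarrow> Ah_poly h f \<odot>\<^bsub>M\<^esub> v = \<zero>\<^bsub>M\<^esub>"
proof
  show "Ah_poly h f \<odot>\<^bsub>M\<^esub> v = \<zero>\<^bsub>M\<^esub>" if "\<forall>r\<in>PIdl\<^bsub>Fx\<^esub> f. Ah_poly h r \<odot>\<^bsub>M\<^esub> v = \<zero>\<^bsub>M\<^esub>"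
    using bspec[OF that, of f] by (simp add: PIdl_Fx)
  show "\<forall>r\<in>PIdl\<^bsub>Fx\<^esub> f. Ah_poly h r \<odot>\<^bsub>M\<^esub> v = \<zero>\<^bsub>M\<^esub>" if "Ah_poly h f \<odot>\<^bsub>M\<^esub> v = \<zero>\<^bsub>M\<^esub>"
    by (rule ballI, rule poly_smult_dvd[OF assms that]) (simp add: PIdl_Fx)
qed

lemma weight_space_PIdl:
  "weight_space h M (PIdl\<^bsub>Fx\<^esub> f) = {v \<in> carrier M. Ah_poly h f \<odot>\<^bsub>M\<^esub> v = \<zero>\<^bsub>M\<^esub>}"
  unfolding weight_space_def
  by (intro Collect_cong conj_cong refl) (simp only: poly_smult_PIdl)

lemma gen_weight_space_PIdl:
  "gen_weight_space h M (PIdl\<^bsub>Fx\<^esub> f) = {v \<in> carrier M. \<exists>k. Ah_poly h (f ^ k) \<odot>\<^bsub>M\<^esub> v = \<zero>\<^bsub>M\<^esub>}"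
  unfolding gen_weight_space_def ideals_power_PIdl
  by (intro Collect_cong conj_cong refl) (simp only: poly_smult_PIdl)

lemma weight_subset_gen: "weight_space h M (PIdl\<^bsub>Fx\<^esub> f) \<subseteq> gen_weight_space h M (PIdl\<^bsub>Fx\<^esub> f)"
  unfolding weight_space_PIdl gen_weight_space_PIdl
proof
  fix v assume "v \<in> {v \<in> carrier M. Ah_poly h f \<odot>\<^bsub>M\<^esub> v = \<zero>\<^bsub>M\<^esub>}"
  then have "v \<in> carrier M \<and> Ah_poly h (f ^ 1) \<odot>\<^bsub>M\<^esub> v = \<zero>\<^bsub>M\<^esub>" by simp
  then show "v \<in> {v \<in> carrier M. \<exists>k. Ah_poly h (f ^ k) \<odot>\<^bsub>M\<^esub> v = \<zero>\<^bsub>M\<^esub>}" by blast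
qed

lemma poly_smult_a_inv:
  assumes "v \<in> carrier M" "Ah_poly h r \<odot>\<^bsub>M\<^esub> v = \<zero>\<^bsub>M\<^esub>"
  shows "Ah_poly h r \<odot>\<^bsub>M\<^esub> (\<ominus>\<^bsub>M\<^esub> v) = \<zero>\<^bsub>M\<^esub>"
  unfolding smult_a_inv_right[OF Ah_poly_closed assms(1)] assms(2) by simp

lemma subgroup_weight_space: "subgroup (weight_space h M (PIdl\<^bsub>Fx\<^esub> f)) (add_monoid M)"
  unfolding weight_space_PIdl
proof (rule M.add.subgroupI)
  let ?W = "{v \<in> carrier M. Ah_poly h f \<odot>\<^bsub>M\<^esub> v = \<zero>\<^bsub>M\<^esub>}"
  show "?W \<subseteq> carrier M" by blast
  have "\<zero>\<^bsub>M\<^esub> \<in> ?W" by simp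
  then show "?W \<noteq> {}" by blast
  show "\<ominus>\<^bsub>M\<^esub> v \<in> ?W" if "v \<in> ?W" for v
    using poly_smult_a_inv[of v f] that by blast
  show "v \<oplus>\<^bsub>M\<^esub> w \<in> ?W" if "v \<in> ?W" "w \<in> ?W" for v w
    using that by (simp add: smult_r_distr)
qed

lemma subgroup_gen_weight_space: "subgroup (gen_weight_space h M (PIdl\<^bsub>Fx\<^esub> f)) (add_monoid M)"
  unfolding gen_weight_space_PIdl
proof (rule M.add.subgroupI)
  let ?G = "{v \<in> carrier M. \<exists>k. Ah_poly h (f ^ k) \<odot>\<^bsub>M\<^esub> v = \<zero>\<^bsub>M\<^esub>}"
  show "?G \<subseteq> carrier M" by blast
  have "\<zero>\<^bsub>M\<^esub> \<in> ?G" by simp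
  then show "?G \<noteq> {}" by blast
  show "\<ominus>\<^bsub>M\<^esub> v \<in> ?G" if "v \<in> ?G" for v
  proof -
    obtain k where "v \<in> carrier M" "Ah_poly h (f ^ k) \<odot>\<^bsub>M\<^esub> v = \<zero>\<^bsub>M\<^esub>" using \<open>v \<in> ?G\<close> by blast
    then show ?thesis using poly_smult_a_inv[of v "f ^ k"] M.a_inv_closed[of v] by blast
  qed
  show "v \<oplus>\<^bsub>M\<^esub> w \<in> ?G" if v: "v \<in> ?G" and w: "w \<in> ?G" for v w
  proof -
    obtain k where k: "v \<in> carrier M" "Ah_poly h (f ^ k) \<odot>\<^bsub>M\<^esub> v = \<zero>\<^bsub>M\<^esub>" using v by blast
    obtain l where l: "w \<in> carrier M" "Ah_poly h (f ^ l) \<odot>\<^bsub>M\<^esub> w = \<zero>\<^bsub>M\<^esub>" using w by blast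
    have "Ah_poly h (f ^ (k + l)) \<odot>\<^bsub>M\<^esub> v = \<zero>\<^bsub>M\<^esub>" "Ah_poly h (f ^ (k + l)) \<odot>\<^bsub>M\<^esub> w = \<zero>\<^bsub>M\<^esub>"
      using poly_smult_dvd[OF k, of "f ^ (k + l)"] poly_smult_dvd[OF l, of "f ^ (k + l)"]
      by (simp_all add: le_imp_power_dvd)
    then have "Ah_poly h (f ^ (k + l)) \<odot>\<^bsub>M\<^esub> (v \<oplus>\<^bsub>M\<^esub> w) = \<zero>\<^bsub>M\<^esub>"
      using k(1) l(1) by (simp add: smult_r_distr)
    then show ?thesis using k(1) l(1) by blast
  qed
qed

text \<open>Distinct maximal ideals have comaximal powers, so an element cannot be annihilated by powers
  of both.\<close>

lemma gen_weight_space_disjoint: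
  assumes f: "Factorial_Ring.irreducible f"
    and all: "carrier M = gen_weight_space h M (PIdl\<^bsub>Fx\<^esub> f)"
    and n: "maximalideal n Fx" "n \<noteq> PIdl\<^bsub>Fx\<^esub> f"
  shows "gen_weight_space h M n = {\<zero>\<^bsub>M\<^esub>}"
proof -
  obtain p where "n = {q. p dvd q}"
    using maximalideal.axioms(1)[OF n(1)] by (rule ideal_FxE)
  then have p: "n = PIdl\<^bsub>Fx\<^esub> p" by (simp only: PIdl_Fx)
  \<comment> \<open>If f divided p, then n would lie inside the ideal of f, and maximality of n
    would force that ideal to be n or the whole ring.\<close>
  have "\<not> f dvd p"
  proof
    assume "f dvd p"
    from dvd_trans[OF this] have "n \<subseteq> PIdl\<^bsub>Fx\<^esub> f" unfolding p PIdl_Fx by (intro Collect_mono impI)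
    moreover have "PIdl\<^bsub>Fx\<^esub> f \<subseteq> carrier Fx" by simp
    ultimately have "PIdl\<^bsub>Fx\<^esub> f = n \<or> PIdl\<^bsub>Fx\<^esub> f = carrier Fx"
      by (rule maximalideal.I_maximal[OF n(1) ideal_PIdl_Fx])
    then show False
      using n(2) maximalideal.I_notcarr[OF maximalideal_irreducible[OF f]] by simp
  qed
  then obtain s t where "s * p + t * f = 1" using bezout_irreducible[OF f] by blast
  have "v = \<zero>\<^bsub>M\<^esub>" if v: "v \<in> carrier M" "Ah_poly h (p ^ k) \<odot>\<^bsub>M\<^esub> v = \<zero>\<^bsub>M\<^esub>" for v k
  proof -
    obtain l where l: "Ah_poly h (f ^ l) \<odot>\<^bsub>M\<^esub> v = \<zero>\<^bsub>M\<^esub>"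
      using subsetD[OF equalityD1[OF all] v(1)] unfolding gen_weight_space_PIdl by blast
    obtain s t where st: "s * p ^ k + t * f ^ l = 1"
      using comaximal_power[OF \<open>s * p + t * f = 1\<close>] by blast
    have "v = Ah_poly h (s * p ^ k + t * f ^ l) \<odot>\<^bsub>M\<^esub> v"
      unfolding st poly_smult_1[OF v(1)] ..
    also have "\<dots> = \<zero>\<^bsub>M\<^esub>"
      unfolding poly_smult_add[OF v(1)] poly_smult_mult[OF v(1)] v(2) l by simp
    finally show ?thesis .
  qed
  then have "gen_weight_space h M n \<subseteq> {\<zero>\<^bsub>M\<^esub>}"
    unfolding p gen_weight_space_PIdl by blast
  moreover have "\<zero>\<^bsub>M\<^esub> \<in> gen_weight_space h M n"
    unfolding p gen_weight_space_PIdl by simp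
  ultimately show ?thesis by blast
qed

lemma gen_weight_moduleI:
  assumes f: "Factorial_Ring.irreducible f"
    and all: "carrier M = gen_weight_space h M (PIdl\<^bsub>Fx\<^esub> f)"
  shows "gen_weight_module h M"
  unfolding gen_weight_module_def
proof (intro conjI is_direct_sum_single[of M "PIdl\<^bsub>Fx\<^esub> f"])
  show "left_module (Ah h) M" by (rule left_module_axioms)
  show "abelian_group M" by (rule M.abelian_group_axioms)
  show "PIdl\<^bsub>Fx\<^esub> f \<in> {n. maximalideal n Fx}" using maximalideal_irreducible[OF f] by simp
  show "subgroup (gen_weight_space h M n) (add_monoid M)" if "n \<in> {n. maximalideal n Fx}" for n
  proof -
    have "ideal n Fx" using maximalideal.axioms(1) \<open>n \<in> {n. maximalideal n Fx}\<close> by simp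
    then obtain p where "n = {q. p dvd q}" by (rule ideal_FxE)
    then show ?thesis using subgroup_gen_weight_space[of p] by (simp only: PIdl_Fx)
  qed
  show "gen_weight_space h M (PIdl\<^bsub>Fx\<^esub> f) = carrier M" using all by (rule sym)
  show "gen_weight_space h M n = {\<zero>\<^bsub>M\<^esub>}" if "n \<in> {n. maximalideal n Fx}" "n \<noteq> PIdl\<^bsub>Fx\<^esub> f" for n
    using gen_weight_space_disjoint[OF f all] that by simp
qed

text \<open>A weight space lies in the generalized weight space of the same ideal, so the vanishing
  of the latter away from f carries over.\<close>

lemma weight_moduleI:
  assumes f: "Factorial_Ring.irreducible f"
    and all: "carrier M = weight_space h M (PIdl\<^bsub>Fx\<^esub> f)"
  shows "weight_module h M"
  unfolding weight_module_def
proof (intro conjI is_direct_sum_single[of M "PIdl\<^bsub>Fx\<^esub> f"])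
  have "gen_weight_space h M (PIdl\<^bsub>Fx\<^esub> f) \<subseteq> carrier M" unfolding gen_weight_space_def by blast
  then have gen: "carrier M = gen_weight_space h M (PIdl\<^bsub>Fx\<^esub> f)"
    using weight_subset_gen all by blast
  have ex: "\<exists>p. n = PIdl\<^bsub>Fx\<^esub> p" if "n \<in> {n. maximalideal n Fx}" for n
  proof -
    have "ideal n Fx" using maximalideal.axioms(1) that by simp
    then obtain p where "n = {q. p dvd q}" by (rule ideal_FxE)
    then show ?thesis unfolding PIdl_Fx by (rule exI)
  qed
  show "left_module (Ah h) M" by (rule left_module_axioms)
  show "abelian_group M" by (rule M.abelian_group_axioms)
  show "PIdl\<^bsub>Fx\<^esub> f \<in> {n. maximalideal n Fx}" using maximalideal_irreducible[OF f] by simp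
  show "subgroup (weight_space h M n) (add_monoid M)" if "n \<in> {n. maximalideal n Fx}" for n
    using ex[OF that] subgroup_weight_space by blast
  show "weight_space h M (PIdl\<^bsub>Fx\<^esub> f) = carrier M" using all by (rule sym)
  show "weight_space h M n = {\<zero>\<^bsub>M\<^esub>}" if n: "n \<in> {n. maximalideal n Fx}" "n \<noteq> PIdl\<^bsub>Fx\<^esub> f" for n
  proof -
    obtain p where p: "n = PIdl\<^bsub>Fx\<^esub> p" using ex[OF n(1)] by blast
    have "weight_space h M n \<subseteq> {\<zero>\<^bsub>M\<^esub>}"
      using gen_weight_space_disjoint[OF f gen] n weight_subset_gen[of p] unfolding p by simp
    moreover have "\<zero>\<^bsub>M\<^esub> \<in> weight_space h M n" unfolding p weight_space_PIdl by simp
    ultimately show ?thesis by blast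
  qed
qed

end


section \<open>The induced module \<open>U(m)\<close>\<close>

text \<open>M is identified with A_h modulo the left ideal J, written in the model. Modules over
  different carrier types are thereby all described by subsets of one type, and the isomorphism
  class depends on J alone.\<close>

definition presented :: "'a::field poly \<Rightarrow> ('a, 'm) Ah_module \<Rightarrow> 'm \<Rightarrow> 'a poly poly set \<Rightarrow> bool" where
  "presented h M v J \<longleftrightarrow> Ah_left_module h M \<and> v \<in> carrier M \<and>
     carrier M = range (cyclic_map h M v) \<and> {p. cyclic_map h M v p = \<zero>\<^bsub>M\<^esub>} = J"

lemma presentedD:
  assumes "presented h M v J"
  shows "Ah_left_module h M" "v \<in> carrier M" "carrier M = range (cyclic_map h M v)"
    "cyclic_map h M v p = \<zero>\<^bsub>M\<^esub> \<longleftrightarrow> p \<in> J"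
  using assms unfolding presented_def by blast+

lemma presented_isomorphic:
  assumes M: "presented h M v J" and N: "presented h N w J"
  shows "isomorphic_modules (Ah h) M N"
  by (rule isomorphic_cyclic[OF presentedD(1)[OF M] presentedD(1)[OF N] presentedD(2,3)[OF M] presentedD(2,3)[OF N]])
    (simp only: presentedD(4)[OF M] presentedD(4)[OF N])

lemma presented_irreducibleI:
  assumes M: "presented h M v J" and "1 \<notin> J"
    and J': "\<And>J'. \<lbrakk>left_closed h J'; J \<subset> J'\<rbrakk> \<Longrightarrow> 1 \<in> J'"
  shows "irreducible_module (Ah h) M"
proof -
  interpret Ah_left_module h M using M by (rule presentedD(1))
  have v: "v \<in> carrier M" using M by (rule presentedD(2))
  have ker: "{p. cyclic_map h M v p = \<zero>\<^bsub>M\<^esub>} = J" using M unfolding presented_def by blast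
  show ?thesis
  proof (rule irreducible_cyclicI[OF v _ presentedD(3)[OF M]])
    show "v \<noteq> \<zero>\<^bsub>M\<^esub>"
      using presentedD(4)[OF M, of 1] \<open>1 \<notin> J\<close> unfolding cyclic_1[OF v] by simp
  qed (use J' in \<open>simp only: ker\<close>)
qed

lemma presented_gen_weightI:
  assumes M: "presented h M v J" and J: "\<And>p. \<exists>k. lmul h (f ^ k) p \<in> J"
  shows "carrier M = gen_weight_space h M (PIdl\<^bsub>Fx\<^esub> f)"
proof -
  interpret Ah_left_module h M using M by (rule presentedD(1))
  have v: "v \<in> carrier M" using M by (rule presentedD(2))
  have "carrier M \<subseteq> {w \<in> carrier M. \<exists>k. Ah_poly h (f ^ k) \<odot>\<^bsub>M\<^esub> w = \<zero>\<^bsub>M\<^esub>}"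
  proof
    fix w assume w: "w \<in> carrier M"
    then obtain p where p: "w = cyclic_map h M v p" using presentedD(3)[OF M] by blast
    obtain k where "lmul h (f ^ k) p \<in> J" using J by blast
    then have "Ah_poly h (f ^ k) \<odot>\<^bsub>M\<^esub> w = \<zero>\<^bsub>M\<^esub>"
      unfolding p cyclic_lmul[OF v, symmetric] presentedD(4)[OF M] .
    then show "w \<in> {w \<in> carrier M. \<exists>k. Ah_poly h (f ^ k) \<odot>\<^bsub>M\<^esub> w = \<zero>\<^bsub>M\<^esub>}" using w by blast
  qed
  then show ?thesis unfolding gen_weight_space_PIdl by (intro equalityI) blast+
qed

lemma presented_weightI:
  assumes M: "presented h M v J" and J: "\<And>p. lmul h f p \<in> J"
  shows "carrier M = weight_space h M (PIdl\<^bsub>Fx\<^esub> f)"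
proof -
  interpret Ah_left_module h M using M by (rule presentedD(1))
  have v: "v \<in> carrier M" using M by (rule presentedD(2))
  have "carrier M \<subseteq> {w \<in> carrier M. Ah_poly h f \<odot>\<^bsub>M\<^esub> w = \<zero>\<^bsub>M\<^esub>}"
  proof
    fix w assume w: "w \<in> carrier M"
    then obtain p where p: "w = cyclic_map h M v p" using presentedD(3)[OF M] by blast
    have "Ah_poly h f \<odot>\<^bsub>M\<^esub> w = \<zero>\<^bsub>M\<^esub>"
      unfolding p cyclic_lmul[OF v, symmetric] presentedD(4)[OF M] by (rule J)
    then show "w \<in> {w \<in> carrier M. Ah_poly h f \<odot>\<^bsub>M\<^esub> w = \<zero>\<^bsub>M\<^esub>}" using w by blast
  qed
  then show ?thesis unfolding weight_space_PIdl by (intro equalityI) blast+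
qed

section \<open>Multiples of f in the model and the presentation of U(m)\<close>

lemma const_dvd_pCons_iff: "[:f:] dvd pCons a p \<longleftrightarrow> f dvd a \<and> [:f:] dvd p"
  for f :: "'a::field poly"
  unfolding const_poly_dvd_iff
proof (intro iffI conjI allI)
  show "f dvd a" if "\<forall>n. f dvd coeff (pCons a p) n" using that[rule_format, of 0] by simp
  show "f dvd coeff p n" if "\<forall>n. f dvd coeff (pCons a p) n" for n using that[rule_format, of "Suc n"] by simp
  show "f dvd coeff (pCons a p) n" if "f dvd a \<and> (\<forall>n. f dvd coeff p n)" for n
    using that by (cases n) simp_all
qed

lemma const_dvd_iff_smult: "[:f:] dvd p \<longleftrightarrow> (\<exists>q. p = smult f q)"
  by (simp add: dvd_def)

lemma lmul_const_dvd: "[:f:] dvd p \<Longrightarrow> [:f:] dvd lmul h r p"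
  by (auto simp: const_dvd_iff_smult lmul_smult)

lemma left_closed_const_multiples: "left_closed h {p. [:f:] dvd p}"
  by (simp add: left_closed_def lmul_const_dvd const_dvd_pCons_iff)

lemma submodule_PIdl_regular: "Module.submodule (PIdl\<^bsub>Fx\<^esub> f) Fx (regular_module (Fx :: 'a::field poly ring))"
proof -
  interpret left_module Fx "regular_module (Fx :: 'a poly ring)"
    by (rule left_module_regular[OF ring_ring_of_type_algebra])
  show ?thesis by (rule submoduleI') (simp_all add: PIdl_Fx)
qed

text \<open>The elements \<open>y\<^sup>i r \<otimes> 1\<close> with \<open>f\<close> dividing \<open>r\<close> vanish, and there are no further relations:
  the balanced map \<open>(a, s + m) \<mapsto> a s\<close> sends \<open>U(m)\<close> to the model modulo \<open>f\<close>.\<close>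

lemma U_presented:
  fixes h f :: "'a::field poly"
  defines "m \<equiv> PIdl\<^bsub>Fx\<^esub> f"
  shows "\<exists>u. presented h (U h m) u {p. [:f:] dvd p}"
proof -
  let ?R = "Fx :: 'a poly ring"
  let ?N = "quotient_module (regular_module ?R) m"
  interpret reg: left_module ?R "regular_module ?R"
    by (rule left_module_regular[OF ring_ring_of_type_algebra])
  have sub: "Module.submodule m ?R (regular_module ?R)"
    unfolding m_def by (rule submodule_PIdl_regular)
  interpret m: abelian_subgroup m "regular_module ?R"
    using sub by (rule reg.submodule_additive)
  interpret N: left_module ?R ?N using sub by (rule reg.left_module_quotient)
  interpret I: induction_data ?R "Ah h" ?N "Ah_poly h"
    by (intro induction_data.intro induction_data_axioms.intro N.left_module_axioms
        ring_ring_of_type_algebra ring_Ah Ah_poly_closed)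
  let ?c = "\<lambda>s. m +>\<^bsub>regular_module ?R\<^esub> s"
  have U_eq: "U h m = induced_module ?R (Ah h) (Ah_poly h) ?N" by (simp add: U_def)
  have U: "Ah_left_module h (U h m)"
    unfolding U_eq using I.left_module_induced by (rule Ah_left_module.intro)
  interpret U: Ah_left_module h "U h m" by (rule U)
  have c_carrier: "?c s \<in> carrier ?N" for s
    using reg.coset_module_hom[OF sub] by (rule module_homD(1)) simp
  have c_cases: "\<exists>s. C = ?c s" if "C \<in> carrier ?N" for C
    using that unfolding quotient_module_simps A_RCOSETS_def' by blast
  have c_smult: "r \<odot>\<^bsub>?N\<^esub> ?c s = ?c (r * s)" for r s
    using reg.smult_coset[OF sub, of r s] by simp
  have c_add: "?c s \<oplus>\<^bsub>?N\<^esub> ?c t = ?c (s + t)" for s t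
    using m.a_rcos_sum[of s t] by simp
  \<comment> \<open>The generator is the tensor of 1 with the coset of 1.\<close>
  define u where "u = I.tens \<one>\<^bsub>Ah h\<^esub> (?c 1)"
  have u: "u \<in> carrier (U h m)"
    unfolding u_def U_eq by (rule I.tens_closed[OF I.S.one_closed c_carrier])
  have tens_eq: "I.tens a (?c s) = a \<odot>\<^bsub>U h m\<^esub> (Ah_poly h s \<odot>\<^bsub>U h m\<^esub> u)" if a: "a \<in> carrier (Ah h)" for a s
  proof -
    have "I.tens a (?c s) = I.tens a (s \<odot>\<^bsub>?N\<^esub> ?c 1)" by (simp add: c_smult)
    also have "\<dots> = I.tens (a \<otimes>\<^bsub>Ah h\<^esub> Ah_poly h s) (?c 1)"
      by (rule I.tens_balanced[symmetric]) (simp_all add: a c_carrier del: quotient_module_simps)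
    also have "\<dots> = (a \<otimes>\<^bsub>Ah h\<^esub> Ah_poly h s) \<odot>\<^bsub>U h m\<^esub> u"
      unfolding u_def U_eq using a by (simp add: I.smult_tens)
    also have "\<dots> = a \<odot>\<^bsub>U h m\<^esub> (Ah_poly h s \<odot>\<^bsub>U h m\<^esub> u)"
      by (rule U.smult_assoc[OF a Ah_poly_closed u])
    finally show ?thesis .
  qed
  have surj: "\<exists>p. C = cyclic_map h (U h m) u p" if "C \<in> carrier (U h m)" for C
    using that[unfolded U_eq]
  proof (induction rule: I.induced_induct)
    case (tens a v)
    obtain s where s: "v = ?c s" using c_cases[OF tens(2)] by blast
    obtain w where w: "a = Ah_class h w" using tens(1) by (rule Ah_cases)
    have "I.tens a v = a \<odot>\<^bsub>U h m\<^esub> cyclic_map h (U h m) u [:s:]"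
      unfolding s U.cyclic_const[OF u] by (rule tens_eq[OF tens(1)])
    also have "\<dots> = cyclic_map h (U h m) u (free_act h w [:s:])"
      unfolding w by (rule U.cyclic_act[OF u])
    finally show ?case by (rule exI)
  next
    case (diff C D)
    then obtain p q where "C = cyclic_map h (U h m) u p" "D = cyclic_map h (U h m) u q" by blast
    then have "C \<ominus>\<^bsub>U h m\<^esub> D = cyclic_map h (U h m) u (p - q)"
      by (simp only: U.cyclic_diff[OF u])
    then show ?case unfolding U_eq by (rule exI)
  qed
  \<comment> \<open>The factor f is moved across the tensor sign, where its coset equals that of
    0.\<close>
  have fu: "Ah_poly h f \<odot>\<^bsub>U h m\<^esub> u = \<zero>\<^bsub>U h m\<^esub>"
  proof -
    have "?c f = ?c 0"
      using reg.coset_eq_zero_iff[OF sub, of f] reg.coset_eq_zero_iff[OF sub, of 0] by (simp add: m_def PIdl_Fx)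
    then have "\<one>\<^bsub>Ah h\<^esub> \<odot>\<^bsub>U h m\<^esub> (Ah_poly h f \<odot>\<^bsub>U h m\<^esub> u) = \<one>\<^bsub>Ah h\<^esub> \<odot>\<^bsub>U h m\<^esub> (Ah_poly h 0 \<odot>\<^bsub>U h m\<^esub> u)"
      unfolding tens_eq[OF I.S.one_closed, symmetric] by simp
    then show ?thesis
      using U.poly_smult_0[OF u] U.smult_one[OF U.poly_smult_closed[OF u]] by simp
  qed
  have ker: "cyclic_map h (U h m) u p = \<zero>\<^bsub>U h m\<^esub> \<longleftrightarrow> [:f:] dvd p" for p
  proof
    assume "[:f:] dvd p"
    then obtain q where q: "p = smult f q" unfolding const_dvd_iff_smult by blast
    show "cyclic_map h (U h m) u p = \<zero>\<^bsub>U h m\<^esub>"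
      unfolding q U.cyclic_smult[OF u] fu by (rule U.cyclic_of_zero)
  next
    assume zero: "cyclic_map h (U h m) u p = \<zero>\<^bsub>U h m\<^esub>"
    let ?P = "poly_module h" and ?J = "{p. [:f:] dvd p}"
    interpret P: Ah_left_module h ?P by (rule poly_module_left_module)
    have J: "Module.submodule ?J (Ah h) ?P"
      using P.cyclic_image_submodule[OF _ left_closed_const_multiples, of 1 f] by (simp add: poly_module_cyclic)
    let ?Q = "quotient_module ?P ?J" and ?q = "?J +>\<^bsub>?P\<^esub> 1"
    note Q = quotient_cyclic[OF poly_module_left_module J, of 1, unfolded poly_module_cyclic]
    interpret Q: Ah_left_module h ?Q by (rule Q(1)) simp
    have q: "?q \<in> carrier ?Q" by (rule Q(2)) simp
    have Qker: "cyclic_map h ?Q ?q p = \<zero>\<^bsub>?Q\<^esub> \<longleftrightarrow> [:f:] dvd p" for p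
      using Q(4)[of p] by simp
    \<comment> \<open>A coset is evaluated at an arbitrary representative; representatives differ by
      a multiple of f, which is zero in \<open>?Q\<close>.\<close>
    define \<phi> where "\<phi> C = cyclic_map h ?Q ?q [:SOME r. r \<in> C:]" for C
    have \<phi>: "\<phi> (?c s) = cyclic_map h ?Q ?q [:s:]" for s
    proof -
      have "s \<in> ?c s" by (rule m.a_rcos_self) simp
      then have "(SOME r. r \<in> ?c s) \<in> ?c s" by (rule someI)
      then obtain k where "k \<in> m" "(SOME r. r \<in> ?c s) = k + s"
        unfolding a_r_coset_def' by auto
      then have "[:f:] dvd [:SOME r. r \<in> ?c s:] - [:s:]" by (simp add: m_def PIdl_Fx)
      then show ?thesis unfolding \<phi>_def Q.cyclic_eq_iff[OF q] Qker .
    qed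
    obtain T where T: "T \<in> module_hom (Ah h) (U h m) ?Q"
      and T_tens: "\<And>a v. \<lbrakk>a \<in> carrier (Ah h); v \<in> carrier ?N\<rbrakk> \<Longrightarrow> T (I.tens a v) = a \<odot>\<^bsub>?Q\<^esub> \<phi> v"
      unfolding U_eq
    proof (rule I.induced_lift)
      show "left_module (Ah h) ?Q" by (rule Q.left_module_axioms)
      show "\<phi> v \<in> carrier ?Q" for v unfolding \<phi>_def using q by (rule Q.cyclic_closed)
      show "\<phi> (v \<oplus>\<^bsub>?N\<^esub> w) = \<phi> v \<oplus>\<^bsub>?Q\<^esub> \<phi> w" if vw: "v \<in> carrier ?N" "w \<in> carrier ?N" for v w
      proof -
        obtain s t where s: "v = ?c s" "w = ?c t" using c_cases[OF vw(1)] c_cases[OF vw(2)] by blast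
        show ?thesis
          unfolding s c_add \<phi> Q.cyclic_add[OF q, symmetric] by simp
      qed
      show "\<phi> (r \<odot>\<^bsub>?N\<^esub> v) = Ah_poly h r \<odot>\<^bsub>?Q\<^esub> \<phi> v" if v: "v \<in> carrier ?N" for r v
      proof -
        obtain s where s: "v = ?c s" using c_cases[OF v] by blast
        show ?thesis
          unfolding s c_smult \<phi> Q.cyclic_lmul[OF q, symmetric] by simp
      qed
    qed blast
    have "T u = \<one>\<^bsub>Ah h\<^esub> \<odot>\<^bsub>?Q\<^esub> \<phi> (?c 1)"
      unfolding u_def by (rule T_tens[OF I.S.one_closed c_carrier])
    also have "\<dots> = ?q"
      unfolding \<phi> one_pCons[symmetric] Q.cyclic_1[OF q] by (rule Q.smult_one[OF q])
    finally have Tu: "T u = ?q" .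
    have "cyclic_map h ?Q ?q p = T (cyclic_map h (U h m) u p)"
      unfolding cyclic_map_hom[OF U Q.Ah_left_module_axioms T u] Tu ..
    also have "\<dots> = \<zero>\<^bsub>?Q\<^esub>"
      unfolding zero by (rule module_hom_zero[OF U.left_module_axioms Q.left_module_axioms T])
    finally show "[:f:] dvd p" unfolding Qker .
  qed
  have "carrier (U h m) = range (cyclic_map h (U h m) u)"
  proof
    show "carrier (U h m) \<subseteq> range (cyclic_map h (U h m) u)" using surj by blast
    show "range (cyclic_map h (U h m) u) \<subseteq> carrier (U h m)" using U.cyclic_closed[OF u] by blast
  qed
  then have "presented h (U h m) u {p. [:f:] dvd p}"
    unfolding presented_def ker using U u by blast
  then show ?thesis by (rule exI)
qed

section \<open>Left multiplication by f and its powers\<close>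

lemma power_dvd_delta:
  assumes "f ^ Suc n dvd r"
  shows "f ^ n dvd delta h r"
proof -
  obtain s where r: "r = f ^ Suc n * s" using assms by (rule dvdE)
  \<comment> \<open>A derivation costs at most one factor f: the derivative of f^(n+1) is (n+1) f^n
    f'.\<close>
  have "delta h (f ^ Suc n) = f ^ n * (smult (of_nat (Suc n)) (pderiv f * h))"
    by (simp only: delta_def pderiv_power_Suc) (simp add: mult.assoc)
  then have "f ^ n dvd delta h (f ^ Suc n)" by (rule dvdI)
  then have "f ^ n dvd delta h (f ^ Suc n) * s" by (rule dvd_mult2)
  moreover have "f ^ n dvd f ^ Suc n * delta h s" by (rule dvd_mult2, rule le_imp_power_dvd) simp
  ultimately show ?thesis
    unfolding r delta_mult by (rule dvd_add)
qed

text \<open>The exponent n depends on p and grows by one with each power of y: for a + y p both r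
  and \<delta>(r) act on p, and \<delta> loses one factor f. The claim covers all multiples r of f^n
  so that it can be applied to \<delta>(r).\<close>

lemma lmul_power_dvd: "\<exists>n. \<forall>r. f ^ n dvd r \<longrightarrow> [:f:] dvd lmul h r p"
proof (induction p)
  case 0
  then show ?case by simp
next
  case (pCons a p)
  obtain n where "\<forall>r. f ^ n dvd r \<longrightarrow> [:f:] dvd lmul h r p" using pCons.IH by (rule exE)
  then have n: "\<And>r. f ^ n dvd r \<Longrightarrow> [:f:] dvd lmul h r p" by simp
  have "[:f:] dvd lmul h r (pCons a p)" if r: "f ^ Suc n dvd r" for r
  proof -
    have "f dvd r" using dvd_mult_left[of f "f ^ n" r] r by simp
    moreover have "f ^ n dvd r" using dvd_mult_right[of f "f ^ n" r] r by simp
    ultimately have "[:f:] dvd pCons (r * a) (lmul h r p)"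
      using n[of r] by (simp add: const_dvd_pCons_iff)
    then show ?thesis
      unfolding lmul_pCons using n[OF power_dvd_delta[OF r]] by (rule dvd_diff)
  qed
  then show ?case by (intro exI[of _ "Suc n"] allI impI)
qed

text \<open>The recursion for \<open>lmul\<close> only ever passes from r to \<delta>(r), and both
  stay divisible by f.\<close>

lemma lmul_invariant_dvd:
  assumes inv: "\<And>s. f dvd s \<Longrightarrow> f dvd delta h s" and "f dvd r"
  shows "[:f:] dvd lmul h r p"
  using assms(2)
proof (induction p arbitrary: r)
  case (pCons a p)
  have "[:f:] dvd pCons (r * a) (lmul h r p)"
    using pCons.IH[OF pCons.prems] dvd_mult2[OF pCons.prems] by (simp add: const_dvd_pCons_iff)
  then show ?case
    unfolding lmul_pCons using pCons.IH[OF inv[OF pCons.prems]] by (rule dvd_diff)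
qed simp

lemma coeff_lmul: "degree p \<le> n \<Longrightarrow> coeff (lmul h r p) n = r * coeff p n"
proof (induction p arbitrary: r n)
  case (pCons a p)
  show ?case
  proof (cases "p = 0")
    case False
    then obtain k where k: "n = Suc k" "degree p \<le> k" using pCons.prems by (cases n) auto
    have "coeff p (Suc k) = 0" using k(2) by (simp add: coeff_eq_0)
    then show ?thesis using pCons.IH[of k r] pCons.IH[of "Suc k" "delta h r"] k by (simp add: lmul_pCons)
  qed (simp add: coeff_pCons split: nat.split)
qed simp

text \<open>The formula comes from r y^(n+1) = y^(n+1) r - (n+1) y^n \<delta>(r) + lower powers of
  y. The bound on the degree need not be attained; it excludes contributions from still higher
  powers.\<close>

lemma coeff_lmul_subleading:
  "degree p \<le> Suc n \<Longrightarrow>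
    coeff (lmul h r p) n = r * coeff p n - of_nat (Suc n) * delta h r * coeff p (Suc n)"
proof (induction p arbitrary: r n)
  case (pCons a p)
  show ?case
  proof (cases "p = 0")
    case False
    then have p: "degree p \<le> n" using pCons.prems by simp
    show ?thesis
    proof (cases n)
      case 0
      then show ?thesis using coeff_lmul[of p 0 h "delta h r"] p by (simp add: lmul_pCons)
    next
      case (Suc k)
      then show ?thesis
        using pCons.IH[of k r] coeff_lmul[of p "Suc k" h "delta h r"] p
        by (simp add: lmul_pCons algebra_simps)
    qed
  qed (simp add: coeff_pCons split: nat.split)
qed simp

text \<open>In characteristic zero the coefficient of f' in degree deg f - 1 is nonzero, so f' is a
  nonzero polynomial of smaller degree than f.\<close>

lemma irreducible_not_dvd_pderiv:
  fixes f :: "'a::field poly"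
  assumes f: "Factorial_Ring.irreducible f" and "CHAR('a) = 0"
  shows "\<not> f dvd pderiv f"
proof
  have f0: "f \<noteq> 0" "\<not> f dvd 1" using f irreducible_not_unit[OF f] by auto
  have "degree f \<noteq> 0"
    using f0 by (auto simp: is_unit_iff_degree)
  moreover have "coeff (pderiv f) (degree f - 1) = of_nat (degree f) * lead_coeff f"
    using \<open>degree f \<noteq> 0\<close> by (simp add: coeff_pderiv)
  ultimately have "pderiv f \<noteq> 0"
    using f0(1) assms(2) of_nat_eq_0_iff_char_dvd[where 'a = 'a, of "degree f"] by auto
  moreover assume "f dvd pderiv f"
  ultimately have "degree f \<le> degree (pderiv f)" by (intro dvd_imp_degree_le)
  moreover have "degree (pderiv f) \<le> degree f - 1"
    by (rule degree_le) (simp add: coeff_pderiv coeff_eq_0)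
  ultimately show False using \<open>degree f \<noteq> 0\<close> by simp
qed

text \<open>Multiplication by \<open>f\<close> lowers the degree by exactly one modulo \<open>f\<close>, since \<open>\<delta>(f) = f' h\<close> is
  invertible modulo \<open>f\<close>; so an invariant subset descends to a nonzero constant.\<close>

lemma left_closed_one_mem:
  fixes h f :: "'a::field poly"
  assumes f: "Factorial_Ring.irreducible f" and char: "CHAR('a) = 0" and h: "\<not> f dvd h"
    and J: "left_closed h J" "\<And>p. [:f:] dvd p \<Longrightarrow> p \<in> J"
    and p: "p \<in> J" "\<not> [:f:] dvd p"
  shows "1 \<in> J"
proof -
  have prime: "f dvd a * b \<longleftrightarrow> f dvd a \<or> f dvd b" for a b
    using prime_elem_dvd_mult_iff[OF field_poly_irreducible_imp_prime[OF f]] .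
  \<comment> \<open>In characteristic zero n+1 is a nonzero constant, hence a unit, and f is
    not.\<close>
  have of_nat: "\<not> f dvd of_nat (Suc n)" for n
  proof -
    have "of_nat (Suc n) \<noteq> (0 :: 'a)"
      using char of_nat_eq_0_iff_char_dvd[where 'a = 'a, of "Suc n"] by simp
    then have "(of_nat (Suc n) :: 'a poly) dvd 1"
      by (simp only: of_nat_poly is_unit_const_poly_iff dvd_field_iff) simp
    then have "f dvd 1" if "f dvd of_nat (Suc n)" by (rule dvd_trans[OF that])
    then show ?thesis using irreducible_not_unit[OF f] by blast
  qed
  \<comment> \<open>The induction is on a bound for the degree rather than on the degree: p is
    replaced by other elements of J, still nonzero modulo f, for which only a bound is
    known.\<close>
  have step: "1 \<in> J" if "degree p \<le> n" "p \<in> J" "\<not> [:f:] dvd p" for p n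
    using that
  proof (induction n arbitrary: p)
    case 0
    then obtain c where c: "p = [:c:]" by (auto elim: degree_eq_zeroE)
    then have "\<not> f dvd c" using 0(3) by (simp add: const_dvd_pCons_iff)
    \<comment> \<open>A constant outside the ideal of f is invertible modulo f, and J contains every
      multiple of f.\<close>
    then obtain s t where st: "s * c + t * f = 1" using bezout_irreducible[OF f] by blast
    have "[:s * c:] \<in> J" using left_closedD(3)[OF J(1) 0(2), of s] c by simp
    moreover have "[:t * f:] \<in> J" by (rule J(2)) (simp add: const_dvd_pCons_iff)
    ultimately have "[:s * c:] + [:t * f:] \<in> J" by (rule left_closedD(2)[OF J(1)])
    then show ?case using st by (simp add: one_pCons)
  next
    case (Suc n)
    show ?case
    proof (cases "f dvd coeff p (Suc n)")
      \<comment> \<open>The top monomial is a multiple of f and so lies in J; dropping it lowers the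
        bound without changing p modulo f.\<close>
      case True
      let ?m = "monom (coeff p (Suc n)) (Suc n)"
      have m: "[:f:] dvd ?m" using True by (simp add: const_poly_dvd_iff)
      have "degree (p - ?m) \<le> n"
      proof (rule degree_le, intro allI impI)
        fix i assume i: "n < i"
        show "coeff (p - ?m) i = 0"
          using i Suc.prems(1) by (cases "i = Suc n") (simp_all add: coeff_eq_0)
      qed
      moreover have "p - ?m \<in> J" using Suc.prems(2) J(2)[OF m] by (rule left_closedD(6)[OF J(1)])
      moreover have "\<not> [:f:] dvd p - ?m"
        using Suc.prems(3) dvd_diff_left_iff[OF m, of p] by simp
      ultimately show ?thesis by (rule Suc.IH)
    next
      \<comment> \<open>In f p the coefficient of y^(n+1) is divisible by f and is subtracted.
        Modulo f the coefficient of y^n becomes -(n+1) f' h times the former top coefficient, and f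
        divides none of these factors.\<close>
      case False
      let ?m = "monom (f * coeff p (Suc n)) (Suc n)"
      let ?q = "lmul h f p - ?m"
      have m: "[:f:] dvd ?m" by (simp add: const_poly_dvd_iff)
      have "degree ?q \<le> n"
      proof (rule degree_le, intro allI impI)
        fix i assume i: "n < i"
        then have "degree p \<le> i" using Suc.prems(1) by simp
        then show "coeff ?q i = 0"
          using i Suc.prems(1) by (cases "i = Suc n") (simp_all add: coeff_lmul coeff_eq_0)
      qed
      moreover have "?q \<in> J"
        using left_closedD(3)[OF J(1) Suc.prems(2)] J(2)[OF m] by (rule left_closedD(6)[OF J(1)])
      moreover have "\<not> [:f:] dvd ?q"
      proof
        assume "[:f:] dvd ?q"
        then have "f dvd coeff ?q n" by (simp only: const_poly_dvd_iff)
        then have "f dvd f * coeff p n - of_nat (Suc n) * delta h f * coeff p (Suc n)"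
          using coeff_lmul_subleading[OF Suc.prems(1), of h f] by simp
        then have "f dvd of_nat (Suc n) * delta h f * coeff p (Suc n)"
          using dvd_diff[of f "f * coeff p n" "f * coeff p n - of_nat (Suc n) * delta h f * coeff p (Suc n)"] by simp
        then have "f dvd of_nat (Suc n) \<or> f dvd pderiv f \<or> f dvd h \<or> f dvd coeff p (Suc n)"
          by (simp only: delta_def prime disj_assoc)
        then show False
          using of_nat h False irreducible_not_dvd_pderiv[OF f char] by blast
      qed
      ultimately show ?thesis by (rule Suc.IH)
    qed
  qed
  show ?thesis by (rule step[OF order_refl p])
qed

lemma U_gen_weight:
  "carrier (U h (PIdl\<^bsub>Fx\<^esub> f)) = gen_weight_space h (U h (PIdl\<^bsub>Fx\<^esub> f)) (PIdl\<^bsub>Fx\<^esub> f)"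
proof -
  obtain u where u: "presented h (U h (PIdl\<^bsub>Fx\<^esub> f)) u {p. [:f:] dvd p}"
    using U_presented by (rule exE)
  show ?thesis
  proof (rule presented_gen_weightI[OF u])
    fix p
    obtain k where "\<forall>r. f ^ k dvd r \<longrightarrow> [:f:] dvd lmul h r p" using lmul_power_dvd by (rule exE)
    then show "\<exists>k. lmul h (f ^ k) p \<in> {p. [:f:] dvd p}" by (intro exI[of _ k]) simp
  qed
qed

lemma U_weight:
  assumes inv: "delta_invariant h (PIdl\<^bsub>Fx\<^esub> f)"
  shows "carrier (U h (PIdl\<^bsub>Fx\<^esub> f)) = weight_space h (U h (PIdl\<^bsub>Fx\<^esub> f)) (PIdl\<^bsub>Fx\<^esub> f)"
proof -
  obtain u where u: "presented h (U h (PIdl\<^bsub>Fx\<^esub> f)) u {p. [:f:] dvd p}"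
    using U_presented by (rule exE)
  have inv': "f dvd delta h s" if "f dvd s" for s
  proof -
    have "delta h s \<in> delta h ` {q. f dvd q}" using that by (intro imageI CollectI)
    from subsetD[OF inv[unfolded delta_invariant_def PIdl_Fx] this] show ?thesis by simp
  qed
  show ?thesis
    by (rule presented_weightI[OF u]) (rule CollectI, rule lmul_invariant_dvd[OF inv' dvd_refl])
qed

lemma U_irreducible:
  fixes h f :: "'a::field poly"
  assumes f: "Factorial_Ring.irreducible f" and char: "CHAR('a) = 0" and h: "\<not> f dvd h"
  shows "irreducible_module (Ah h) (U h (PIdl\<^bsub>Fx\<^esub> f))"
proof -
  obtain u where u: "presented h (U h (PIdl\<^bsub>Fx\<^esub> f)) u {p. [:f:] dvd p}"
    using U_presented by (rule exE)
  show ?thesis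
  proof (rule presented_irreducibleI[OF u])
    have "\<not> [:f:] dvd [:1:]"
      unfolding const_poly_dvd_const_poly_iff by (rule irreducible_not_unit[OF f])
    then show "1 \<notin> {p. [:f:] dvd p}" by (simp only: one_pCons mem_Collect_eq not_False_eq_True)
    fix J assume J: "left_closed h J" "{p. [:f:] dvd p} \<subset> J"
    then obtain p where "p \<in> J" "\<not> [:f:] dvd p" by blast
    moreover have "p \<in> J" if "[:f:] dvd p" for p using J(2) that by blast
    ultimately show "1 \<in> J" using left_closed_one_mem[OF f char h J(1)] by blast
  qed
qed


section \<open>Reduction of the model modulo an irreducible factor of \<open>h\<close>\<close>

lemma mem_PIdl_iff: "a \<in> PIdl\<^bsub>R\<^esub> b \<longleftrightarrow> (\<exists>x\<in>carrier R. a = x \<otimes>\<^bsub>R\<^esub> b)"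
  by (auto simp: cgenideal_def)

text \<open>All correction terms in \<open>lmul_pCons\<close> contain a value of \<delta>, which is
  a multiple of h and hence of f.\<close>

lemma lmul_cong_smult:
  fixes f :: "'a::field poly"
  assumes "f dvd h" shows "[:f:] dvd lmul h r p - smult r p"
proof (induction p arbitrary: r)
  case (pCons a p)
  have "f dvd delta h s" for s using assms by (simp add: delta_def)
  then have "[:f:] dvd lmul h (delta h r) p" by (intro lmul_invariant_dvd)
  moreover have "[:f:] dvd pCons 0 (lmul h r p - smult r p)"
    using pCons.IH[of r] by (simp add: const_dvd_pCons_iff)
  ultimately have "[:f:] dvd pCons 0 (lmul h r p - smult r p) - lmul h (delta h r) p"
    by (intro dvd_diff)
  also have "pCons 0 (lmul h r p - smult r p) - lmul h (delta h r) p =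
      lmul h r (pCons a p) - smult r (pCons a p)"
    by (rule poly_eqI) (simp add: lmul_pCons coeff_pCons split: nat.split)
  finally show ?case .
qed simp

lemma left_closed_smult:
  assumes "f dvd h" "left_closed h J" "{p. [:f:] dvd p} \<subseteq> J" "p \<in> J"
  shows "smult r p \<in> J"
proof -
  have "lmul h r p - smult r p \<in> J" using assms(3) lmul_cong_smult[OF assms(1), of r p] by blast
  with left_closedD(3)[OF assms(2,4)] have "lmul h r p - (lmul h r p - smult r p) \<in> J"
    by (rule left_closedD(6)[OF assms(2)])
  then show ?thesis by simp
qed

text \<open>A stable subset containing the multiples of f is an ideal of the commutative ring
  F[x][y]: multiplication by y is the shift, and multiplication by coefficients agrees modulo f with
  \<open>lmul\<close>.\<close>

lemma left_closed_mult:
  assumes "f dvd h" "left_closed h J" "{p. [:f:] dvd p} \<subseteq> J" "p \<in> J"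
  shows "q * p \<in> J"
proof (induction q)
  case 0
  then show ?case using left_closedD(1)[OF assms(2)] by simp
next
  case (pCons a q)
  have "smult a p + pCons 0 (q * p) \<in> J"
    by (intro left_closedD(2)[OF assms(2)] left_closedD(4)[OF assms(2)] pCons.IH left_closed_smult[OF assms])
  then show ?case by simp
qed

text \<open>This is the ideal of F[x][y] generated by f and G, that is, the preimage under reduction
  modulo f of the principal ideal generated by the reduction of G.\<close>

definition cong_multiples :: "'a::field poly \<Rightarrow> 'a poly poly \<Rightarrow> 'a poly poly set" where
  "cong_multiples f G = {p. \<exists>q. [:f:] dvd p - G * q}"

lemma cong_multiplesI: "[:f:] dvd p - G * q \<Longrightarrow> p \<in> cong_multiples f G"
  unfolding cong_multiples_def by blast

lemma const_dvd_cong_multiples: "[:f:] dvd p \<Longrightarrow> p \<in> cong_multiples f G"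
  by (rule cong_multiplesI[of _ _ _ 0]) simp

lemma const_multiples_subset: "{p. [:f:] dvd p} \<subseteq> cong_multiples f G"
  using const_dvd_cong_multiples by blast

lemma cong_multiples_cong:
  assumes "[:f:] dvd G - G'" shows "cong_multiples f G = cong_multiples f G'"
proof -
  have "cong_multiples f G \<subseteq> cong_multiples f G'" if "[:f:] dvd G - G'" for G G'
  proof
    fix p assume "p \<in> cong_multiples f G"
    then obtain q where "[:f:] dvd p - G * q" unfolding cong_multiples_def by blast
    then have "[:f:] dvd (p - G * q) + (G - G') * q" using dvd_mult2[OF that] by (rule dvd_add)
    then show "p \<in> cong_multiples f G'" by (intro cong_multiplesI[of _ _ _ q]) (simp add: algebra_simps)
  qed
  note sub = this
  have "[:f:] dvd G' - G" using assms dvd_minus_iff[of "[:f:]" "G - G'"] by simp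
  from sub[OF assms] sub[OF this] show ?thesis by (rule subset_antisym)
qed

lemma left_closed_cong_multiples:
  assumes "f dvd h" shows "left_closed h (cong_multiples f G)"
  unfolding left_closed_def
proof (intro conjI ballI allI)
  show "0 \<in> cong_multiples f G" by (rule const_dvd_cong_multiples) simp
  show "p + p' \<in> cong_multiples f G" if p: "p \<in> cong_multiples f G" and p': "p' \<in> cong_multiples f G" for p p'
  proof -
    obtain q where q: "[:f:] dvd p - G * q" using p unfolding cong_multiples_def by blast
    obtain q' where q': "[:f:] dvd p' - G * q'" using p' unfolding cong_multiples_def by blast
    have "p + p' - G * (q + q') = (p - G * q) + (p' - G * q')" by (simp add: algebra_simps)
    with dvd_add[OF q q'] have "[:f:] dvd p + p' - G * (q + q')" by (simp only:)
    then show ?thesis by (rule cong_multiplesI)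
  qed
  show "lmul h r p \<in> cong_multiples f G" if p: "p \<in> cong_multiples f G" for r p
  proof -
    obtain q where q: "[:f:] dvd p - G * q" using p unfolding cong_multiples_def by blast
    have "[:f:] dvd smult r (p - G * q)" using q by (rule dvd_smult)
    with lmul_cong_smult[OF assms] have "[:f:] dvd (lmul h r p - smult r p) + smult r (p - G * q)"
      by (rule dvd_add)
    then show ?thesis by (intro cong_multiplesI[of _ _ _ "smult r q"]) (simp add: smult_diff_right)
  qed
  show "pCons 0 p \<in> cong_multiples f G" if p: "p \<in> cong_multiples f G" for p
  proof -
    obtain q where q: "[:f:] dvd p - G * q" using p unfolding cong_multiples_def by blast
    have "pCons 0 p - G * pCons 0 q = pCons 0 (p - G * q)" by simp
    with q show ?thesis by (intro cong_multiplesI[of _ _ _ "pCons 0 q"]) (simp only: const_dvd_pCons_iff dvd_0_right simp_thms)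
  qed
qed

section \<open>Reduction of coefficients modulo f as a surjection onto Q\<close>

locale irreducible_polynomial =
  fixes f :: "'a::field poly"
  assumes irreducible: "Factorial_Ring.irreducible f"
begin

abbreviation "\<mm> \<equiv> PIdl\<^bsub>Fx\<^esub> f"
abbreviation "K \<equiv> Fx Quot \<mm>"
abbreviation "cls r \<equiv> \<mm> +>\<^bsub>Fx\<^esub> r"

lemma field_K: "field K"
  by (rule maximalideal.quotient_is_field[OF maximalideal_irreducible[OF irreducible] cring_Fx])

lemma cls_hom:
  shows cls_add: "cls (r + s) = cls r \<oplus>\<^bsub>K\<^esub> cls s" and cls_mult: "cls (r * s) = cls r \<otimes>\<^bsub>K\<^esub> cls s"
    and cls_1: "cls 1 = \<one>\<^bsub>K\<^esub>" and cls_closed: "cls r \<in> carrier K"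
proof -
  note hom = ideal.rcos_ring_hom[OF ideal_PIdl_Fx[of f]]
  show "cls (r + s) = cls r \<oplus>\<^bsub>K\<^esub> cls s" using ring_hom_add[OF hom, of r s] by simp
  show "cls (r * s) = cls r \<otimes>\<^bsub>K\<^esub> cls s" using ring_hom_mult[OF hom, of r s] by simp
  show "cls 1 = \<one>\<^bsub>K\<^esub>" using ring_hom_one[OF hom] by simp
  show "cls r \<in> carrier K" using ring_hom_closed[OF hom, of r] by simp
qed

lemma mem_cls_iff: "r \<in> cls s \<longleftrightarrow> f dvd r - s"
proof
  show "f dvd r - s" if "r \<in> cls s" using that by (auto simp: a_r_coset_def' PIdl_Fx)
  show "r \<in> cls s" if "f dvd r - s"
  proof -
    have "(r - s) + s \<in> cls s" unfolding a_r_coset_def' using that by (auto simp: PIdl_Fx intro!: bexI[of _ "r - s"])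
    then show ?thesis by simp
  qed
qed

lemma cls_eq_iff: "cls r = cls s \<longleftrightarrow> f dvd r - s"
proof
  show "f dvd r - s" if "cls r = cls s"
    using mem_cls_iff[of r r] unfolding that mem_cls_iff by simp
  show "cls r = cls s" if "f dvd r - s"
  proof (rule Set.set_eqI)
    fix t
    have "t - s = (t - r) + (r - s)" by simp
    then show "t \<in> cls r \<longleftrightarrow> t \<in> cls s"
      unfolding mem_cls_iff using dvd_add_left_iff[OF that, of "t - r"] by simp
  qed
qed

lemma cls_0: "cls 0 = \<zero>\<^bsub>K\<^esub>"
proof -
  have "\<zero>\<^bsub>K\<^esub> = \<mm>" by (simp add: FactRing_def)
  moreover have "cls 0 = \<mm>" by (rule Set.set_eqI, simp only: mem_cls_iff) (simp add: PIdl_Fx)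
  ultimately show ?thesis by simp
qed

lemma cls_cases: "C \<in> carrier K \<Longrightarrow> \<exists>r. C = cls r"
  unfolding FactRing_def A_RCOSETS_def' by auto

lemma mem_coset_cls: "C \<in> carrier K \<Longrightarrow> r \<in> C \<Longrightarrow> C = cls r"
proof -
  assume C: "C \<in> carrier K" "r \<in> C"
  obtain s where s: "C = cls s" using cls_cases[OF C(1)] by blast
  have "f dvd s - r" using C(2) dvd_minus_iff[of f "r - s"] unfolding s mem_cls_iff by simp
  then show "C = cls r" unfolding s cls_eq_iff .
qed

lemma cls_sum:
  fixes n :: nat
  shows "cls (\<Sum>i\<le>n. g i) = (\<Oplus>\<^bsub>K\<^esub> i\<in>{..n}. cls (g i))"
proof -
  interpret K: field K by (rule field_K)
  show ?thesis
  proof (induction n)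
    case 0
    have "(\<Oplus>\<^bsub>K\<^esub> i\<in>{..0::nat}. cls (g i)) = cls (g 0)"
      using K.finsum_singleton[of "0::nat" "{0}" "\<lambda>i. cls (g i)"] by (simp add: cls_closed)
    then show ?case by simp
  next
    case (Suc n)
    have "(\<Oplus>\<^bsub>K\<^esub> i\<in>{..Suc n}. cls (g i)) = cls (g (Suc n)) \<oplus>\<^bsub>K\<^esub> (\<Oplus>\<^bsub>K\<^esub> i\<in>{..n}. cls (g i))"
      by (rule K.finsum_Suc) (simp add: cls_closed)
    then show ?case by (simp add: cls_add Suc add.commute)
  qed
qed

text \<open>Coefficient lists of the target start with the leading coefficient and may not begin
  with zero. Hence the reversal, and the normalisation, since leading coefficients can vanish modulo
  f.\<close>

definition reduce :: "'a poly poly \<Rightarrow> 'a poly set list" where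
  "reduce p = ring.normalize K (map cls (rev (coeffs p)))"

lemma reduce_closed: "reduce p \<in> carrier (Q \<mm>)"
proof -
  interpret K: field K by (rule field_K)
  show ?thesis
    unfolding Q_def reduce_def univ_poly_carrier[symmetric]
    by (rule K.normalize_gives_polynomial) (auto simp: cls_closed)
qed

lemma coeff_reduce: "ring.coeff K (reduce p) i = cls (coeff p i)"
proof -
  interpret K: field K by (rule field_K)
  let ?l = "map cls (rev (coeffs p))"
  have "K.coeff (reduce p) i = K.coeff ?l i"
    unfolding reduce_def K.normalize_coeff[symmetric] ..
  also have "\<dots> = cls (coeff p i)"
  proof (cases "i < length (coeffs p)")
    case True
    then have "K.coeff ?l i = ?l ! (length (coeffs p) - 1 - i)"
      using K.coeff_nth[of i ?l] by simp
    also have "\<dots> = cls (coeffs p ! i)"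
      using True by (simp add: rev_nth)
    also have "coeffs p ! i = coeff p i"
      using nth_default_nth[of i "coeffs p" 0] True by (simp add: nth_default_coeffs_eq)
    finally show ?thesis .
  next
    case False
    then have "coeff p i = 0" by (simp add: nth_default_coeffs_eq[symmetric] nth_default_def)
    then show ?thesis using False K.coeff_length[of ?l i] by (simp add: cls_0)
  qed
  finally show ?thesis .
qed

text \<open>Normalised lists are determined by their coefficient functions, so the homomorphism laws
  for \<open>reduce\<close> can be checked coefficient by coefficient.\<close>

lemma Q_eq_iff:
  assumes "p \<in> carrier (Q \<mm>)" "q \<in> carrier (Q \<mm>)"
  shows "p = q \<longleftrightarrow> (\<forall>i. ring.coeff K p i = ring.coeff K q i)"
proof -
  interpret K: field K by (rule field_K)
  show ?thesis
    using K.coeff_iff_polynomial_cond[of "carrier K" p q] assms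
    unfolding Q_def univ_poly_carrier[symmetric] by (simp add: fun_eq_iff)
qed

lemma Q_set: "p \<in> carrier (Q \<mm>) \<Longrightarrow> set p \<subseteq> carrier K"
  unfolding Q_def univ_poly_carrier[symmetric] polynomial_def by auto

lemma reduce_eq_iff: "reduce p = reduce q \<longleftrightarrow> [:f:] dvd p - q"
  unfolding Q_eq_iff[OF reduce_closed reduce_closed] coeff_reduce cls_eq_iff const_poly_dvd_iff by simp

lemma principal_domain_Q: "principal_domain (Q \<mm>)"
proof -
  interpret K: field K by (rule field_K)
  show ?thesis unfolding Q_def by (rule K.univ_poly_is_principal[OF K.carrier_is_subfield])
qed

lemma reduce_add: "reduce (p + q) = reduce p \<oplus>\<^bsub>Q \<mm>\<^esub> reduce q"
proof -
  interpret K: field K by (rule field_K)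
  interpret Q: principal_domain "Q \<mm>" by (rule principal_domain_Q)
  have "reduce p \<oplus>\<^bsub>Q \<mm>\<^esub> reduce q \<in> carrier (Q \<mm>)" by (intro Q.a_closed reduce_closed)
  from Q_eq_iff[OF reduce_closed this] show ?thesis
    using K.poly_add_coeff[OF Q_set[OF reduce_closed[of p]] Q_set[OF reduce_closed[of q]]]
    by (simp add: coeff_reduce cls_add Q_def univ_poly_add)
qed

lemma reduce_mult: "reduce (p * q) = reduce p \<otimes>\<^bsub>Q \<mm>\<^esub> reduce q"
proof -
  interpret K: field K by (rule field_K)
  interpret Q: principal_domain "Q \<mm>" by (rule principal_domain_Q)
  have "reduce p \<otimes>\<^bsub>Q \<mm>\<^esub> reduce q \<in> carrier (Q \<mm>)" by (intro Q.m_closed reduce_closed)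
  from Q_eq_iff[OF reduce_closed this] show ?thesis
    using K.poly_mult_coeff[OF Q_set[OF reduce_closed[of p]] Q_set[OF reduce_closed[of q]]]
    by (simp add: coeff_reduce coeff_mult cls_sum cls_mult Q_def univ_poly_mult)
qed

lemma reduce_1: "reduce 1 = \<one>\<^bsub>Q \<mm>\<^esub>"
proof -
  interpret K: field K by (rule field_K)
  interpret Q: principal_domain "Q \<mm>" by (rule principal_domain_Q)
  show ?thesis
    unfolding Q_eq_iff[OF reduce_closed Q.one_closed] coeff_reduce
    by (simp add: Q_def univ_poly_one cls_1 cls_0)
qed

lemma reduce_0: "reduce 0 = \<zero>\<^bsub>Q \<mm>\<^esub>"
proof -
  interpret K: field K by (rule field_K)
  show ?thesis by (simp add: reduce_def Q_def univ_poly_zero)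
qed

text \<open>The bound n may exceed the degree of q. The coefficients of q there are the zero coset,
  so the corresponding g i are multiples of f and vanish under reduction.\<close>

lemma lift_poly:
  assumes q: "q \<in> carrier (Q \<mm>)" and n: "Polynomials.degree q \<le> n"
    and g: "\<And>i. i \<le> n \<Longrightarrow> g i \<in> ring.coeff K q i"
  shows "reduce (\<Sum>i\<le>n. monom (g i) i) = q"
  unfolding Q_eq_iff[OF reduce_closed q] coeff_reduce
proof
  interpret K: field K by (rule field_K)
  fix i
  have "K.coeff q i = cls (g i)" if "i \<le> n"
    by (rule mem_coset_cls[OF K.coeff_in_carrier[OF Q_set[OF q]] g[OF that]])
  moreover have "K.coeff q i = cls 0" if "\<not> i \<le> n"
    using K.coeff_degree[of q i] that n by (simp add: cls_0)
  moreover have "coeff (\<Sum>i\<le>n. monom (g i) i) i = (if i \<le> n then g i else 0)"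
    by (simp add: coeff_sum)
  ultimately show "cls (coeff (\<Sum>i\<le>n. monom (g i) i) i) = K.coeff q i" by simp
qed

lemma reduce_surj:
  assumes q: "q \<in> carrier (Q \<mm>)" shows "\<exists>p. q = reduce p"
proof -
  interpret K: field K by (rule field_K)
  have "\<exists>r. r \<in> K.coeff q i" for i
  proof -
    obtain s where s: "K.coeff q i = cls s" using cls_cases[OF K.coeff_in_carrier[OF Q_set[OF q]]] by blast
    have "s \<in> K.coeff q i" unfolding s mem_cls_iff by simp
    then show ?thesis by (rule exI)
  qed
  then have "(SOME r. r \<in> K.coeff q i) \<in> K.coeff q i" for i by (rule someI_ex)
  then have "reduce (\<Sum>i\<le>Polynomials.degree q. monom (SOME r. r \<in> K.coeff q i) i) = q"
    by (intro lift_poly[OF q order_refl])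
  then show ?thesis by (intro exI) (rule sym)
qed

section \<open>Stable subsets containing the multiples of f and ideals of Q\<close>

lemma ideal_reduce_image:
  assumes "f dvd h" and J: "left_closed h J" "{p. [:f:] dvd p} \<subseteq> J"
  shows "ideal (reduce ` J) (Q \<mm>)"
proof -
  interpret Q: principal_domain "Q \<mm>" by (rule principal_domain_Q)
  note mult = left_closed_mult[OF assms]
  show ?thesis
  proof (rule idealI[OF Q.ring_axioms])
    show "subgroup (reduce ` J) (add_monoid (Q \<mm>))"
    proof (rule Q.add.subgroupI)
      show "reduce ` J \<subseteq> carrier (Q \<mm>)" using reduce_closed by blast
      show "reduce ` J \<noteq> {}" using left_closedD(1)[OF J(1)] by blast
      show "\<ominus>\<^bsub>Q \<mm>\<^esub> a \<in> reduce ` J" if a: "a \<in> reduce ` J" for a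
      proof -
        obtain p where p: "a = reduce p" "p \<in> J" using a by blast
        have "reduce (- p) \<oplus>\<^bsub>Q \<mm>\<^esub> reduce p = \<zero>\<^bsub>Q \<mm>\<^esub>"
          unfolding reduce_add[symmetric] by (simp add: reduce_0)
        then have "\<ominus>\<^bsub>Q \<mm>\<^esub> a = reduce (- p)"
          unfolding p(1) by (intro Q.minus_equality reduce_closed)
        moreover have "- p \<in> J" using mult[OF p(2), of "- 1"] by simp
        ultimately show ?thesis by simp
      qed
      show "a \<oplus>\<^bsub>Q \<mm>\<^esub> b \<in> reduce ` J" if a: "a \<in> reduce ` J" and b: "b \<in> reduce ` J" for a b
      proof -
        obtain p q where "a = reduce p" "p \<in> J" "b = reduce q" "q \<in> J" using a b by blast
        then show ?thesis using left_closedD(2)[OF J(1), of p q] by (simp flip: reduce_add)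
      qed
    qed
    show *: "x \<otimes>\<^bsub>Q \<mm>\<^esub> a \<in> reduce ` J" if a: "a \<in> reduce ` J" and x: "x \<in> carrier (Q \<mm>)" for a x
    proof -
      obtain p where p: "a = reduce p" "p \<in> J" using a by blast
      obtain q where q: "x = reduce q" using reduce_surj[OF x] by blast
      show ?thesis unfolding p(1) q reduce_mult[symmetric] using mult[OF p(2)] by blast
    qed
    show "a \<otimes>\<^bsub>Q \<mm>\<^esub> x \<in> reduce ` J" if "a \<in> reduce ` J" "x \<in> carrier (Q \<mm>)" for a x
    proof -
      have "a \<in> carrier (Q \<mm>)" using that(1) reduce_closed by blast
      then show ?thesis using *[OF that] Q.m_comm that(2) by simp
    qed
  qed
qed

text \<open>J contains the kernel of reduction, so it is the full preimage of its image.\<close>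

lemma reduce_mem_image_iff:
  assumes J: "left_closed h J" "{p. [:f:] dvd p} \<subseteq> J"
  shows "reduce p \<in> reduce ` J \<longleftrightarrow> p \<in> J"
proof
  assume "reduce p \<in> reduce ` J"
  then obtain q where q: "reduce p = reduce q" "q \<in> J" by blast
  have "p - q \<in> J" using J(2) q(1) unfolding reduce_eq_iff by blast
  then have "(p - q) + q \<in> J" using q(2) by (rule left_closedD(2)[OF J(1)])
  then show "p \<in> J" by simp
qed simp

lemma PIdl_reduce: "PIdl\<^bsub>Q \<mm>\<^esub> (reduce G) = reduce ` cong_multiples f G"
proof
  interpret Q: principal_domain "Q \<mm>" by (rule principal_domain_Q)
  show "PIdl\<^bsub>Q \<mm>\<^esub> (reduce G) \<subseteq> reduce ` cong_multiples f G"
  proof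
    fix a assume "a \<in> PIdl\<^bsub>Q \<mm>\<^esub> (reduce G)"
    then obtain x where x: "a = x \<otimes>\<^bsub>Q \<mm>\<^esub> reduce G" "x \<in> carrier (Q \<mm>)" unfolding mem_PIdl_iff by (rule bexE)
    obtain q where q: "x = reduce q" using reduce_surj[OF x(2)] by blast
    have "a = reduce (G * q)" unfolding x(1) q reduce_mult[symmetric] mult.commute[of q G] ..
    moreover have "G * q \<in> cong_multiples f G" by (rule cong_multiplesI[of _ _ _ q]) simp
    ultimately show "a \<in> reduce ` cong_multiples f G" by blast
  qed
  show "reduce ` cong_multiples f G \<subseteq> PIdl\<^bsub>Q \<mm>\<^esub> (reduce G)"
  proof
    fix a assume "a \<in> reduce ` cong_multiples f G"
    then obtain p where a: "a = reduce p" and p: "p \<in> cong_multiples f G" by blast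
    obtain q where q: "[:f:] dvd p - G * q" using p unfolding cong_multiples_def by blast
    have "a = reduce q \<otimes>\<^bsub>Q \<mm>\<^esub> reduce G"
      using q unfolding a reduce_mult[symmetric] reduce_eq_iff mult.commute[of q G] .
    then show "a \<in> PIdl\<^bsub>Q \<mm>\<^esub> (reduce G)" unfolding mem_PIdl_iff using reduce_closed by (rule bexI)
  qed
qed

text \<open>In the principal ideal domain Q an irreducible element generates a maximal ideal, and
  stable subsets above the multiples of f inject into the ideals of Q by taking images.\<close>

lemma cong_multiples_maximal:
  assumes h: "f dvd h" and G: "ring_irreducible\<^bsub>Q \<mm>\<^esub> (reduce G)"
    and J: "left_closed h J" "cong_multiples f G \<subset> J"
  shows "1 \<in> J"
proof -
  interpret Q: principal_domain "Q \<mm>" by (rule principal_domain_Q)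
  have fJ: "{p. [:f:] dvd p} \<subseteq> J" using const_multiples_subset[of f G] J(2) by blast
  have max: "maximalideal (PIdl\<^bsub>Q \<mm>\<^esub> (reduce G)) (Q \<mm>)"
    by (rule Q.irreducible_imp_maximalideal[OF reduce_closed G])
  have id: "ideal (reduce ` J) (Q \<mm>)" by (rule ideal_reduce_image[OF h J(1) fJ])
  have "PIdl\<^bsub>Q \<mm>\<^esub> (reduce G) \<subseteq> reduce ` J" unfolding PIdl_reduce using J(2) by blast
  moreover have "reduce ` J \<subseteq> carrier (Q \<mm>)" using reduce_closed by blast
  ultimately have "reduce ` J = PIdl\<^bsub>Q \<mm>\<^esub> (reduce G) \<or> reduce ` J = carrier (Q \<mm>)"
    by (rule maximalideal.I_maximal[OF max id])
  moreover have "reduce ` J \<noteq> PIdl\<^bsub>Q \<mm>\<^esub> (reduce G)"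
  proof
    assume eq: "reduce ` J = PIdl\<^bsub>Q \<mm>\<^esub> (reduce G)"
    obtain p where p: "p \<in> J" "p \<notin> cong_multiples f G" using J(2) by blast
    have "reduce p \<in> reduce ` cong_multiples f G" unfolding PIdl_reduce[symmetric] eq[symmetric] using p(1) by (rule imageI)
    then have "p \<in> cong_multiples f G"
      using reduce_mem_image_iff[OF left_closed_cong_multiples[OF h] const_multiples_subset] by blast
    then show False using p(2) by blast
  qed
  ultimately have "reduce 1 \<in> reduce ` J" using reduce_closed by simp
  then show ?thesis using reduce_mem_image_iff[OF J(1) fJ] by blast
qed

text \<open>Otherwise the reduction of G would divide 1 in Q and be a unit.\<close>

lemma one_notin_cong_multiples:
  assumes G: "ring_irreducible\<^bsub>Q \<mm>\<^esub> (reduce G)"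
  shows "1 \<notin> cong_multiples f G"
proof
  interpret Q: principal_domain "Q \<mm>" by (rule principal_domain_Q)
  assume "1 \<in> cong_multiples f G"
  then have "\<one>\<^bsub>Q \<mm>\<^esub> \<in> PIdl\<^bsub>Q \<mm>\<^esub> (reduce G)" unfolding PIdl_reduce reduce_1[symmetric] by (rule imageI)
  then obtain x where x: "\<one>\<^bsub>Q \<mm>\<^esub> = x \<otimes>\<^bsub>Q \<mm>\<^esub> reduce G" "x \<in> carrier (Q \<mm>)" unfolding mem_PIdl_iff by (rule bexE)
  have "reduce G \<otimes>\<^bsub>Q \<mm>\<^esub> x = \<one>\<^bsub>Q \<mm>\<^esub>" unfolding x(1) by (rule Q.m_comm[OF reduce_closed x(2)])
  then have "reduce G \<in> Units (Q \<mm>)"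
    unfolding Units_def using x(1)[symmetric] x(2) reduce_closed by blast
  then show False using Q.ring_irreducibleE(4)[OF reduce_closed G] by blast
qed

text \<open>The generator is nonzero modulo \<open>f\<close>: the multiples of \<open>f\<close> lie in the proper invariant subset
  where \<open>f\<close> divides the constant coefficient, so they are not maximal.\<close>

lemma maximal_left_closed:
  assumes h: "f dvd h" and J: "left_closed h J" "{p. [:f:] dvd p} \<subseteq> J" "1 \<notin> J"
    and max: "\<And>J'. \<lbrakk>left_closed h J'; J \<subset> J'\<rbrakk> \<Longrightarrow> 1 \<in> J'"
  shows "\<exists>G. monic_prime \<mm> (reduce G) \<and> J = cong_multiples f G"
proof -
  interpret K: field K by (rule field_K)
  interpret Q: principal_domain "Q \<mm>" by (rule principal_domain_Q)
  have id: "ideal (reduce ` J) (Q \<mm>)" by (rule ideal_reduce_image[OF h J(1,2)])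
  have mem: "reduce p \<in> reduce ` J \<longleftrightarrow> p \<in> J" for p by (rule reduce_mem_image_iff[OF J(1,2)])
  have "reduce ` J \<noteq> {[]}"
  proof
    assume zero: "reduce ` J = {[]}"
    let ?J = "{p. f dvd coeff p 0}"
    have "left_closed h ?J"
      unfolding left_closed_def
    proof (intro conjI ballI allI)
      show "lmul h r p \<in> ?J" if "p \<in> ?J" for r p
      proof -
        have "f dvd coeff (lmul h r p - smult r p) 0"
          using lmul_cong_smult[OF h, of r p] unfolding const_poly_dvd_iff by blast
        moreover have "f dvd coeff (smult r p) 0" using that by simp
        ultimately have "f dvd coeff (lmul h r p - smult r p) 0 + coeff (smult r p) 0" by (rule dvd_add)
        then show ?thesis by simp
      qed
    qed simp_all
    moreover have "J \<subset> ?J"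
    proof
      show "J \<subseteq> ?J"
      proof
        fix p assume "p \<in> J"
        then have "reduce p = reduce 0" using zero unfolding reduce_0 Q_def univ_poly_zero by blast
        then have "[:f:] dvd p" unfolding reduce_eq_iff by simp
        then show "p \<in> ?J" unfolding const_poly_dvd_iff by simp
      qed
      \<comment> \<open>The polynomial y witnesses strictness: its constant coefficient is 0, but y
        is not divisible by f.\<close>
      have "[:0, 1:] \<notin> J"
      proof
        assume "[:0, 1:] \<in> J"
        then have "reduce [:0, 1:] = reduce 0" using zero unfolding reduce_0 Q_def univ_poly_zero by blast
        then have "f dvd 1" unfolding reduce_eq_iff by (simp add: const_dvd_pCons_iff)
        then show False using irreducible_not_unit[OF irreducible] by blast
      qed
      then show "J \<noteq> ?J" by auto
    qed
    ultimately have "1 \<in> ?J" by (rule max)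
    then show False using irreducible_not_unit[OF irreducible] by simp
  qed
  \<comment> \<open>Being nonzero, the image of J has a generator normalised to be monic.\<close>
  then obtain g where g: "g \<in> carrier (Q \<mm>)" "Polynomials.lead_coeff g = \<one>\<^bsub>K\<^esub>" "reduce ` J = PIdl\<^bsub>Q \<mm>\<^esub> g"
    using K.exists_unique_gen[OF K.carrier_is_subfield id[unfolded Q_def]] unfolding Q_def by blast
  obtain G where G: "g = reduce G" using reduce_surj[OF g(1)] by blast
  have J_eq: "J = cong_multiples f G"
  proof (rule Set.set_eqI)
    fix p
    show "p \<in> J \<longleftrightarrow> p \<in> cong_multiples f G"
      using mem[of p] reduce_mem_image_iff[OF left_closed_cong_multiples[OF h] const_multiples_subset, of p G]
      unfolding g(3) G PIdl_reduce by blast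
  qed
  \<comment> \<open>An ideal I above the image of J pulls back to a stable subset containing J; the
    hypothesis on J says that this subset is J or contains 1.\<close>
  have "maximalideal (PIdl\<^bsub>Q \<mm>\<^esub> g) (Q \<mm>)"
  proof (rule maximalidealI)
    show "ideal (PIdl\<^bsub>Q \<mm>\<^esub> g) (Q \<mm>)" using id unfolding g(3) .
    show "carrier (Q \<mm>) \<noteq> PIdl\<^bsub>Q \<mm>\<^esub> g"
      using mem[of 1] J(3) reduce_closed[of 1] unfolding g(3)[symmetric] by blast
    fix I assume I: "ideal I (Q \<mm>)" "PIdl\<^bsub>Q \<mm>\<^esub> g \<subseteq> I" "I \<subseteq> carrier (Q \<mm>)"
    let ?J = "{p. reduce p \<in> I}"
    have fJ: "p \<in> ?J" if "[:f:] dvd p" for p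
    proof -
      have "p \<in> J" using J(2) that by blast
      then have "reduce p \<in> reduce ` J" by (rule imageI)
      then show ?thesis using I(2) unfolding g(3) by blast
    qed
    have add: "p + q \<in> ?J" if "p \<in> ?J" "q \<in> ?J" for p q
      using that additive_subgroup.a_closed[OF ideal.axioms(1)[OF I(1)]] by (simp add: reduce_add)
    have mult: "q * p \<in> ?J" if "p \<in> ?J" for p q
      using that ideal.I_l_closed[OF I(1) _ reduce_closed] by (simp add: reduce_mult)
    have "left_closed h ?J"
      unfolding left_closed_def
    proof (intro conjI ballI allI)
      show "0 \<in> ?J" by (rule fJ) simp
      show "p + q \<in> ?J" if "p \<in> ?J" "q \<in> ?J" for p q using that by (rule add)
      show "lmul h r p \<in> ?J" if "p \<in> ?J" for r p
      proof -
        have "(lmul h r p - smult r p) + [:r:] * p \<in> ?J"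
          by (intro add mult fJ lmul_cong_smult[OF h] that)
        then show ?thesis by simp
      qed
      show "pCons 0 p \<in> ?J" if "p \<in> ?J" for p
        using mult[OF that, of "[:0, 1:]"] by simp
    qed
    moreover have "J \<subseteq> ?J" using I(2) unfolding g(3)[symmetric] by blast
    ultimately have "J = ?J \<or> 1 \<in> ?J" using max[of ?J] by blast
    then show "I = PIdl\<^bsub>Q \<mm>\<^esub> g \<or> I = carrier (Q \<mm>)"
    proof
      assume "J = ?J"
      then have "I \<subseteq> reduce ` J" using I(3) reduce_surj by blast
      then show ?thesis using I(2) unfolding g(3) by blast
    next
      assume "1 \<in> ?J"
      then have "\<one>\<^bsub>Q \<mm>\<^esub> \<in> I" unfolding reduce_1[symmetric] by blast
      then show ?thesis using ideal.one_imp_carrier[OF I(1)] by blast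
    qed
  qed
  \<comment> \<open>Irreducibility of g is reached through primality: a maximal ideal is prime, and
    a nonzero generator of a prime ideal is a prime element, hence irreducible.\<close>
  then have "primeideal (PIdl\<^bsub>Q \<mm>\<^esub> g) (Q \<mm>)" by (rule Q.maximalideal_prime)
  moreover have "g \<noteq> \<zero>\<^bsub>Q \<mm>\<^esub>"
  proof
    assume zero: "g = \<zero>\<^bsub>Q \<mm>\<^esub>"
    have "a = \<zero>\<^bsub>Q \<mm>\<^esub>" if a: "a \<in> reduce ` J" for a
    proof -
      obtain x where "a = x \<otimes>\<^bsub>Q \<mm>\<^esub> \<zero>\<^bsub>Q \<mm>\<^esub>" "x \<in> carrier (Q \<mm>)"
        using a unfolding g(3) zero mem_PIdl_iff by (rule bexE)
      then show ?thesis using Q.r_null by simp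
    qed
    moreover have "\<zero>\<^bsub>Q \<mm>\<^esub> \<in> reduce ` J"
      unfolding reduce_0[symmetric] using left_closedD(1)[OF J(1)] by (rule imageI)
    ultimately have "reduce ` J = {\<zero>\<^bsub>Q \<mm>\<^esub>}" by blast
    then show False using \<open>reduce ` J \<noteq> {[]}\<close> unfolding Q_def univ_poly_zero by blast
  qed
  ultimately have "ring_irreducible\<^bsub>Q \<mm>\<^esub> g"
    using Q.primeideal_iff_prime[of g] Q.primeness_condition[OF g(1)] g(1) by blast
  then have "monic_prime \<mm> (reduce G)"
    unfolding monic_prime_def using g(1,2) unfolding G by blast
  then show ?thesis using J_eq by blast
qed

end


section \<open>Irreducible quotients of \<open>U(m)\<close>\<close>

text \<open>Because I contains the annihilator J, whether the image of p lies in the image of I is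
  decided by p \<in> I; thus I is the annihilator of the new generator.\<close>

lemma presented_quotient:
  assumes M: "presented h M v J" and I: "left_closed h I" "J \<subseteq> I"
  shows "presented h (quotient_module M (cyclic_map h M v ` I)) (cyclic_map h M v ` I +>\<^bsub>M\<^esub> v) I"
proof -
  interpret Ah_left_module h M using M by (rule presentedD(1))
  have v: "v \<in> carrier M" using M by (rule presentedD(2))
  let ?N = "cyclic_map h M v ` I"
  have N: "Module.submodule ?N (Ah h) M" using v I(1) by (rule cyclic_image_submodule)
  note q = quotient_cyclic[OF Ah_left_module_axioms N v]
  have "cyclic_map h M v p \<in> ?N \<longleftrightarrow> p \<in> I" for p
  proof
    assume "cyclic_map h M v p \<in> ?N"
    then obtain p' where p': "cyclic_map h M v p = cyclic_map h M v p'" "p' \<in> I" by blast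
    have "p - p' \<in> J" using p'(1) unfolding cyclic_eq_iff[OF v] presentedD(4)[OF M] .
    then have "(p - p') + p' \<in> I" using I(2) p'(2) by (intro left_closedD(2)[OF I(1)]) blast+
    then show "p \<in> I" by simp
  qed (rule imageI)
  then have "{p. cyclic_map h (quotient_module M ?N) (?N +>\<^bsub>M\<^esub> v) p = \<zero>\<^bsub>quotient_module M ?N\<^esub>} = I"
    unfolding q(4) by simp
  then show ?thesis
    unfolding presented_def using q(1,2) q(5)[OF presentedD(3)[OF M]] by blast
qed

context Ah_left_module begin

lemma y_power_smult:
  assumes "v \<in> carrier M"
  shows "(Ah_y h [^]\<^bsub>Ah h\<^esub> i) \<odot>\<^bsub>M\<^esub> \<Phi> v p = \<Phi> v (Polynomial.monom 1 i * p)"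
proof (induction i arbitrary: p)
  case 0
  then show ?case using assms by (simp add: smult_one one_pCons[symmetric] monom_0)
next
  case (Suc i)
  have "(Ah_y h [^]\<^bsub>Ah h\<^esub> Suc i) \<odot>\<^bsub>M\<^esub> \<Phi> v p = (Ah_y h [^]\<^bsub>Ah h\<^esub> i) \<odot>\<^bsub>M\<^esub> (Ah_y h \<odot>\<^bsub>M\<^esub> \<Phi> v p)"
    unfolding R.nat_pow_Suc
    by (rule smult_assoc[OF R.nat_pow_closed[OF Ah_y_closed] Ah_y_closed cyclic_closed[OF assms]])
  also have "\<dots> = \<Phi> v (Polynomial.monom 1 i * pCons 0 p)"
    unfolding cyclic_y[OF assms, symmetric] by (rule Suc)
  also have "Polynomial.monom 1 i * pCons 0 p = Polynomial.monom 1 (Suc i) * p"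
    by (simp add: monom_Suc)
  finally show ?case .
qed

text \<open>This computes the action of a lift g on any cyclic module: the coefficient standing to
  the right of y^i acts first, through the twisted \<open>lmul\<close>, and y^i shifts the
  result.\<close>

lemma normal_form_smult:
  fixes n :: nat
  assumes "v \<in> carrier M"
  shows "(\<Oplus>\<^bsub>Ah h\<^esub> i\<in>{..n}. (Ah_y h [^]\<^bsub>Ah h\<^esub> i) \<otimes>\<^bsub>Ah h\<^esub> Ah_poly h (g i)) \<odot>\<^bsub>M\<^esub> \<Phi> v p =
    \<Phi> v (\<Sum>i\<le>n. Polynomial.monom 1 i * lmul h (g i) p)"
proof -
  let ?t = "\<lambda>i. (Ah_y h [^]\<^bsub>Ah h\<^esub> i) \<otimes>\<^bsub>Ah h\<^esub> Ah_poly h (g i)"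
  have t: "?t i \<in> carrier (Ah h)" for i :: nat
    by (intro R.m_closed R.nat_pow_closed Ah_y_closed Ah_poly_closed)
  have term_eq: "?t i \<odot>\<^bsub>M\<^esub> \<Phi> v p = \<Phi> v (Polynomial.monom 1 i * lmul h (g i) p)" for i
    unfolding smult_assoc[OF R.nat_pow_closed[OF Ah_y_closed] Ah_poly_closed cyclic_closed[OF assms]]
      cyclic_lmul[OF assms, symmetric] by (rule y_power_smult[OF assms])
  show ?thesis
  proof (induction n)
    case 0
    have "(\<Oplus>\<^bsub>Ah h\<^esub> i\<in>{..0::nat}. ?t i) = ?t 0"
      using R.finsum_singleton[of "0::nat" "{0}" ?t] t by simp
    then show ?case using term_eq[of 0] by simp
  next
    case (Suc n)
    have sum: "(\<Oplus>\<^bsub>Ah h\<^esub> i\<in>{..Suc n}. ?t i) = ?t (Suc n) \<oplus>\<^bsub>Ah h\<^esub> (\<Oplus>\<^bsub>Ah h\<^esub> i\<in>{..n}. ?t i)"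
      using t by (intro R.finsum_Suc) blast
    have closed: "(\<Oplus>\<^bsub>Ah h\<^esub> i\<in>{..n}. ?t i) \<in> carrier (Ah h)"
      using t by (intro R.finsum_closed) blast
    show ?case
      unfolding sum smult_l_distr[OF t closed cyclic_closed[OF assms]] Suc term_eq
        cyclic_add[OF assms, symmetric] by (simp add: add.commute)
  qed
qed

end

context irreducible_polynomial begin

text \<open>Modulo f the lift g acts as multiplication by a commutative polynomial, so g U(m) is the
  image of the ideal generated by f and that polynomial. This ideal depends only on gbar, which
  leaves G free to be any representative, in particular a monic one.\<close>

lemma L_presented:
  assumes h: "f dvd h" and G: "reduce G = gbar" and g: "g \<in> lifts h \<mm> gbar"
  shows "\<exists>l. presented h (L h \<mm> g) l (cong_multiples f G)"
proof -
  obtain u where u: "presented h (U h \<mm>) u {p. [:f:] dvd p}"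
    using U_presented by (rule exE)
  interpret Ah_left_module h "U h \<mm>" using u by (rule presentedD(1))
  have uc: "u \<in> carrier (U h \<mm>)" using u by (rule presentedD(2))
  obtain n c where n: "Polynomials.degree gbar \<le> n" and c: "\<forall>i\<le>n. c i \<in> ring.coeff K gbar i"
    and g_eq: "g = (\<Oplus>\<^bsub>Ah h\<^esub> i\<in>{..n}. (Ah_y h [^]\<^bsub>Ah h\<^esub> i) \<otimes>\<^bsub>Ah h\<^esub> Ah_poly h (c i))"
    using g unfolding lifts_def by blast
  \<comment> \<open>The polynomial belonging to the given lift g; it agrees with G only modulo
    f.\<close>
  define G' where "G' = (\<Sum>i\<le>n. Polynomial.monom (c i) i)"
  have "reduce G' = reduce G"
    unfolding G'_def G using n c by (intro lift_poly) (simp_all add: reduce_closed flip: G)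
  then have cong: "cong_multiples f G' = cong_multiples f G"
    unfolding reduce_eq_iff by (rule cong_multiples_cong)
  have g_smult: "g \<odot>\<^bsub>U h \<mm>\<^esub> \<Phi> u p = \<Phi> u (G' * p)" for p
  proof -
    have "(\<Sum>i\<le>n. Polynomial.monom 1 i * lmul h (c i) p) - G' * p =
        (\<Sum>i\<le>n. Polynomial.monom 1 i * (lmul h (c i) p - smult (c i) p))"
    proof -
      have "Polynomial.monom (c i) i = smult (c i) (Polynomial.monom 1 i)" for i by (simp add: smult_monom)
      then have "G' * p = (\<Sum>i\<le>n. Polynomial.monom 1 i * smult (c i) p)"
        unfolding G'_def sum_distrib_right by (intro sum.cong refl) simp
      then show ?thesis by (simp only: right_diff_distrib sum_subtractf)
    qed
    also have "[:f:] dvd \<dots>"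
      by (intro dvd_sum dvd_mult lmul_cong_smult[OF h])
    finally show ?thesis
      unfolding g_eq normal_form_smult[OF uc] cyclic_eq_iff[OF uc] presentedD(4)[OF u] by (rule CollectI)
  qed
  have "{g \<odot>\<^bsub>U h \<mm>\<^esub> w |w. w \<in> carrier (U h \<mm>)} = \<Phi> u ` cong_multiples f G'"
  proof
    show "{g \<odot>\<^bsub>U h \<mm>\<^esub> w |w. w \<in> carrier (U h \<mm>)} \<subseteq> \<Phi> u ` cong_multiples f G'"
    proof
      fix x assume "x \<in> {g \<odot>\<^bsub>U h \<mm>\<^esub> w |w. w \<in> carrier (U h \<mm>)}"
      then obtain w where w: "x = g \<odot>\<^bsub>U h \<mm>\<^esub> w" "w \<in> carrier (U h \<mm>)" by blast
      obtain p where p: "w = \<Phi> u p" using w(2) unfolding presentedD(3)[OF u] by blast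
      have "G' * p \<in> cong_multiples f G'" by (rule cong_multiplesI[of _ _ _ p]) simp
      then show "x \<in> \<Phi> u ` cong_multiples f G'" unfolding w(1) p g_smult by (rule imageI)
    qed
    show "\<Phi> u ` cong_multiples f G' \<subseteq> {g \<odot>\<^bsub>U h \<mm>\<^esub> w |w. w \<in> carrier (U h \<mm>)}"
    proof
      fix x assume "x \<in> \<Phi> u ` cong_multiples f G'"
      then obtain p where p: "x = \<Phi> u p" "p \<in> cong_multiples f G'" by blast
      obtain q where "[:f:] dvd p - G' * q" using p(2) unfolding cong_multiples_def by blast
      then have "\<Phi> u p = g \<odot>\<^bsub>U h \<mm>\<^esub> \<Phi> u q"
        unfolding g_smult cyclic_eq_iff[OF uc] presentedD(4)[OF u] by (rule CollectI)
      then show "x \<in> {g \<odot>\<^bsub>U h \<mm>\<^esub> w |w. w \<in> carrier (U h \<mm>)}"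
        unfolding p(1) using cyclic_closed[OF uc] by blast
    qed
  qed
  moreover have "presented h (quotient_module (U h \<mm>) (\<Phi> u ` cong_multiples f G'))
      (\<Phi> u ` cong_multiples f G' +>\<^bsub>U h \<mm>\<^esub> u) (cong_multiples f G')"
    using u left_closed_cong_multiples[OF h] const_multiples_subset by (rule presented_quotient)
  ultimately have "presented h (L h \<mm> g) (\<Phi> u ` cong_multiples f G' +>\<^bsub>U h \<mm>\<^esub> u) (cong_multiples f G)"
    unfolding L_def cong by simp
  then show ?thesis by (rule exI)
qed

lemma presented_cong_irreducible:
  assumes "f dvd h" "presented h M l (cong_multiples f G)" "ring_irreducible\<^bsub>Q \<mm>\<^esub> (reduce G)"
  shows "irreducible_module (Ah h) M"
  using presented_irreducibleI[OF assms(2) one_notin_cong_multiples[OF assms(3)]]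
    cong_multiples_maximal[OF assms(1,3)] by blast

lemma presented_cong_weight:
  assumes h: "f dvd h" and M: "presented h M l (cong_multiples f G)"
  shows "weight_module h M"
proof -
  interpret Ah_left_module h M using M by (rule presentedD(1))
  have "f dvd delta h s" for s using h by (simp add: delta_def)
  then have "lmul h f p \<in> cong_multiples f G" for p
    by (intro const_dvd_cong_multiples lmul_invariant_dvd dvd_refl)
  then have "carrier M = weight_space h M \<mm>"
    by (rule presented_weightI[OF M])
  then show ?thesis by (rule weight_moduleI[OF irreducible])
qed

text \<open>The last nonzero vector \<open>f\<^sup>k v\<close> has weight \<open>m\<close> and generates the module.\<close>

lemma irreducible_gen_weight_presented:
  assumes h: "f dvd h" and V: "irreducible_module (Ah h) V"
    and all: "carrier V = gen_weight_space h V \<mm>"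
  shows "\<exists>w G. monic_prime \<mm> (reduce G) \<and> presented h V w (cong_multiples f G)"
proof -
  have lm: "left_module (Ah h) V" and ne: "carrier V \<noteq> {\<zero>\<^bsub>V\<^esub>}"
    and simple: "\<And>N. Module.submodule N (Ah h) V \<Longrightarrow> N = {\<zero>\<^bsub>V\<^esub>} \<or> N = carrier V"
    using V unfolding irreducible_module_def by blast+
  interpret Ah_left_module h V using lm by (rule Ah_left_module.intro)
  obtain v where v: "v \<in> carrier V" "v \<noteq> \<zero>\<^bsub>V\<^esub>" using ne M.zero_closed by blast
  have "v \<in> gen_weight_space h V \<mm>" using v(1) all by simp
  then have ex: "\<exists>k. Ah_poly h (f ^ k) \<odot>\<^bsub>V\<^esub> v = \<zero>\<^bsub>V\<^esub>" unfolding gen_weight_space_PIdl by blast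
  define k where "k = (LEAST k. Ah_poly h (f ^ k) \<odot>\<^bsub>V\<^esub> v = \<zero>\<^bsub>V\<^esub>)"
  have k: "Ah_poly h (f ^ k) \<odot>\<^bsub>V\<^esub> v = \<zero>\<^bsub>V\<^esub>" unfolding k_def using ex by (rule LeastI_ex)
  have "k \<noteq> 0"
  proof
    assume "k = 0"
    then show False using k v(2) unfolding \<open>k = 0\<close> power_0 poly_smult_1[OF v(1)] by blast
  qed
  then obtain k' where k': "k = Suc k'" by (cases k) blast+
  define w where "w = Ah_poly h (f ^ k') \<odot>\<^bsub>V\<^esub> v"
  have w: "w \<in> carrier V" unfolding w_def using v(1) by (rule poly_smult_closed)
  have w0: "w \<noteq> \<zero>\<^bsub>V\<^esub>"
  proof -
    have "k' < k" unfolding k' by simp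
    then show ?thesis unfolding w_def k_def by (rule not_less_Least)
  qed
  have fw: "Ah_poly h f \<odot>\<^bsub>V\<^esub> w = \<zero>\<^bsub>V\<^esub>"
    using k unfolding k' power_Suc poly_smult_mult[OF v(1)] w_def .
  have surj: "carrier V = range (\<Phi> w)"
  proof -
    have "left_closed h UNIV" by (simp add: left_closed_def)
    then have "Module.submodule (range (\<Phi> w)) (Ah h) V" by (rule cyclic_image_submodule[OF w])
    then have "range (\<Phi> w) = {\<zero>\<^bsub>V\<^esub>} \<or> range (\<Phi> w) = carrier V" by (rule simple)
    moreover have "w \<in> range (\<Phi> w)" using cyclic_1[OF w] by (metis rangeI)
    ultimately show ?thesis using w0 by blast
  qed
  define J where "J = {p. \<Phi> w p = \<zero>\<^bsub>V\<^esub>}"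
  have pres: "presented h V w J"
    unfolding presented_def J_def using Ah_left_module_axioms w surj by blast
  have "Module.submodule {\<zero>\<^bsub>V\<^esub>} (Ah h) V" by (rule submoduleI') simp_all
  from cyclic_vimage_left_closed[OF w this] have J: "left_closed h J" unfolding J_def by simp
  have fJ: "{p. [:f:] dvd p} \<subseteq> J"
  proof
    fix p assume "p \<in> {p. [:f:] dvd p}"
    then obtain q where q: "p = smult f q" unfolding mem_Collect_eq const_dvd_iff_smult by blast
    show "p \<in> J" unfolding q J_def mem_Collect_eq cyclic_smult[OF w] fw by (rule cyclic_of_zero)
  qed
  have J1: "1 \<notin> J" unfolding J_def mem_Collect_eq cyclic_1[OF w] by (rule w0)
  \<comment> \<open>The image of J' is a nonzero submodule, hence all of V, so it contains w =
    \<Phi> w q with q \<in> J'. The difference 1 - q kills w and lies in J, so 1 lies in J'.\<close>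
  have max: "1 \<in> J'" if J': "left_closed h J'" "J \<subset> J'" for J'
  proof -
    have "Module.submodule (\<Phi> w ` J') (Ah h) V" using w J'(1) by (rule cyclic_image_submodule)
    then have "\<Phi> w ` J' = {\<zero>\<^bsub>V\<^esub>} \<or> \<Phi> w ` J' = carrier V" by (rule simple)
    moreover have "\<Phi> w ` J' \<noteq> {\<zero>\<^bsub>V\<^esub>}" using J'(2) unfolding J_def by blast
    ultimately have "w \<in> \<Phi> w ` J'" using w by simp
    then obtain q where q: "w = \<Phi> w q" "q \<in> J'" by blast
    have "\<Phi> w 1 = \<Phi> w q" unfolding cyclic_1[OF w] by (rule q(1))
    then have "1 - q \<in> J" unfolding cyclic_eq_iff[OF w] J_def by (rule CollectI)
    then have "(1 - q) + q \<in> J'" using J'(2) q(2) by (intro left_closedD(2)[OF J'(1)]) blast+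
    then show ?thesis by simp
  qed
  obtain G where "monic_prime \<mm> (reduce G)" "J = cong_multiples f G"
    using maximal_left_closed[OF h J fJ J1 max] by blast
  then show ?thesis using pres by blast
qed


section \<open>Dimension\<close>

lemma monic_lift:
  assumes gbar: "gbar \<in> carrier (Q \<mm>)" "Polynomials.lead_coeff gbar = \<one>\<^bsub>K\<^esub>" "gbar \<noteq> []"
  shows "\<exists>G. reduce G = gbar \<and> Polynomial.lead_coeff G = 1 \<and> Polynomial.degree G = Polynomials.degree gbar"
proof -
  interpret K: field K by (rule field_K)
  define d where "d = Polynomials.degree gbar"
  obtain H where H: "gbar = reduce H" using reduce_surj[OF gbar(1)] by blast
  \<comment> \<open>The top coset is that of 1, and 1 itself is chosen as its representative, so
    that the lift is monic over F[x] and keeps the degree of gbar.\<close>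
  define c where "c i = (if i = d then 1 else Polynomial.coeff H i)" for i
  have "c i \<in> K.coeff gbar i" for i
  proof (cases "i = d")
    case True
    have "K.coeff gbar i = cls 1" using K.lead_coeff_simp[OF gbar(3)] gbar(2) True unfolding d_def by (simp only: cls_1)
    then show ?thesis using True mem_cls_iff[of 1 1] by (simp add: c_def)
  next
    case False
    then show ?thesis using mem_cls_iff[of "Polynomial.coeff H i" "Polynomial.coeff H i"] unfolding H coeff_reduce by (simp add: c_def flip: H)
  qed
  then have red: "reduce (\<Sum>i\<le>d. Polynomial.monom (c i) i) = gbar" unfolding d_def by (intro lift_poly[OF gbar(1) order_refl])
  let ?G = "\<Sum>i\<le>d. Polynomial.monom (c i) i"
  have c_coeff: "Polynomial.coeff ?G i = (if i \<le> d then c i else 0)" for i by (simp add: coeff_sum)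
  have "Polynomial.degree ?G = d"
  proof (rule antisym)
    show "Polynomial.degree ?G \<le> d" by (rule degree_le) (simp add: c_coeff)
    show "d \<le> Polynomial.degree ?G" by (rule le_degree) (simp only: c_coeff, simp add: c_def)
  qed
  moreover have "Polynomial.coeff ?G d = 1" unfolding c_coeff by (simp add: c_def)
  ultimately show ?thesis using red unfolding d_def[symmetric] by (intro exI[of _ ?G]) simp
qed

lemma coeff_mod_eq_0:
  assumes "Polynomial.degree f \<le> j" shows "Polynomial.coeff (a mod f) j = 0"
proof (cases "a mod f = 0")
  case False
  have "f \<noteq> 0" using irreducible by auto
  with False have "Polynomial.degree (a mod f) < j" using degree_mod_less[of f a] assms by simp
  then show ?thesis by (rule coeff_eq_0)
qed simp

text \<open>Existence of normal forms: pseudo-division by a monic G is genuine division and bounds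
  the y-degree; taking coefficients modulo f bounds the x-degree.\<close>

lemma reduce_mod_monic:
  assumes G: "Polynomial.lead_coeff G = 1"
  shows "\<exists>q. p - q \<in> cong_multiples f G \<and> (\<forall>i\<ge>Polynomial.degree G. Polynomial.coeff q i = 0) \<and>
    (\<forall>i. \<forall>j\<ge>Polynomial.degree f. Polynomial.coeff (Polynomial.coeff q i) j = 0)"
proof -
  have "G \<noteq> 0" using G by auto
  obtain s r where sr: "pseudo_divmod p G = (s, r)" by (cases "pseudo_divmod p G")
  have p: "p = G * s + r" using pseudo_divmod(1)[OF \<open>G \<noteq> 0\<close> sr] G by simp
  have r: "Polynomial.coeff r i = 0" if "i \<ge> Polynomial.degree G" for i
    using pseudo_divmod(2)[OF \<open>G \<noteq> 0\<close> sr] that by (auto intro: coeff_eq_0)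
  define q where "q = map_poly (\<lambda>a. a mod f) r"
  have q: "Polynomial.coeff q i = Polynomial.coeff r i mod f" for i unfolding q_def by (rule coeff_map_poly) simp
  have "[:f:] dvd r - q" unfolding const_poly_dvd_iff by (simp add: q minus_mod_eq_mult_div)
  moreover have "p - q - G * s = r - q" unfolding p by simp
  ultimately have "[:f:] dvd p - q - G * s" by (simp only:)
  then have "p - q \<in> cong_multiples f G" by (rule cong_multiplesI)
  moreover have "Polynomial.coeff (Polynomial.coeff q i) j = 0" if "j \<ge> Polynomial.degree f" for i j
    unfolding q using that by (rule coeff_mod_eq_0)
  ultimately show ?thesis using r by (intro exI[of _ q]) (simp add: q)
qed

text \<open>Uniqueness of normal forms: a nonzero cofactor of G, once reduced modulo f, would leave
  a top coefficient that f cannot divide.\<close>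

lemma cong_multiples_small_zero:
  assumes G: "Polynomial.lead_coeff G = 1" and q: "q \<in> cong_multiples f G" "\<And>i. i \<ge> Polynomial.degree G \<Longrightarrow> Polynomial.coeff q i = 0"
    "\<And>i j. j \<ge> Polynomial.degree f \<Longrightarrow> Polynomial.coeff (Polynomial.coeff q i) j = 0"
  shows "q = 0"
proof -
  have small: "a = 0" if "f dvd a" "\<And>j. j \<ge> Polynomial.degree f \<Longrightarrow> Polynomial.coeff a j = 0" for a
  proof (rule ccontr)
    assume "a \<noteq> 0"
    then have "Polynomial.degree f \<le> Polynomial.degree a" using that(1) by (rule dvd_imp_degree_le[rotated])
    then show False using that(2)[of "Polynomial.degree a"] \<open>a \<noteq> 0\<close> by simp
  qed
  obtain s0 where s0: "[:f:] dvd q - G * s0" using q(1) unfolding cong_multiples_def by blast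
  \<comment> \<open>Reducing the cofactor modulo f changes the product only by a multiple of f, and
    afterwards a coefficient of s divisible by f must be zero.\<close>
  define s where "s = map_poly (\<lambda>a. a mod f) s0"
  have s: "Polynomial.coeff s i = Polynomial.coeff s0 i mod f" for i unfolding s_def by (rule coeff_map_poly) simp
  have "[:f:] dvd s0 - s" unfolding const_poly_dvd_iff by (simp add: s minus_mod_eq_mult_div)
  then have "[:f:] dvd (q - G * s0) + G * (s0 - s)" using s0 by (intro dvd_add dvd_mult)
  then have qs: "[:f:] dvd q - G * s" by (simp add: algebra_simps)
  have "s = 0"
  proof (rule ccontr)
    assume "s \<noteq> 0"
    \<comment> \<open>In this degree q has no term and G contributes its leading coefficient 1, so
      only the leading coefficient of s remains.\<close>
    have "Polynomial.coeff (q - G * s) (Polynomial.degree G + Polynomial.degree s) = - Polynomial.lead_coeff s"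
      using q(2)[of "Polynomial.degree G + Polynomial.degree s"] G by (simp add: coeff_mult_degree_sum)
    moreover have "f dvd Polynomial.coeff (q - G * s) (Polynomial.degree G + Polynomial.degree s)"
      using qs unfolding const_poly_dvd_iff by blast
    ultimately have "f dvd Polynomial.lead_coeff s" by simp
    then have "Polynomial.lead_coeff s = 0" using coeff_mod_eq_0 unfolding s by (intro small)
    then show False using \<open>s \<noteq> 0\<close> by simp
  qed
  then have "f dvd Polynomial.coeff q i" for i using qs unfolding const_poly_dvd_iff by simp
  then have "Polynomial.coeff q i = 0" for i using q(3) by (intro small)
  then show ?thesis by (intro poly_eqI) simp
qed

lemma coeff_sum_basis:
  assumes "finite A"
  shows "Polynomial.coeff (Polynomial.coeff (\<Sum>t\<in>A. smult [:c t:] (case t of (i, j) \<Rightarrow> Polynomial.monom (Polynomial.monom 1 j) i)) i) j =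
    (if (i, j) \<in> A then c (i, j) else (0 :: 'a))"
proof -
  have "Polynomial.coeff (Polynomial.coeff (smult [:c t:] (case t of (i, j) \<Rightarrow> Polynomial.monom (Polynomial.monom 1 j) i)) i) j =
      (if t = (i, j) then c (i, j) else 0)" for t
    by (cases t) auto
  then show ?thesis using assms by (simp add: coeff_sum sum.delta')
qed

text \<open>The basis consists of the images of the y^i x^j with i < deg G and j < deg f. Existence
  of normal forms shows that they span, uniqueness that they are independent.\<close>

lemma presented_has_dimension:
  assumes M: "presented h M l (cong_multiples f G)" and G: "Polynomial.lead_coeff G = 1"
  shows "has_dimension h M (Polynomial.degree f * Polynomial.degree G)"
proof -
  interpret M: Ah_left_module h M using M by (rule presentedD(1))
  have l: "l \<in> carrier M" using M by (rule presentedD(2))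
  let ?V = "scalar_restriction h M" and ?F = "ring_of_type_algebra :: 'a ring"
  have V_simps: "carrier ?V = carrier M" "\<zero>\<^bsub>?V\<^esub> = \<zero>\<^bsub>M\<^esub>" "ring.add ?V = ring.add M"
    "\<And>c v. c \<odot>\<^bsub>?V\<^esub> v = Ah_poly h [:c:] \<odot>\<^bsub>M\<^esub> v"
    by (simp_all add: scalar_restriction_def)
  have "abelian_group ?V"
    using M.M.abelian_group_axioms unfolding abelian_group_iff_comm_group V_simps
    by (rule comm_group_change_extension)
  moreover have "module_axioms ?F ?V"
  proof
    show "(a \<oplus>\<^bsub>?F\<^esub> b) \<odot>\<^bsub>?V\<^esub> v = a \<odot>\<^bsub>?V\<^esub> v \<oplus>\<^bsub>?V\<^esub> b \<odot>\<^bsub>?V\<^esub> v" if "v \<in> carrier ?V" for a b v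
      using M.poly_smult_add[of v "[:a:]" "[:b:]"] that unfolding V_simps by simp
    show "(a \<otimes>\<^bsub>?F\<^esub> b) \<odot>\<^bsub>?V\<^esub> v = a \<odot>\<^bsub>?V\<^esub> (b \<odot>\<^bsub>?V\<^esub> v)" if "v \<in> carrier ?V" for a b v
      using M.poly_smult_mult[of v "[:a:]" "[:b:]"] that unfolding V_simps by (simp add: mult.commute)
    show "a \<odot>\<^bsub>?V\<^esub> (v \<oplus>\<^bsub>?V\<^esub> w) = a \<odot>\<^bsub>?V\<^esub> v \<oplus>\<^bsub>?V\<^esub> a \<odot>\<^bsub>?V\<^esub> w"
      if "v \<in> carrier ?V" "w \<in> carrier ?V" for a v w
      using that unfolding V_simps by (intro M.smult_r_distr Ah_poly_closed)
    show "\<one>\<^bsub>?F\<^esub> \<odot>\<^bsub>?V\<^esub> v = v" if "v \<in> carrier ?V" for v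
      using that M.poly_smult_1[of v] unfolding V_simps by (simp add: one_pCons)
    show "a \<odot>\<^bsub>?V\<^esub> v \<in> carrier ?V" if "v \<in> carrier ?V" for a v
      using that M.poly_smult_closed unfolding V_simps by blast
  qed
  ultimately have "Module.module ?F ?V"
    by (intro Module.module.intro cring_from_type_algebra)
  then have vs: "vectorspace ?F ?V"
    by (intro vectorspace.intro field_from_type_algebra)
  interpret V: vectorspace ?F ?V by (rule vs)
  let ?I = "{..<Polynomial.degree G} \<times> {..<Polynomial.degree f}"
  let ?B = "\<lambda>(i, j). Polynomial.monom (Polynomial.monom (1 :: 'a) j) i"
  define b where "b t = cyclic_map h M l (?B t)" for t
  have B_coeff: "Polynomial.coeff (Polynomial.coeff (?B t) i) j = (if t = (i, j) then 1 else 0)" for t i j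
    by (cases t) auto
  have b_closed: "b t \<in> carrier M" for t unfolding b_def using l by (rule M.cyclic_closed)
  \<comment> \<open>Linear combinations take their coefficients as functions on vectors, so distinct
    indices must give distinct vectors; the cardinality of the basis depends on this as
    well.\<close>
  have inj: "inj_on b ?I"
  proof (rule inj_onI)
    fix t t' assume t: "t \<in> ?I" "t' \<in> ?I" and eq: "b t = b t'"
    from eq have "?B t - ?B t' \<in> cong_multiples f G"
      unfolding b_def M.cyclic_eq_iff[OF l] presentedD(4)[OF M] .
    moreover have "Polynomial.coeff (?B t) i = 0" if "t \<in> ?I" "i \<ge> Polynomial.degree G" for t i
      using that by (cases t) auto
    moreover have "Polynomial.coeff (Polynomial.coeff (?B t) i) j = 0" if "t \<in> ?I" "j \<ge> Polynomial.degree f" for t i j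
      using that unfolding B_coeff by auto
    ultimately have "?B t - ?B t' = 0"
      using t by (intro cong_multiples_small_zero[OF G]) simp_all
    then have "Polynomial.coeff (Polynomial.coeff (?B t) (fst t)) (snd t) = Polynomial.coeff (Polynomial.coeff (?B t') (fst t)) (snd t)" by simp
    then show "t = t'" unfolding B_coeff by (simp split: if_splits)
  qed
  have lincomb: "V.lincomb a (b ` A) = cyclic_map h M l (\<Sum>t\<in>A. smult [:a (b t):] (?B t))"
    if "A \<subseteq> ?I" for a A
  proof -
    have "finite A" using that by (rule finite_subset) simp
    then show ?thesis using that
    proof (induction A)
      case empty
      then show ?case by (simp add: V.lincomb_def V_simps)
    next
      case (insert t A)
      have "b t \<notin> b ` A"
        using inj_on_image_mem_iff[OF inj, of t A] insert.hyps(2) insert.prems by simp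
      then have "V.lincomb a (b ` insert t A) = a (b t) \<odot>\<^bsub>?V\<^esub> b t \<oplus>\<^bsub>?V\<^esub> V.lincomb a (b ` A)"
        unfolding V.lincomb_def image_insert using insert(1) b_closed
        by (intro V.finsum_insert) (auto simp: V_simps intro!: M.poly_smult_closed b_closed)
      \<comment> \<open>Scalars of F are central: left multiplication by a constant equals
        \<open>smult\<close> by it, so a scalar multiple of a basis vector is the image of a scaled
        monomial.\<close>
      also have "\<dots> = cyclic_map h M l (smult [:a (b t):] (?B t) + (\<Sum>t\<in>A. smult [:a (b t):] (?B t)))"
        using insert unfolding V_simps b_def M.cyclic_add[OF l] lmul_const_left[of h, symmetric] M.cyclic_lmul[OF l] by simp
      finally show ?case using insert(1,2) by simp
    qed
  qed
  have indpt: "V.lin_indpt (b ` ?I)"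
  proof (rule V.finite_lin_indpt2)
    show "finite (b ` ?I)" by simp
    show "b ` ?I \<subseteq> carrier ?V" using b_closed unfolding V_simps by blast
    fix a assume "V.lincomb a (b ` ?I) = \<zero>\<^bsub>?V\<^esub>"
    then have mem: "(\<Sum>t\<in>?I. smult [:a (b t):] (?B t)) \<in> cong_multiples f G"
      unfolding lincomb[OF order_refl] V_simps presentedD(4)[OF M] .
    have c_coeff: "Polynomial.coeff (Polynomial.coeff (\<Sum>t\<in>?I. smult [:a (b t):] (?B t)) i) j = (if (i, j) \<in> ?I then a (b (i, j)) else 0)" for i j
      by (rule coeff_sum_basis) simp
    have "(\<Sum>t\<in>?I. smult [:a (b t):] (?B t)) = 0"
    proof (rule cong_multiples_small_zero[OF G mem])
      show "Polynomial.coeff (\<Sum>t\<in>?I. smult [:a (b t):] (?B t)) i = 0" if "Polynomial.degree G \<le> i" for i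
        using that by (intro poly_eqI) (simp add: c_coeff)
      show "Polynomial.coeff (Polynomial.coeff (\<Sum>t\<in>?I. smult [:a (b t):] (?B t)) i) j = 0" if "Polynomial.degree f \<le> j" for i j
        using that by (simp add: c_coeff)
    qed
    then have "a (b (i, j)) = 0" if "(i, j) \<in> ?I" for i j
      using c_coeff[of i j] that by simp
    then show "\<forall>v\<in>b ` ?I. a v = \<zero>\<^bsub>?F\<^esub>" by auto
  qed
  have gen: "V.gen_set (b ` ?I)"
  proof
    show "V.span (b ` ?I) \<subseteq> carrier ?V"
      using b_closed by (intro V.span_is_subset2) (auto simp: V_simps)
    show "carrier ?V \<subseteq> V.span (b ` ?I)"
    proof
      fix v assume "v \<in> carrier ?V"
      then obtain p where p: "v = cyclic_map h M l p" unfolding V_simps presentedD(3)[OF M] by blast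
      obtain q where q: "p - q \<in> cong_multiples f G" "\<forall>i\<ge>Polynomial.degree G. Polynomial.coeff q i = 0"
        "\<forall>i. \<forall>j\<ge>Polynomial.degree f. Polynomial.coeff (Polynomial.coeff q i) j = 0"
        using reduce_mod_monic[OF G, of p] by blast
      \<comment> \<open>The coefficients of the normal form q, transported from index pairs to
        vectors through the inverse of \<open>b\<close>.\<close>
      define a where "a v = (case inv_into ?I b v of (i, j) \<Rightarrow> Polynomial.coeff (Polynomial.coeff q i) j)" for v
      have ab: "a (b (i, j)) = Polynomial.coeff (Polynomial.coeff q i) j" if "(i, j) \<in> ?I" for i j
        unfolding a_def inv_into_f_f[OF inj that] by simp
      have "q = (\<Sum>t\<in>?I. smult [:a (b t):] (?B t))"
      proof (intro poly_eqI)
        fix i j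
        have c: "Polynomial.coeff (Polynomial.coeff (\<Sum>t\<in>?I. smult [:a (b t):] (?B t)) i) j = (if (i, j) \<in> ?I then a (b (i, j)) else 0)"
          by (rule coeff_sum_basis) simp
        show "Polynomial.coeff (Polynomial.coeff q i) j = Polynomial.coeff (Polynomial.coeff (\<Sum>t\<in>?I. smult [:a (b t):] (?B t)) i) j"
          unfolding c using ab[of i j] q(2,3) by (auto simp: not_less)
      qed
      then have "v = V.lincomb a (b ` ?I)"
        using q(1) unfolding p lincomb[OF order_refl] M.cyclic_eq_iff[OF l] presentedD(4)[OF M] by simp
      then show "v \<in> V.span (b ` ?I)"
        unfolding V.span_def by (intro CollectI exI[of _ a] exI[of _ "b ` ?I"]) simp
    qed
  qed
  have sub: "b ` ?I \<subseteq> carrier ?V" using b_closed unfolding V_simps by blast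
  have fin: "finite (b ` ?I)" by simp
  have "V.dim = card (b ` ?I)"
    using fin by (rule V.dim_basis) (simp only: V.basis_def indpt gen sub simp_thms)
  moreover have "card (b ` ?I) = Polynomial.degree f * Polynomial.degree G"
    using card_image[OF inj] by (simp add: card_cartesian_product)
  moreover have "V.fin_dim" unfolding V.fin_dim_def using fin sub gen by blast
  ultimately show ?thesis unfolding has_dimension_def using vs by simp
qed

end

text \<open>The quotient by gbar U(m) is formed with an explicit lift g, so the statements about it
  quantify over all lifts; this expresses that the choice of lift does not matter.\<close>

theorem theorem4p7:
  fixes h f :: "'a::field poly" and m :: "'a poly set"
  assumes "h \<noteq> 0" and "Factorial_Ring.irreducible f" and "m = PIdl\<^bsub>Fx\<^esub> f"
  shows
    "(carrier (U h m) = gen_weight_space h (U h m) m \<and> gen_weight_module h (U h m) \<and>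
      (delta_invariant h m \<longrightarrow>
         carrier (U h m) = weight_space h (U h m) m \<and> weight_module h (U h m)))
     \<and>
     (f dvd h \<longrightarrow>
        carrier (U h m) = weight_space h (U h m) m \<and>
        (\<forall>gbar g. monic_prime m gbar \<and> g \<in> lifts h m gbar \<longrightarrow>
           irreducible_module (Ah h) (L h m g) \<and> weight_module h (L h m g) \<and>
           has_dimension h (L h m g) (Polynomial.degree f * Polynomials.degree gbar)) \<and>
        (\<forall>V :: ('a, 'v) Ah_module.
           irreducible_module (Ah h) V \<and> gen_weight_module h V \<and>
           carrier V = gen_weight_space h V m \<longrightarrow>
           (\<exists>gbar. monic_prime m gbar \<and>
              (\<forall>g \<in> lifts h m gbar. isomorphic_modules (Ah h) V (L h m g)))))
     \<and>
     (CHAR('a) = 0 \<and> \<not> f dvd h \<longrightarrow>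
        carrier (U h m) = gen_weight_space h (U h m) m \<and>
        irreducible_module (Ah h) (U h m) \<and> gen_weight_module h (U h m))"
proof -
  note m = assms(3)
  interpret irreducible_polynomial f using assms(2) by (rule irreducible_polynomial.intro)
  obtain u where u: "presented h (U h m) u {p. [:f:] dvd p}"
    unfolding m using U_presented by (rule exE)
  interpret U: Ah_left_module h "U h m" using u by (rule presentedD(1))
  have gen: "carrier (U h m) = gen_weight_space h (U h m) m"
    unfolding m by (rule U_gen_weight)
  have gen_mod: "gen_weight_module h (U h m)"
    using U.gen_weight_moduleI[OF assms(2)] gen unfolding m by blast
  have weight: "carrier (U h m) = weight_space h (U h m) m" if "delta_invariant h m"
    using that unfolding m by (rule U_weight)
  have weight_mod: "weight_module h (U h m)" if "delta_invariant h m"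
    using U.weight_moduleI[OF assms(2)] weight[OF that] unfolding m by blast
  \<comment> \<open>If f divides h, every value of \<delta> is a multiple of f. This reduces the
    weight statement for f dividing h to the one for \<delta>-invariant m.\<close>
  have inv: "delta_invariant h m" if "f dvd h"
    using that unfolding delta_invariant_def m PIdl_Fx by (auto simp: delta_def)
  have L: "irreducible_module (Ah h) (L h m g) \<and> weight_module h (L h m g) \<and>
      has_dimension h (L h m g) (Polynomial.degree f * Polynomials.degree gbar)"
    if h: "f dvd h" and gbar: "monic_prime m gbar" and g: "g \<in> lifts h m gbar" for gbar g
  proof -
    have gbar': "gbar \<in> carrier (Q m)" "ring_irreducible\<^bsub>Q m\<^esub> gbar"
        "Polynomials.lead_coeff gbar = \<one>\<^bsub>Fx Quot m\<^esub>"
      using gbar unfolding monic_prime_def by blast+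
    have "gbar \<noteq> []"
      using gbar'(2) unfolding ring_irreducible_def Q_def univ_poly_zero by blast
    then obtain G where G: "reduce G = gbar" "Polynomial.lead_coeff G = 1"
        "Polynomial.degree G = Polynomials.degree gbar"
      using monic_lift[of gbar] gbar'(1,3) unfolding m by blast
    obtain l where l: "presented h (L h m g) l (cong_multiples f G)"
      using L_presented[OF h G(1)] g unfolding m by blast
    have "irreducible_module (Ah h) (L h m g)"
      using presented_cong_irreducible[OF h l] gbar'(2) unfolding G(1) m by blast
    then show ?thesis
      using presented_cong_weight[OF h l] presented_has_dimension[OF l G(2)] unfolding G(3) by blast
  qed
  have V: "\<exists>gbar. monic_prime m gbar \<and> (\<forall>g\<in>lifts h m gbar. isomorphic_modules (Ah h) V (L h m g))"
    if h: "f dvd h" and V: "irreducible_module (Ah h) V" "carrier V = gen_weight_space h V m"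
    for V :: "('a, 'v) Ah_module"
  proof -
    obtain w G where G: "monic_prime m (reduce G)" and w: "presented h V w (cong_multiples f G)"
      using irreducible_gen_weight_presented[OF h V(1)] V(2) unfolding m by blast
    \<comment> \<open>Every lift of the same gbar yields a module presented by the same ideal as
      V.\<close>
    have "isomorphic_modules (Ah h) V (L h m g)" if g: "g \<in> lifts h m (reduce G)" for g
    proof -
      obtain l where "presented h (L h m g) l (cong_multiples f G)"
        using L_presented[OF h refl] g unfolding m by blast
      with w show ?thesis by (rule presented_isomorphic)
    qed
    with G show ?thesis by blast
  qed
  have irr: "irreducible_module (Ah h) (U h m)" if "CHAR('a) = 0" "\<not> f dvd h"
    using U_irreducible[OF assms(2) that] unfolding m .
  show ?thesis
  proof (intro conjI impI allI)
    show "irreducible_module (Ah h) (L h m g)" "weight_module h (L h m g)"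
        "has_dimension h (L h m g) (Polynomial.degree f * Polynomials.degree gbar)"
      if "f dvd h" "monic_prime m gbar \<and> g \<in> lifts h m gbar" for gbar g
      using L that by blast+
    show "\<exists>gbar. monic_prime m gbar \<and> (\<forall>g\<in>lifts h m gbar. isomorphic_modules (Ah h) V (L h m g))"
      if "f dvd h" "irreducible_module (Ah h) V \<and> gen_weight_module h V \<and> carrier V = gen_weight_space h V m"
      for V :: "('a, 'v) Ah_module"
      using V[OF that(1)] that(2) by blast
  qed (use gen gen_mod weight weight_mod inv irr in blast)+
qed

end
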